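(* There is a polynomial-time algorithm that, given an (unweighted) interval graph $G$, outputs a proper coloring of $G$ whose entropy is at most the minimum entropy of a proper coloring of $G$ plus 1 bit.
   Context: For an undirected graph $G=(V,E)$ with $n=|V|$, a proper coloring $\phi: V\to\mathbb{N}^+$ has entropy $-\sum_i p_i\log p_i$ where $p_i := |\phi^{-1}(i)|/n$ (logarithms base 2, $0\log 0:=0$). An interval graph is the intersection graph of a finite family of intervals of the real line. *)

theory Defs
  imports "HOL-Analysis.Analysis" "HOL-Computational_Algebra.Polynomial"
begin

section \<open>Graphs, colorings and entropy\<close>

definition simple_graph :: "'a set \<Rightarrow> 'a set set \<Rightarrow> bool" where
  "simple_graph V E \<longleftrightarrow> finite V \<and> (\<forall>e\<in>E. \<exists>u\<in>V. \<exists>v\<in>V. u \<noteq> v \<and> e = {u, v})"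

text \<open>The intervals may be open, closed, half-open or unbounded, and distinct vertices may be
  represented by the same interval.\<close>

definition interval_graph :: "'a set \<Rightarrow> 'a set set \<Rightarrow> bool" where
  "interval_graph V E \<longleftrightarrow> simple_graph V E \<and>
     (\<exists>I :: 'a \<Rightarrow> real set.
        (\<forall>v\<in>V. is_interval (I v) \<and> I v \<noteq> {}) \<and>
        (\<forall>u\<in>V. \<forall>v\<in>V. u \<noteq> v \<longrightarrow> ({u, v} \<in> E \<longleftrightarrow> I u \<inter> I v \<noteq> {})))"

definition proper_coloring :: "'a set \<Rightarrow> 'a set set \<Rightarrow> ('a \<Rightarrow> nat) \<Rightarrow> bool" where
  "proper_coloring V E \<phi> \<longleftrightarrow>
     (\<forall>v\<in>V. \<phi> v > 0) \<and> (\<forall>u\<in>V. \<forall>v\<in>V. {u, v} \<in> E \<longrightarrow> \<phi> u \<noteq> \<phi> v)"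

definition color_freq :: "'a set \<Rightarrow> ('a \<Rightarrow> nat) \<Rightarrow> nat \<Rightarrow> real" where
  "color_freq V \<phi> i = real (card {v \<in> V. \<phi> v = i}) / real (card V)"

text \<open>Only the colors in use are summed over; every other color contributes \<open>0 log 0 = 0\<close>.\<close>

definition color_entropy :: "'a set \<Rightarrow> ('a \<Rightarrow> nat) \<Rightarrow> real" where
  "color_entropy V \<phi> = - (\<Sum>i\<in>\<phi> ` V. color_freq V \<phi> i * log 2 (color_freq V \<phi> i))"

definition min_entropy :: "'a set \<Rightarrow> 'a set set \<Rightarrow> real" where
  "min_entropy V E = Min (color_entropy V ` {\<phi>. proper_coloring V E \<phi>})"

text \<open>The minimum ranges over infinitely many colorings, but the entropy depends only on the
  partition into color classes, so it takes finitely many values.\<close>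

lemma color_entropy_partition:
  assumes "finite V"
  shows "color_entropy V \<phi> =
    - (\<Sum>v\<in>V. log 2 (real (card {u \<in> V. \<phi> u = \<phi> v}) / real (card V)) / real (card V))"
proof -
  let ?g = "\<lambda>v. log 2 (real (card {u \<in> V. \<phi> u = \<phi> v}) / real (card V)) / real (card V)"
  have "(\<Sum>v\<in>V. ?g v) = (\<Sum>i\<in>\<phi> ` V. \<Sum>v\<in>{v \<in> V. \<phi> v = i}. ?g v)"
    by (rule sum.image_gen[OF assms])
  also have "\<dots> = (\<Sum>i\<in>\<phi> ` V. color_freq V \<phi> i * log 2 (color_freq V \<phi> i))"
  proof (rule sum.cong[OF refl])
    fix i
    have "(\<Sum>v\<in>{v \<in> V. \<phi> v = i}. ?g v) =
      (\<Sum>v\<in>{v \<in> V. \<phi> v = i}. log 2 (color_freq V \<phi> i) / real (card V))"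
      by (rule sum.cong) (auto simp: color_freq_def)
    then show "(\<Sum>v\<in>{v \<in> V. \<phi> v = i}. ?g v) = color_freq V \<phi> i * log 2 (color_freq V \<phi> i)"
      by (simp add: color_freq_def)
  qed
  finally show ?thesis by (simp add: color_entropy_def)
qed

lemma finite_color_entropies:
  assumes "finite V"
  shows "finite (color_entropy V ` A)"
proof -
  let ?F = "\<lambda>R. - (\<Sum>v\<in>V. log 2 (real (card {u \<in> V. (u, v) \<in> R}) / real (card V)) / real (card V))"
  have "color_entropy V \<phi> = ?F {(u, v) \<in> V \<times> V. \<phi> u = \<phi> v}" for \<phi>
    unfolding color_entropy_partition[OF assms]
    by (intro arg_cong[where f = uminus] sum.cong refl arg_cong[where f = "\<lambda>k. log 2 (real k / real (card V)) / real (card V)"]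
        arg_cong[where f = card]) auto
  then have "color_entropy V ` A \<subseteq> ?F ` Pow (V \<times> V)" by blast
  moreover have "finite (?F ` Pow (V \<times> V))" using assms by blast
  ultimately show ?thesis by (rule finite_subset)
qed

lemma proper_coloring_exists:
  fixes V :: "'a set"
  assumes "simple_graph V E"
  shows "\<exists>\<phi>. proper_coloring V E \<phi>"
proof -
  from assms have "finite V" by (simp add: simple_graph_def)
  then obtain f :: "'a \<Rightarrow> nat" where f: "inj_on f V"
    using finite_imp_inj_to_nat_seg by blast
  have "u \<noteq> v" if "{u, v} \<in> E" for u v
  proof
    assume "u = v"
    with that assms obtain a b where "a \<noteq> b" "{u} = {a, b}"
      unfolding simple_graph_def by (metis insert_absorb2)
    then show False by (metis insertI1 insert_subset singletonD subset_refl)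
  qed
  with f have "proper_coloring V E (\<lambda>v. Suc (f v))"
    by (auto simp: proper_coloring_def inj_on_eq_iff)
  then show ?thesis by blast
qed

lemma min_entropy_attained:
  assumes "simple_graph V E"
  shows "\<exists>\<phi>. proper_coloring V E \<phi> \<and> color_entropy V \<phi> = min_entropy V E"
    and "proper_coloring V E \<psi> \<Longrightarrow> min_entropy V E \<le> color_entropy V \<psi>"
proof -
  let ?S = "color_entropy V ` {\<phi>. proper_coloring V E \<phi>}"
  have fin: "finite ?S" using assms by (simp add: finite_color_entropies simple_graph_def)
  have ne: "?S \<noteq> {}" using proper_coloring_exists[OF assms] by simp
  show "\<exists>\<phi>. proper_coloring V E \<phi> \<and> color_entropy V \<phi> = min_entropy V E"
    using Min_in[OF fin ne] unfolding min_entropy_def by auto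
  show "min_entropy V E \<le> color_entropy V \<psi>" if "proper_coloring V E \<psi>"
    using fin that unfolding min_entropy_def by (intro Min_le) auto
qed


section \<open>The model of computation\<close>

text \<open>
  Algorithms are programs of Jones's WHILE language (N. D. Jones, Computability and Complexity
  from a Programming Perspective, 1997): a store of finitely many used variables holding binary
  trees, with assignments, conditionals and loops. Polynomial time in this language coincides with
  polynomial time on Turing machines. An assignment is charged the size of the tree it stores (and
  not one unit, as in Jones's book), so no sharing of subtrees is needed to carry out a run within
  a polynomial of its cost, and the running time bounds the size of everything computed.
\<close>

datatype data = Leaf | Node data data

fun data_size :: "data \<Rightarrow> nat" where
  "data_size Leaf = 1"
| "data_size (Node a b) = 1 + data_size a + data_size b"

datatype expr = Var nat | LEAF | NODE expr expr | LEFT expr | RIGHT expr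

type_synonym store = "nat \<Rightarrow> data"

fun left :: "data \<Rightarrow> data" where
  "left Leaf = Leaf"
| "left (Node a b) = a"

fun right :: "data \<Rightarrow> data" where
  "right Leaf = Leaf"
| "right (Node a b) = b"

fun value_of :: "expr \<Rightarrow> store \<Rightarrow> data" where
  "value_of (Var x) s = s x"
| "value_of LEAF s = Leaf"
| "value_of (NODE e1 e2) s = Node (value_of e1 s) (value_of e2 s)"
| "value_of (LEFT e) s = left (value_of e s)"
| "value_of (RIGHT e) s = right (value_of e s)"

datatype com =
    SKIP
  | ASSIGN nat expr
  | SEQ com com
  | IF expr com com
  | WHILE expr com

text \<open>\<open>exec c s t s'\<close>: started in \<open>s\<close>, program \<open>c\<close> terminates in \<open>s'\<close> with cost \<open>t\<close>. A test
  succeeds on every tree other than \<open>Leaf\<close>.\<close>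

inductive exec :: "com \<Rightarrow> store \<Rightarrow> nat \<Rightarrow> store \<Rightarrow> bool" where
  Skip: "exec SKIP s 1 s"
| Assign: "exec (ASSIGN x e) s (1 + data_size (value_of e s)) (s(x := value_of e s))"
| Seq: "exec c1 s t1 s' \<Longrightarrow> exec c2 s' t2 s'' \<Longrightarrow> exec (SEQ c1 c2) s (t1 + t2) s''"
| IfTrue: "value_of e s \<noteq> Leaf \<Longrightarrow> exec c1 s t s' \<Longrightarrow> exec (IF e c1 c2) s (1 + t) s'"
| IfFalse: "value_of e s = Leaf \<Longrightarrow> exec c2 s t s' \<Longrightarrow> exec (IF e c1 c2) s (1 + t) s'"
| WhileFalse: "value_of e s = Leaf \<Longrightarrow> exec (WHILE e c) s 1 s"
| WhileTrue: "value_of e s \<noteq> Leaf \<Longrightarrow> exec c s t1 s' \<Longrightarrow> exec (WHILE e c) s' t2 s'' \<Longrightarrow>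
    exec (WHILE e c) s (1 + t1 + t2) s''"

inductive_cases exec_SkipE: "exec SKIP s t s'"
inductive_cases exec_AssignE: "exec (ASSIGN x e) s t s'"
inductive_cases exec_SeqE: "exec (SEQ c1 c2) s t s'"
inductive_cases exec_IfE: "exec (IF e c1 c2) s t s'"
inductive_cases exec_WhileE: "exec (WHILE e c) s t s'"

lemma exec_deterministic:
  assumes "exec c s t s'" and "exec c s u s''"
  shows "t = u \<and> s' = s''"
  using assms
proof (induction arbitrary: u s'' rule: exec.induct)
  case (Skip s)
  then show ?case by (auto elim: exec_SkipE)
next
  case (Assign x e s)
  then show ?case by (auto elim: exec_AssignE)
next
  case (Seq c1 s t1 s' c2 t2 s2)
  from Seq.prems show ?case by (elim exec_SeqE) (use Seq.IH in blast)
next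
  case (IfTrue e s c1 t s' c2)
  from IfTrue.prems IfTrue.hyps(1) obtain u1 where
    "exec c1 s u1 s''" "u = 1 + u1"
    by (elim exec_IfE) simp_all
  with IfTrue.IH show ?case by metis
next
  case (IfFalse e s c2 t s' c1)
  from IfFalse.prems IfFalse.hyps(1) obtain u1 where
    "exec c2 s u1 s''" "u = 1 + u1"
    by (elim exec_IfE) simp_all
  with IfFalse.IH show ?case by metis
next
  case (WhileFalse e s c)
  from WhileFalse.prems show ?case by (rule exec_WhileE) (use WhileFalse.hyps in auto)
next
  case (WhileTrue e s c t1 s' t2 s2)
  from WhileTrue.prems obtain u1 u2 s1 where
    "exec c s u1 s1" "exec (WHILE e c) s1 u2 s''" "u = 1 + u1 + u2"
    by (rule exec_WhileE) (use WhileTrue.hyps(1) in auto)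
  with WhileTrue.IH show ?case by metis
qed

text \<open>Input and output both live in variable 0; every other variable starts as \<open>Leaf\<close>.\<close>

definition computes_in_time :: "com \<Rightarrow> data \<Rightarrow> data \<Rightarrow> nat \<Rightarrow> bool" where
  "computes_in_time c x y t \<longleftrightarrow> (\<exists>s'. exec c ((\<lambda>_. Leaf)(0 := x)) t s' \<and> s' 0 = y)"


section \<open>Encodings\<close>

text \<open>A graph on the vertex set \<open>{..<n}\<close> is presented by its adjacency matrix and a coloring by the
  list of the colors of \<open>0, \<dots>, n - 1\<close>, each written in unary.\<close>

fun enc_list :: "data list \<Rightarrow> data" where
  "enc_list [] = Leaf"
| "enc_list (x # xs) = Node x (enc_list xs)"

fun enc_bool :: "bool \<Rightarrow> data" where
  "enc_bool False = Leaf"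
| "enc_bool True = Node Leaf Leaf"

definition enc_nat :: "nat \<Rightarrow> data" where
  "enc_nat k = enc_list (replicate k Leaf)"

definition enc_graph :: "nat \<Rightarrow> nat set set \<Rightarrow> data" where
  "enc_graph n E =
     enc_list (map (\<lambda>i. enc_list (map (\<lambda>j. enc_bool ({i, j} \<in> E)) [0..<n])) [0..<n])"

definition enc_coloring :: "nat \<Rightarrow> (nat \<Rightarrow> nat) \<Rightarrow> data" where
  "enc_coloring n \<phi> = enc_list (map (\<lambda>v. enc_nat (\<phi> v)) [0..<n])"

lemma enc_list_inject: "enc_list xs = enc_list ys \<longleftrightarrow> xs = ys"
proof (induction xs arbitrary: ys)
  case Nil
  then show ?case by (cases ys) auto
next
  case (Cons x xs)
  then show ?case by (cases ys) auto
qed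

lemma enc_coloring_inject: "enc_coloring n \<phi> = enc_coloring n \<psi> \<longleftrightarrow> (\<forall>v<n. \<phi> v = \<psi> v)"
  by (auto simp: enc_coloring_def enc_nat_def enc_list_inject)

end

(* The maximal cliques of an interval graph can be ordered so that every vertex occupies consecutive
   cliques. Such an order is found by individualization and refinement: repeatedly a clique is put
   before all cliques it is not yet compared with, and the forced comparisons are derived. Every
   relation that arises is negatively transitive; if it is also asymmetric, it is a weak order that
   some valid order extends, because the ties can be broken by any valid order whatsoever.

   In an interval representation, processed by right end points, best-fit assignment to k tracks
   accepts a maximum k-colorable set S_k. One list of tracks, whose prefixes are the track sets for
   all k, handles every k at once, so S_1, S_2, ... is a chain. The vertices in S_(k+1) but not in
   S_k contain no triangle and split into two color classes. As the sizes of the S_k dominate the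
   partial sums of the class sizes of an optimal coloring, the levels have at most the optimal
   entropy, and the splitting costs at most one bit. *)

theory Submission
  imports Defs
begin

section \<open>Polynomial-time functions on encoded data\<close>

text \<open>Two obstacles shape the proof. The input is an adjacency matrix without an interval
  representation, and the running time is that of a concrete program over trees. Hence the algorithm
  is built from folds, maps and filters with controlled growth, and the representation is recovered
  by repeated local deduction.

  Putting a clique in front of others is a guess, yet no backtracking occurs. Among the unsettled
  cliques, the one that comes first in some valid extension is a right guess: all comparisons forced
  by it hold in that extension, so no contradiction can appear. And a guess that leads to no
  contradiction can be kept, whichever it is.

  The k largest classes of an optimal coloring form a k-colorable set, which is why a maximum S_k
  dominates them. The one bit is log 2: giving half of the weight of the i-th largest optimal class
  to each of the two colors of the i-th level yields the distribution to which Gibbs' inequality is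
  applied.\<close>

definition pbounded :: "(nat \<Rightarrow> nat) \<Rightarrow> bool" where
  "pbounded f \<longleftrightarrow> (\<exists>p :: nat poly. \<forall>x. f x \<le> poly p x)"

text \<open>Natural coefficients make polynomials monotone, so a bound at the exact size of an
  intermediate result can be replaced by a bound at an estimate of that size.\<close>

lemma poly_nat_mono: "x \<le> y \<Longrightarrow> poly p x \<le> poly p y" for p :: "nat poly"
  by (induction p) (auto intro!: add_mono mult_mono)

lemma pbounded_const: "pbounded (\<lambda>x. k)"
  unfolding pbounded_def by (rule exI[of _ "[:k:]"]) simp

lemma pbounded_id: "pbounded (\<lambda>x. x)"
  unfolding pbounded_def by (rule exI[of _ "[:0, 1:]"]) simp

lemma pbounded_add: "pbounded f \<Longrightarrow> pbounded g \<Longrightarrow> pbounded (\<lambda>x. f x + g x)"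
  unfolding pbounded_def by (metis add_mono poly_add)

lemma pbounded_mult: "pbounded f \<Longrightarrow> pbounded g \<Longrightarrow> pbounded (\<lambda>x. f x * g x)"
  unfolding pbounded_def by (metis mult_mono zero_le poly_mult)

lemma pbounded_poly: "pbounded f \<Longrightarrow> pbounded (\<lambda>x. poly p (f x))"
  unfolding pbounded_def by (metis order_trans poly_nat_mono poly_pcompose)

lemmas pbounded_intros = pbounded_const pbounded_id pbounded_poly pbounded_add pbounded_mult

section \<open>Typed values as trees, and their sizes\<close>

class encodable =
  fixes encode :: "'a \<Rightarrow> data"

definition sz :: "'a::encodable \<Rightarrow> nat" where
  "sz a = data_size (encode a)"

instantiation unit :: encodable
begin
definition encode_unit :: "unit \<Rightarrow> data" where [simp]: "encode_unit u = Leaf"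
instance ..
end

instantiation bool :: encodable
begin
definition encode_bool :: "bool \<Rightarrow> data" where [simp]: "encode_bool b = enc_bool b"
instance ..
end

instantiation nat :: encodable
begin
definition encode_nat :: "nat \<Rightarrow> data" where [simp]: "encode_nat n = enc_nat n"
instance ..
end

instantiation prod :: (encodable, encodable) encodable
begin
definition encode_prod :: "'a \<times> 'b \<Rightarrow> data" where
  [simp]: "encode_prod z = Node (encode (fst z)) (encode (snd z))"
instance ..
end

instantiation list :: (encodable) encodable
begin
definition encode_list :: "'a list \<Rightarrow> data" where
  [simp]: "encode_list xs = enc_list (map encode xs)"
instance ..
end

lemma enc_nat_simps [simp]: "enc_nat 0 = Leaf" "enc_nat (Suc n) = Node Leaf (enc_nat n)"
  by (simp_all add: enc_nat_def)

lemma sz_pos: "0 < sz a"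
  unfolding sz_def by (cases "encode a") auto

lemma sz_pair [simp]: "sz (a, b) = 1 + sz a + sz b"
  by (simp add: sz_def)

lemma sz_nil [simp]: "sz [] = 1"
  by (simp add: sz_def)

lemma sz_cons [simp]: "sz (x # xs) = 1 + sz x + sz xs"
  by (simp add: sz_def)

lemma sz_unit [simp]: "sz () = 1"
  by (simp add: sz_def)

lemma sz_nat [simp]: "sz (n::nat) = 2 * n + 1"
  by (induction n) (auto simp: sz_def)

lemma sz_bool: "sz (b::bool) \<le> 3"
  by (cases b) (auto simp: sz_def)

lemma sz_bool_simps [simp]: "sz True = 3" "sz False = 1"
  by (auto simp: sz_def)

lemma sz_append: "sz (xs @ ys) + 1 = sz xs + sz ys"
  by (induction xs) auto

lemma sz_fst: "sz (fst z) \<le> sz z" and sz_snd: "sz (snd z) \<le> sz z"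
  by (cases z; simp)+

lemma length_le_sz: "length xs \<le> sz xs"
  by (induction xs) auto

lemma sz_member: "x \<in> set xs \<Longrightarrow> sz x \<le> sz xs"
  by (induction xs) auto

section \<open>Program runs with cost bounds\<close>

definition runs :: "com \<Rightarrow> store \<Rightarrow> nat \<Rightarrow> store \<Rightarrow> bool" where
  "runs c s T s' \<longleftrightarrow> (\<exists>t\<le>T. exec c s t s')"

lemma runs_mono: "runs c s T s' \<Longrightarrow> T \<le> T' \<Longrightarrow> runs c s T' s'"
  unfolding runs_def by (meson order_trans)

lemma runs_assign:
  "s' = s(x := value_of e s) \<Longrightarrow> 1 + data_size (value_of e s) \<le> T \<Longrightarrow> runs (ASSIGN x e) s T s'"
  unfolding runs_def using exec.Assign by blast

lemma runs_seq: "runs c1 s T1 s1 \<Longrightarrow> runs c2 s1 T2 s2 \<Longrightarrow> runs (SEQ c1 c2) s (T1 + T2) s2"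
  unfolding runs_def using exec.Seq add_mono by blast

lemma runs_if:
  "(value_of e s \<noteq> Leaf \<Longrightarrow> runs c1 s T s') \<Longrightarrow> (value_of e s = Leaf \<Longrightarrow> runs c2 s T s') \<Longrightarrow>
    runs (IF e c1 c2) s (1 + T) s'"
  unfolding runs_def using exec.IfTrue exec.IfFalse add_left_mono
  by (cases "value_of e s = Leaf") blast+

lemma runs_while_end: "value_of e s = Leaf \<Longrightarrow> runs (WHILE e c) s 1 s"
  unfolding runs_def using exec.WhileFalse by blast

lemma runs_while_step:
  "value_of e s \<noteq> Leaf \<Longrightarrow> runs c s T1 s1 \<Longrightarrow> runs (WHILE e c) s1 T2 s2 \<Longrightarrow>
    runs (WHILE e c) s (1 + T1 + T2) s2"
  unfolding runs_def using exec.WhileTrue by (meson add_mono order_refl)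

text \<open>Variables \<open>1, \<dots>, N - 1\<close> are scratch space that a program finds and leaves clean; it does not
  touch the variables from \<open>N\<close> on, so callers can keep their own data there.\<close>

definition implements :: "com \<Rightarrow> nat \<Rightarrow> (nat \<Rightarrow> nat) \<Rightarrow> ('a::encodable \<Rightarrow> 'b::encodable) \<Rightarrow> bool" where
  "implements c N T f \<longleftrightarrow> (\<forall>a s. s 0 = encode a \<longrightarrow> (\<forall>i. 0 < i \<and> i < N \<longrightarrow> s i = Leaf) \<longrightarrow>
     runs c s (T (sz a)) (s(0 := encode (f a))) \<and> sz (f a) \<le> T (sz a))"

definition ptime :: "('a::encodable \<Rightarrow> 'b::encodable) \<Rightarrow> bool" where
  "ptime f \<longleftrightarrow> (\<exists>c N p. implements c N (poly p) f)"

lemma ptimeI: "pbounded T \<Longrightarrow> implements c N T f \<Longrightarrow> ptime f"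
  unfolding ptime_def implements_def pbounded_def by (meson order_trans runs_mono)

lemma implements_runs:
  "implements c N T f \<Longrightarrow> s 0 = encode a \<Longrightarrow> (\<And>i. 0 < i \<Longrightarrow> i < N \<Longrightarrow> s i = Leaf) \<Longrightarrow>
    runs c s (T (sz a)) (s(0 := encode (f a)))"
  unfolding implements_def by blast

lemma runs_eq: "runs c s T s1 \<Longrightarrow> s1 = s' \<Longrightarrow> runs c s T s'"
  by simp

lemma implements_sz: "implements c N T f \<Longrightarrow> sz (f a) \<le> T (sz a)"
  unfolding implements_def by (erule allE[of _ a], erule allE[of _ "(\<lambda>_. Leaf)(0 := encode a)"]) simp

lemma ptime_sz:
  assumes "ptime f"
  obtains p where "\<And>a. sz (f a) \<le> poly p (sz a)"
  using assms implements_sz unfolding ptime_def by blast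

lemma ptime_expr:
  assumes "\<And>a s. s 0 = encode a \<Longrightarrow> value_of e s = encode (f a)"
    and "pbounded T" and "\<And>a. sz (f a) \<le> T (sz a)"
  shows "ptime f"
proof (rule ptimeI)
  show "pbounded (\<lambda>x. 1 + T x)" by (intro pbounded_intros assms)
  show "implements (ASSIGN 0 e) 1 (\<lambda>x. 1 + T x) f"
    unfolding implements_def using assms(1,3)
    by (auto intro!: runs_assign simp: sz_def le_SucI)
qed

lemma ptime_id: "ptime (\<lambda>x. x)"
  by (rule ptime_expr[of "Var 0" _ "\<lambda>x. x"]) (auto simp: pbounded_id)

fun lit :: "data \<Rightarrow> expr" where
  "lit Leaf = LEAF"
| "lit (Node a b) = NODE (lit a) (lit b)"

lemma value_of_lit [simp]: "value_of (lit d) s = d"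
  by (induction d) auto

lemma ptime_const: "ptime (\<lambda>x. c)"
  by (rule ptime_expr[of "lit (encode c)" _ "\<lambda>x. sz c"]) (auto simp: pbounded_const)

lemma ptime_comp:
  fixes f :: "'b::encodable \<Rightarrow> 'c::encodable" and g :: "'a::encodable \<Rightarrow> 'b"
  assumes "ptime f" "ptime g"
  shows "ptime (\<lambda>x. f (g x))"
proof -
  obtain cf Nf pf cg Ng pg where f: "implements cf Nf (poly pf) f" and g: "implements cg Ng (poly pg) g"
    using assms unfolding ptime_def by blast
  let ?N = "max Nf Ng" and ?T = "\<lambda>x. poly pg x + poly pf (poly pg x)"
  show ?thesis
  proof (rule ptimeI)
    show "pbounded ?T" by (intro pbounded_intros)
    show "implements (SEQ cg cf) ?N ?T (\<lambda>x. f (g x))"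
      unfolding implements_def
    proof (intro allI impI conjI)
      fix a :: 'a and s assume s: "s 0 = encode a" "\<forall>i. 0 < i \<and> i < ?N \<longrightarrow> s i = Leaf"
      have le: "poly pf (sz (g a)) \<le> poly pf (poly pg (sz a))"
        using implements_sz[OF g] by (rule poly_nat_mono)
      let ?s1 = "s(0 := encode (g a))"
      have 1: "runs cg s (poly pg (sz a)) ?s1"
        by (rule implements_runs[OF g]) (use s in auto)
      have 2: "runs cf ?s1 (poly pf (sz (g a))) (?s1(0 := encode (f (g a))))"
        by (rule implements_runs[OF f]) (use s in auto)
      have "runs (SEQ cg cf) s (poly pg (sz a) + poly pf (sz (g a))) (s(0 := encode (f (g a))))"
        using runs_seq[OF 1 2] by simp
      then show "runs (SEQ cg cf) s (?T (sz a)) (s(0 := encode (f (g a))))"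
        using le runs_mono by fastforce
      show "sz (f (g a)) \<le> ?T (sz a)" using implements_sz[OF f, of "g a"] le by simp
    qed
  qed
qed

lemma ptime_pair:
  fixes f :: "'a::encodable \<Rightarrow> 'b::encodable" and g :: "'a \<Rightarrow> 'c::encodable"
  assumes "ptime f" "ptime g"
  shows "ptime (\<lambda>x. (f x, g x))"
proof -
  obtain cf Nf pf cg Ng pg where f: "implements cf Nf (poly pf) f" and g: "implements cg Ng (poly pg) g"
    using assms unfolding ptime_def by blast
  \<comment> \<open>\<open>K\<close> saves the input and \<open>Suc K\<close> the first result, both
    beyond the scratch space of either program; \<open>Suc\<close> keeps \<open>K\<close> away from
    variable 0. Both are reset at the end, since \<open>implements\<close> lets only variable 0
    change.\<close>
  define K where "K = Suc (max Nf Ng)"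
  let ?c = "SEQ (ASSIGN K (Var 0)) (SEQ cf (SEQ (ASSIGN (Suc K) (Var 0)) (SEQ (ASSIGN 0 (Var K))
    (SEQ cg (SEQ (ASSIGN 0 (NODE (Var (Suc K)) (Var 0))) (SEQ (ASSIGN K LEAF) (ASSIGN (Suc K) LEAF)))))))"
  let ?T = "\<lambda>x. (1 + x) + (poly pf x + ((1 + poly pf x) + ((1 + x) + (poly pg x +
    ((1 + (1 + poly pf x + poly pg x)) + (2 + 2))))))"
  show ?thesis
  proof (rule ptimeI)
    show "pbounded ?T" by (intro pbounded_intros)
    show "implements ?c (K + 2) ?T (\<lambda>x. (f x, g x))"
      unfolding implements_def
    proof (intro allI impI conjI)
      fix a :: 'a and s assume s: "s 0 = encode a" "\<forall>i. 0 < i \<and> i < K + 2 \<longrightarrow> s i = Leaf"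
      have K: "0 < K" "Nf < K" "Ng < K" by (auto simp: K_def)
      have sf: "data_size (encode (f a)) \<le> poly pf (sz a)" and sg: "data_size (encode (g a)) \<le> poly pg (sz a)"
        using implements_sz[OF f, of a] implements_sz[OF g, of a] by (auto simp: sz_def)
      let ?s1 = "s(K := encode a)"
      let ?s2 = "?s1(0 := encode (f a))"
      let ?s3 = "?s2(Suc K := encode (f a))"
      let ?s4 = "?s3(0 := encode a)"
      let ?s5 = "?s4(0 := encode (g a))"
      let ?s6 = "?s5(0 := encode (f a, g a))"
      let ?s7 = "?s6(K := Leaf)"
      have 1: "runs (ASSIGN K (Var 0)) s (1 + sz a) ?s1"
        by (rule runs_assign) (simp_all add: s sz_def)
      have 2: "runs cf ?s1 (poly pf (sz a)) ?s2"
        by (rule implements_runs[OF f]) (use s K in auto)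
      have 3: "runs (ASSIGN (Suc K) (Var 0)) ?s2 (1 + poly pf (sz a)) ?s3"
        by (rule runs_assign) (use sf K in simp_all)
      have 4: "runs (ASSIGN 0 (Var K)) ?s3 (1 + sz a) ?s4"
        by (rule runs_assign) (use K in \<open>simp_all add: sz_def\<close>)
      have 5: "runs cg ?s4 (poly pg (sz a)) ?s5"
        by (rule implements_runs[OF g]) (use s K in auto)
      have 6: "runs (ASSIGN 0 (NODE (Var (Suc K)) (Var 0))) ?s5 (1 + (1 + poly pf (sz a) + poly pg (sz a))) ?s6"
        by (rule runs_assign) (use sf sg K in simp_all)
      have 7: "runs (ASSIGN K LEAF) ?s6 2 ?s7" by (rule runs_assign) simp_all
      have 8: "runs (ASSIGN (Suc K) LEAF) ?s7 2 (?s7(Suc K := Leaf))" by (rule runs_assign) simp_all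
      have "?s7(Suc K := Leaf) = s(0 := encode (f a, g a))"
        using s(2) K by (auto simp: fun_eq_iff)
      then show "runs ?c s (?T (sz a)) (s(0 := encode (f a, g a)))"
        by (rule runs_eq[OF runs_seq[OF 1 runs_seq[OF 2 runs_seq[OF 3 runs_seq[OF 4 runs_seq[OF 5
          runs_seq[OF 6 runs_seq[OF 7 8]]]]]]]])
      show "sz (f a, g a) \<le> ?T (sz a)" using sf sg by (simp add: sz_def)
    qed
  qed
qed

lemma ptime_if:
  fixes f :: "'a::encodable \<Rightarrow> 'b::encodable"
  assumes "ptime b" "ptime f" "ptime g"
  shows "ptime (\<lambda>x. if b x then f x else g x)"
proof -
  obtain cb Nb pb cf Nf pf cg Ng pg where b: "implements cb Nb (poly pb) b"
    and f: "implements cf Nf (poly pf) f" and g: "implements cg Ng (poly pg) g"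
    using assms unfolding ptime_def by blast
  define K where "K = Suc (max Nb (max Nf Ng))"
  let ?c = "SEQ (ASSIGN K (Var 0)) (SEQ cb (SEQ (ASSIGN (Suc K) (Var 0)) (SEQ (ASSIGN 0 (Var K))
    (SEQ (ASSIGN K LEAF) (IF (Var (Suc K)) (SEQ (ASSIGN (Suc K) LEAF) cf) (SEQ (ASSIGN (Suc K) LEAF) cg))))))"
  let ?T = "\<lambda>x. (1 + x) + (poly pb x + ((1 + poly pb x) + ((1 + x) + (2 + (1 + (2 + (poly pf x + poly pg x)))))))"
  show ?thesis
  proof (rule ptimeI)
    show "pbounded ?T" by (intro pbounded_intros)
    show "implements ?c (K + 2) ?T (\<lambda>x. if b x then f x else g x)"
      unfolding implements_def
    proof (intro allI impI conjI)
      fix a :: 'a and s assume s: "s 0 = encode a" "\<forall>i. 0 < i \<and> i < K + 2 \<longrightarrow> s i = Leaf"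
      have K: "0 < K" "Nb < K" "Nf < K" "Ng < K" by (auto simp: K_def)
      have sb: "data_size (encode (b a)) \<le> poly pb (sz a)"
        using implements_sz[OF b, of a] by (auto simp: sz_def)
      let ?s1 = "s(K := encode a)"
      let ?s2 = "?s1(0 := encode (b a))"
      let ?s3 = "?s2(Suc K := encode (b a))"
      let ?s4 = "?s3(0 := encode a)"
      let ?s5 = "?s4(K := Leaf)"
      let ?s6 = "?s5(Suc K := Leaf)"
      have 1: "runs (ASSIGN K (Var 0)) s (1 + sz a) ?s1"
        by (rule runs_assign) (simp_all add: s sz_def)
      have 2: "runs cb ?s1 (poly pb (sz a)) ?s2"
        by (rule implements_runs[OF b]) (use s K in auto)
      have 3: "runs (ASSIGN (Suc K) (Var 0)) ?s2 (1 + poly pb (sz a)) ?s3"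
        by (rule runs_assign) (use sb K in simp_all)
      have 4: "runs (ASSIGN 0 (Var K)) ?s3 (1 + sz a) ?s4"
        by (rule runs_assign) (use K in \<open>simp_all add: sz_def\<close>)
      have 5: "runs (ASSIGN K LEAF) ?s4 2 ?s5" by (rule runs_assign) simp_all
      have 6: "runs (ASSIGN (Suc K) LEAF) ?s5 2 ?s6" by (rule runs_assign) simp_all
      have f': "runs cf ?s6 (poly pf (sz a)) (?s6(0 := encode (f a)))"
        by (rule implements_runs[OF f]) (use s K in auto)
      have g': "runs cg ?s6 (poly pg (sz a)) (?s6(0 := encode (g a)))"
        by (rule implements_runs[OF g]) (use s K in auto)
      have s6: "?s6(0 := d) = s(0 := d)" for d
        using s(2) K by (auto simp: fun_eq_iff)
      have "runs (IF (Var (Suc K)) (SEQ (ASSIGN (Suc K) LEAF) cf) (SEQ (ASSIGN (Suc K) LEAF) cg)) ?s5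
        (1 + (2 + (poly pf (sz a) + poly pg (sz a)))) (s(0 := encode (if b a then f a else g a)))"
      proof (rule runs_if)
        assume "value_of (Var (Suc K)) ?s5 \<noteq> Leaf"
        then have "b a" by (cases "b a") auto
        then show "runs (SEQ (ASSIGN (Suc K) LEAF) cf) ?s5 (2 + (poly pf (sz a) + poly pg (sz a)))
            (s(0 := encode (if b a then f a else g a)))"
          using runs_mono[OF runs_seq[OF 6 f'[unfolded s6]]] by simp
      next
        assume "value_of (Var (Suc K)) ?s5 = Leaf"
        then have "\<not> b a" by (cases "b a") auto
        then show "runs (SEQ (ASSIGN (Suc K) LEAF) cg) ?s5 (2 + (poly pf (sz a) + poly pg (sz a)))
            (s(0 := encode (if b a then f a else g a)))"
          using runs_mono[OF runs_seq[OF 6 g'[unfolded s6]]] by simp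
      qed
      then show "runs ?c s (?T (sz a)) (s(0 := encode (if b a then f a else g a)))"
        by (intro runs_seq[OF 1 runs_seq[OF 2 runs_seq[OF 3 runs_seq[OF 4 runs_seq[OF 5]]]]])
      show "sz (if b a then f a else g a) \<le> ?T (sz a)"
        using implements_sz[OF f, of a] implements_sz[OF g, of a] by simp
    qed
  qed
qed

section \<open>Iteration over a list\<close>

lemma sz_foldl_le:
  assumes "\<And>a e. sz (g x a e) \<le> sz a + poly q (sz x + sz e)"
  shows "sz (foldl (g x) a l) \<le> sz a + length l * poly q (sz x + sz l)"
proof -
  have "sz (foldl (g x) a l) \<le> sz a + length l * Q" if "\<And>e. e \<in> set l \<Longrightarrow> poly q (sz x + sz e) \<le> Q" for Q
    using that
  proof (induction l arbitrary: a)
    case (Cons e l)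
    have "sz (foldl (g x) (g x a e) l) \<le> sz (g x a e) + length l * Q" using Cons by simp
    also have "sz (g x a e) \<le> sz a + Q" using assms[of a e] Cons.prems[of e] by simp
    finally show ?case by simp
  qed simp
  moreover have "poly q (sz x + sz e) \<le> poly q (sz x + sz l)" if "e \<in> set l" for e
    using sz_member[OF that] by (intro poly_nat_mono) simp
  ultimately show ?thesis by blast
qed

lemma ptime_foldl_core:
  fixes g :: "'x::encodable \<Rightarrow> 'a::encodable \<Rightarrow> 'e::encodable \<Rightarrow> 'a"
  assumes "ptime (\<lambda>z. g (fst z) (fst (snd z)) (snd (snd z)))"
    and bound: "\<And>x a e. sz (g x a e) \<le> sz a + poly q (sz x + sz e)"
  shows "ptime (\<lambda>z. foldl (g (fst z)) (fst (snd z)) (snd (snd z)))"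
proof -
  obtain c N p where c: "implements c N (poly p) (\<lambda>z. g (fst z) (fst (snd z)) (snd (snd z)))"
    using assms(1) unfolding ptime_def by blast
  define K where "K = Suc N"
  have K: "0 < K" "N < K" by (auto simp: K_def)
  let ?body = "SEQ (ASSIGN 0 (NODE (Var K) (NODE (Var (K + 1)) (LEFT (Var (K + 2))))))
    (SEQ (ASSIGN (K + 2) (RIGHT (Var (K + 2)))) (SEQ c (ASSIGN (K + 1) (Var 0))))"
  let ?loop = "WHILE (Var (K + 2)) ?body"
  let ?c = "SEQ (ASSIGN K (LEFT (Var 0))) (SEQ (ASSIGN (K + 1) (LEFT (RIGHT (Var 0))))
    (SEQ (ASSIGN (K + 2) (RIGHT (RIGHT (Var 0)))) (SEQ ?loop (SEQ (ASSIGN 0 (Var (K + 1)))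
    (SEQ (ASSIGN K LEAF) (ASSIGN (K + 1) LEAF))))))"
  let ?B = "\<lambda>M. (1 + M) + ((1 + M) + (poly p M + (1 + M)))"
  \<comment> \<open>\<open>K\<close>, \<open>K + 1\<close> and \<open>K + 2\<close> hold the
    parameter, the accumulator and the rest of the list. What remains in variable 0 depends on
    whether the body ever ran, hence the existential \<open>d\<close>. \<open>M\<close> covers all
    partial folds, as an intermediate accumulator may be larger than the last one.\<close>
  have loop: "\<exists>d. runs ?loop s (1 + length l * (1 + ?B M))
      (s(0 := d, K + 1 := encode (foldl (g x) a l), K + 2 := Leaf))"
    if "s K = encode x" "s (K + 1) = encode a" "s (K + 2) = encode l"
      "\<forall>i. 0 < i \<and> i < N \<longrightarrow> s i = Leaf"
      "\<And>l1 l2. l = l1 @ l2 \<Longrightarrow> 2 + sz x + sz (foldl (g x) a l1) + sz l \<le> M" for s x a l M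
    using that
  proof (induction l arbitrary: s a)
    case Nil
    have "runs ?loop s 1 s" by (rule runs_while_end) (use Nil in simp)
    moreover have "s(0 := s 0, K + 1 := encode a, K + 2 := Leaf) = s"
      using Nil by (auto simp: fun_eq_iff)
    ultimately show ?case by (intro exI[of _ "s 0"]) (simp del: fun_upd_apply One_nat_def)
  next
    case (Cons e l)
    let ?a = "g x a e"
    let ?s = "s(0 := encode ?a, K + 1 := encode ?a, K + 2 := encode l)"
    have M0: "2 + sz x + sz a + sz (e # l) \<le> M" using Cons.prems(5)[of "[]"] by simp
    have M1: "2 + sz x + sz ?a + sz (e # l) \<le> M" using Cons.prems(5)[of "[e]" l] by simp
    have szM: "sz (x, (a, e)) \<le> M" using M0 by simp
    let ?s1 = "s(0 := encode (x, (a, e)))"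
    let ?s2 = "?s1(K + 2 := encode l)"
    let ?s3 = "?s2(0 := encode ?a)"
    have 1: "runs (ASSIGN 0 (NODE (Var K) (NODE (Var (K + 1)) (LEFT (Var (K + 2)))))) s (1 + M) ?s1"
      by (rule runs_assign) (use Cons.prems(1-3) M0 in \<open>simp_all add: sz_def\<close>)
    have 2: "runs (ASSIGN (K + 2) (RIGHT (Var (K + 2)))) ?s1 (1 + M) ?s2"
      by (rule runs_assign) (use Cons.prems(3) M0 in \<open>simp_all add: sz_def\<close>)
    have 3: "runs c ?s2 (poly p (sz (x, (a, e)))) ?s3"
      using implements_runs[OF c, of ?s2 "(x, (a, e))"] Cons.prems(4) K by simp
    have 4: "runs (ASSIGN (K + 1) (Var 0)) ?s3 (1 + M) ?s"
      by (rule runs_assign) (use M1 K in \<open>auto simp: sz_def fun_eq_iff\<close>)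
    have B: "runs ?body s (?B M) ?s"
      by (rule runs_seq[OF 1 runs_seq[OF 2 runs_seq[OF runs_mono[OF 3 poly_nat_mono[OF szM]] 4]]])
    have "\<exists>d. runs ?loop ?s (1 + length l * (1 + ?B M))
      (?s(0 := d, K + 1 := encode (foldl (g x) ?a l), K + 2 := Leaf))"
    proof (rule Cons.IH)
      show "2 + sz x + sz (foldl (g x) (g x a e) l1) + sz l \<le> M" if "l = l1 @ l2" for l1 l2
        using Cons.prems(5)[of "e # l1" l2] that by simp
    qed (use Cons.prems K in auto)
    then obtain d where d: "runs ?loop ?s (1 + length l * (1 + ?B M))
      (?s(0 := d, K + 1 := encode (foldl (g x) ?a l), K + 2 := Leaf))" by blast
    have eq: "?s(0 := d, K + 1 := encode (foldl (g x) ?a l), K + 2 := Leaf) =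
      s(0 := d, K + 1 := encode (foldl (g x) a (e # l)), K + 2 := Leaf)"
      by (auto simp: fun_eq_iff)
    have "runs ?loop s (1 + ?B M + (1 + length l * (1 + ?B M)))
      (s(0 := d, K + 1 := encode (foldl (g x) a (e # l)), K + 2 := Leaf))"
      using runs_while_step[OF _ B d] Cons.prems(3) unfolding eq by simp
    then show ?case by (intro exI[of _ d], elim runs_mono) (simp add: algebra_simps)
  qed
  \<comment> \<open>\<open>y\<close> will be the size of the whole input, which bounds the
    parameter, the start value, the list and its length at once. So \<open>?A y\<close> bounds every
    accumulator by \<open>sz_foldl_le\<close>.\<close>
  let ?A = "\<lambda>y. y + y * poly q (y + y)"
  let ?M = "\<lambda>y. 2 + y + ?A y + y"
  let ?T = "\<lambda>y. (1 + y) + ((1 + y) + ((1 + y) + ((1 + y * (1 + ?B (?M y))) + ((1 + ?A y) + (2 + 2)))))"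
  show ?thesis
  proof (rule ptimeI)
    show "pbounded ?T" by (intro pbounded_intros)
    show "implements ?c (K + 3) ?T (\<lambda>z. foldl (g (fst z)) (fst (snd z)) (snd (snd z)))"
      unfolding implements_def
    proof (intro allI impI)
      fix z :: "'x \<times> 'a \<times> 'e list" and s
      assume s: "s 0 = encode z" "\<forall>i. 0 < i \<and> i < K + 3 \<longrightarrow> s i = Leaf"
      obtain x a l where z: "z = (x, a, l)" by (cases z)
      let ?y = "sz z"
      have le: "sz a \<le> ?y" "sz l \<le> ?y" "sz x \<le> ?y" by (auto simp: z)
      have A: "sz (foldl (g x) a l1) \<le> ?A ?y" if "l = l1 @ l2" for l1 l2
      proof -
        have l1: "sz l1 \<le> sz l" using that sz_append[of l1 l2] sz_pos[of l2] by simp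
        have "sz (foldl (g x) a l1) \<le> sz a + length l1 * poly q (sz x + sz l1)"
          by (rule sz_foldl_le) (rule bound)
        also have "\<dots> \<le> ?A ?y"
          using le l1 length_le_sz[of l1] by (intro add_mono mult_mono poly_nat_mono) auto
        finally show ?thesis .
      qed
      have A': "sz (foldl (g x) a l) \<le> ?A ?y" using A[of l "[]"] by simp
      let ?s = "s(K := encode x, K + 1 := encode a, K + 2 := encode l)"
      have "\<exists>d. runs ?loop ?s (1 + length l * (1 + ?B (?M ?y)))
        (?s(0 := d, K + 1 := encode (foldl (g x) a l), K + 2 := Leaf))"
      proof (rule loop)
        show "2 + sz x + sz (foldl (g x) a l1) + sz l \<le> ?M ?y" if "l = l1 @ l2" for l1 l2
          using A[OF that] le by linarith
      qed (use s K in auto)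
      then obtain d where d: "runs ?loop ?s (1 + length l * (1 + ?B (?M ?y)))
        (?s(0 := d, K + 1 := encode (foldl (g x) a l), K + 2 := Leaf))" by blast
      have L: "length l \<le> ?y" using le length_le_sz[of l] by linarith
      have "runs ?loop ?s (1 + ?y * (1 + ?B (?M ?y)))
        (?s(0 := d, K + 1 := encode (foldl (g x) a l), K + 2 := Leaf))"
        by (rule runs_mono[OF d]) (intro add_mono mult_mono L, auto)
      then have 4: "runs ?loop ?s (1 + ?y * (1 + ?B (?M ?y)))
        (?s(0 := d, K + 1 := encode (foldl (g x) a l), K + 2 := Leaf))" (is "runs _ _ _ ?s4") .
      let ?s1 = "s(K := encode x)"
      let ?s2 = "?s1(K + 1 := encode a)"
      let ?s5 = "?s4(0 := encode (foldl (g x) a l))"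
      let ?s6 = "?s5(K := Leaf)"
      have 1: "runs (ASSIGN K (LEFT (Var 0))) s (1 + ?y) ?s1"
        by (rule runs_assign) (simp_all add: s z sz_def)
      have 2: "runs (ASSIGN (K + 1) (LEFT (RIGHT (Var 0)))) ?s1 (1 + ?y) ?s2"
        by (rule runs_assign) (use K in \<open>simp_all add: s z sz_def\<close>)
      have 3: "runs (ASSIGN (K + 2) (RIGHT (RIGHT (Var 0)))) ?s2 (1 + ?y) ?s"
        by (rule runs_assign) (use K in \<open>simp_all add: s z sz_def\<close>)
      have 5: "runs (ASSIGN 0 (Var (K + 1))) ?s4 (1 + ?A ?y) ?s5"
        by (rule runs_assign) (use A' in \<open>simp_all add: sz_def\<close>)
      have 6: "runs (ASSIGN K LEAF) ?s5 2 ?s6" by (rule runs_assign) simp_all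
      have 7: "runs (ASSIGN (K + 1) LEAF) ?s6 2 (?s6(K + 1 := Leaf))" by (rule runs_assign) simp_all
      have "?s6(K + 1 := Leaf) = s(0 := encode (foldl (g x) a l))"
        using s(2) K by (auto simp: fun_eq_iff)
      then have "runs ?c s (?T ?y) (s(0 := encode (foldl (g x) a l)))"
        by (rule runs_eq[OF runs_seq[OF 1 runs_seq[OF 2 runs_seq[OF 3 runs_seq[OF 4 runs_seq[OF 5
          runs_seq[OF 6 7]]]]]]])
      moreover have "sz (foldl (g x) a l) \<le> ?T ?y" using A' by linarith
      ultimately show "runs ?c s (?T ?y) (s(0 := encode (foldl (g (fst z)) (fst (snd z)) (snd (snd z))))) \<and>
        sz (foldl (g (fst z)) (fst (snd z)) (snd (snd z))) \<le> ?T ?y"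
        unfolding z fst_conv snd_conv by (rule conjI)
    qed
  qed
qed

lemma ptime_comp2:
  assumes "ptime (\<lambda>z. h (fst z) (snd z))" "ptime f" "ptime g"
  shows "ptime (\<lambda>x. h (f x) (g x))"
  using ptime_comp[OF assms(1) ptime_pair[OF assms(2,3)]] by simp

lemma ptime_comp3:
  assumes "ptime (\<lambda>z. h (fst z) (fst (snd z)) (snd (snd z)))" "ptime f" "ptime g" "ptime k"
  shows "ptime (\<lambda>x. h (f x) (g x) (k x))"
  using ptime_comp[OF assms(1) ptime_pair[OF assms(2) ptime_pair[OF assms(3,4)]]] by simp

section \<open>A calculus of polynomial-time functions on lists and numbers\<close>

named_theorems ptime_intros

declare ptime_id [ptime_intros] ptime_pair [ptime_intros] ptime_if [ptime_intros]

lemma ptime_const' [ptime_intros]: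
  "ptime (\<lambda>x. True)" "ptime (\<lambda>x. False)" "ptime (\<lambda>x. 0::nat)" "ptime (\<lambda>x. [])" "ptime (\<lambda>x. ())"
  by (rule ptime_const)+

lemma ptime_fst [ptime_intros]: "ptime f \<Longrightarrow> ptime (\<lambda>x. fst (f x))"
  by (rule ptime_comp[of fst]) (rule ptime_expr[of "LEFT (Var 0)" _ "\<lambda>x. x"], auto simp: pbounded_id sz_fst)

lemma ptime_snd [ptime_intros]: "ptime f \<Longrightarrow> ptime (\<lambda>x. snd (f x))"
  by (rule ptime_comp[of snd]) (rule ptime_expr[of "RIGHT (Var 0)" _ "\<lambda>x. x"], auto simp: pbounded_id sz_snd)

lemma ptime_Suc [ptime_intros]: "ptime f \<Longrightarrow> ptime (\<lambda>x. Suc (f x))"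
proof (rule ptime_comp[of Suc], rule ptime_expr[of "NODE LEAF (Var 0)" _ "\<lambda>x. x + 2"])
  show "pbounded (\<lambda>x. x + 2)" by (intro pbounded_intros)
qed auto

lemma ptime_Cons [ptime_intros]: "ptime f \<Longrightarrow> ptime g \<Longrightarrow> ptime (\<lambda>x. f x # g x)"
  by (rule ptime_comp2) (rule ptime_expr[of "Var 0" _ "\<lambda>x. x"], auto simp: pbounded_id sz_def)

lemma ptime_tl [ptime_intros]: "ptime f \<Longrightarrow> ptime (\<lambda>x. tl (f x))"
proof (rule ptime_comp[of tl], rule ptime_expr[of "RIGHT (Var 0)" _ "\<lambda>x. x"])
  fix xs :: "'b list" and s :: store assume "s 0 = encode xs"
  then show "value_of (RIGHT (Var 0)) s = encode (tl xs)" by (cases xs) auto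
next
  show "sz (tl xs) \<le> sz xs" for xs :: "'b list" by (cases xs) auto
qed (rule pbounded_id)

text \<open>The default value is encoded by \<open>Leaf\<close>, which is what \<open>LEFT\<close> returns on the empty list.\<close>

definition hd_or :: "'a \<Rightarrow> 'a list \<Rightarrow> 'a" where
  "hd_or d xs = (case xs of [] \<Rightarrow> d | x # _ \<Rightarrow> x)"

lemma hd_or_simps [simp]: "hd_or d [] = d" "hd_or d (x # xs) = x"
  by (simp_all add: hd_or_def)

lemma ptime_hd_or [ptime_intros]:
  fixes d :: "'a::encodable"
  assumes "encode d = Leaf" "ptime f"
  shows "ptime (\<lambda>x. hd_or d (f x))"
proof (rule ptime_comp[of "hd_or d", OF _ assms(2)], rule ptime_expr[of "LEFT (Var 0)" _ "\<lambda>x. x"])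
  fix xs :: "'a list" and s :: store assume "s 0 = encode xs"
  with assms(1) show "value_of (LEFT (Var 0)) s = encode (hd_or d xs)" by (cases xs) auto
next
  show "sz (hd_or d xs) \<le> sz xs" for xs using assms(1) by (cases xs) (auto simp: sz_def)
qed (rule pbounded_id)

lemma ptime_pred [ptime_intros]: "ptime f \<Longrightarrow> ptime (\<lambda>x. f x - Suc 0)"
proof (rule ptime_comp[of "\<lambda>k. k - Suc 0"], rule ptime_expr[of "RIGHT (Var 0)" _ "\<lambda>x. x"])
  fix k :: nat and s :: store assume "s 0 = encode k"
  then show "value_of (RIGHT (Var 0)) s = encode (k - Suc 0)" by (cases k) auto
qed (auto simp: pbounded_id)

lemma ptime_not [ptime_intros]: "ptime f \<Longrightarrow> ptime (\<lambda>x. \<not> f x)"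
proof -
  assume "ptime f"
  then have "ptime (\<lambda>x. if f x then False else True)" by (intro ptime_if ptime_const)
  moreover have "(if f x then False else True) \<longleftrightarrow> \<not> f x" for x by simp
  ultimately show ?thesis by (simp only:)
qed

lemma ptime_conj [ptime_intros]: "ptime f \<Longrightarrow> ptime g \<Longrightarrow> ptime (\<lambda>x. f x \<and> g x)"
proof -
  assume "ptime f" "ptime g"
  then have "ptime (\<lambda>x. if f x then g x else False)" by (intro ptime_if ptime_const)
  moreover have "(if f x then g x else False) \<longleftrightarrow> f x \<and> g x" for x by simp
  ultimately show ?thesis by (simp only:)
qed

lemma ptime_disj [ptime_intros]: "ptime f \<Longrightarrow> ptime g \<Longrightarrow> ptime (\<lambda>x. f x \<or> g x)"
proof -
  assume "ptime f" "ptime g"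
  then have "ptime (\<lambda>x. \<not> (\<not> f x \<and> \<not> g x))" by (intro ptime_not ptime_conj)
  moreover have "\<not> (\<not> f x \<and> \<not> g x) \<longleftrightarrow> f x \<or> g x" for x by blast
  ultimately show ?thesis by (simp only:)
qed

lemma ptime_imp [ptime_intros]: "ptime f \<Longrightarrow> ptime g \<Longrightarrow> ptime (\<lambda>x. f x \<longrightarrow> g x)"
  unfolding imp_conv_disj by (intro ptime_not ptime_disj)

text \<open>The bound says that every step enlarges the accumulator by an amount that does not depend on
  the accumulator itself; without it, iteration could produce exponentially large values.\<close>

lemma ptime_foldl:
  fixes g :: "'x::encodable \<Rightarrow> 'a::encodable \<Rightarrow> 'e::encodable \<Rightarrow> 'a"
  assumes "ptime f" "ptime l"
    and "ptime (\<lambda>z. g (fst z) (fst (snd z)) (snd (snd z)))"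
    and "\<And>x a e. sz (g x a e) \<le> sz a + poly q (sz x + sz e)"
  shows "ptime (\<lambda>x. foldl (g x) (f x) (l x))"
  using ptime_comp3[of "\<lambda>x. foldl (g x)", OF ptime_foldl_core[of g q, OF assms(3,4)] ptime_id assms(1,2)]
  by simp

lemma ptime_sz_pair:
  assumes "ptime (\<lambda>z. h (fst z) (snd z))"
  obtains p where "\<And>x e. sz (h x e) \<le> poly p (sz x + sz e)"
proof -
  obtain p where p: "\<And>z. sz (h (fst z) (snd z)) \<le> poly p (sz z)"
    using ptime_sz[OF assms] by blast
  show ?thesis
  proof (rule that[of "pcompose p [:1, 1:]"])
    fix x e
    show "sz (h x e) \<le> poly (pcompose p [:1, 1:]) (sz x + sz e)"
      using p[of "(x, e)"] by (simp add: poly_pcompose)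
  qed
qed

lemma ptime_rev [ptime_intros]: "ptime f \<Longrightarrow> ptime (\<lambda>x. rev (f x))"
proof -
  assume f: "ptime f"
  have "ptime (\<lambda>x. foldl (\<lambda>acc e. e # acc) [] (f x))"
    by (rule ptime_foldl[of _ _ _ "[:1, 1:]"]) ((intro ptime_intros f)+, simp)
  moreover have "foldl (\<lambda>acc e. e # acc) acc xs = rev xs @ acc" for acc xs :: "'b list"
    by (induction xs arbitrary: acc) auto
  ultimately show ?thesis by simp
qed

lemma ptime_append [ptime_intros]:
  assumes "ptime f" "ptime g" shows "ptime (\<lambda>x. f x @ g x)"
proof -
  have "ptime (\<lambda>x. foldl (\<lambda>acc e. e # acc) (g x) (rev (f x)))"
    by (rule ptime_foldl[of _ _ _ "[:1, 1:]"]) ((intro ptime_intros assms)+, simp)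
  moreover have "foldl (\<lambda>acc e. e # acc) acc xs = rev xs @ acc" for acc xs :: "'b list"
    by (induction xs arbitrary: acc) auto
  ultimately show ?thesis by simp
qed

lemma ptime_map [ptime_intros]:
  fixes g :: "'a::encodable \<Rightarrow> 'b::encodable \<Rightarrow> 'c::encodable"
  assumes "ptime (\<lambda>z. g (fst z) (snd z))" "ptime l"
  shows "ptime (\<lambda>x. map (\<lambda>y. g x y) (l x))"
proof -
  obtain p where p: "\<And>x e. sz (g x e) \<le> poly p (sz x + sz e)"
    using ptime_sz_pair[OF assms(1)] by blast
  have "ptime (\<lambda>x. foldl (\<lambda>acc e. g x e # acc) [] (l x))"
  proof (rule ptime_foldl[of _ _ _ "1 + p"])
    show "ptime (\<lambda>z. g (fst z) (snd (snd z)) # fst (snd z))"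
      by (rule ptime_Cons) (rule ptime_comp2[OF assms(1)], (rule ptime_intros)+)
    show "sz (g x e # a) \<le> sz a + poly (1 + p) (sz x + sz e)" for x a e
      using p[of x e] by simp
  qed (intro ptime_intros assms)+
  then have "ptime (\<lambda>x. rev (foldl (\<lambda>acc e. g x e # acc) [] (l x)))" by (rule ptime_rev)
  moreover have "foldl (\<lambda>acc e. h e # acc) acc xs = rev (map h xs) @ acc" for acc xs and h :: "'b \<Rightarrow> 'c"
    by (induction xs arbitrary: acc) auto
  ultimately show ?thesis by simp
qed

lemma ptime_filter [ptime_intros]:
  assumes "ptime (\<lambda>z. g (fst z) (snd z))" "ptime l"
  shows "ptime (\<lambda>x. filter (\<lambda>y. g x y) (l x))"
proof -
  have "ptime (\<lambda>x. foldl (\<lambda>acc e. if g x e then e # acc else acc) [] (l x))"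
  proof (rule ptime_foldl[of _ _ _ "[:1, 1:]"])
    show "ptime (\<lambda>z. if g (fst z) (snd (snd z)) then snd (snd z) # fst (snd z) else fst (snd z))"
      by (rule ptime_if) (rule ptime_comp2[OF assms(1)], (rule ptime_intros)+)
  qed (intro ptime_intros assms | simp)+
  then have "ptime (\<lambda>x. rev (foldl (\<lambda>acc e. if g x e then e # acc else acc) [] (l x)))" by (rule ptime_rev)
  moreover have "foldl (\<lambda>acc e. if h e then e # acc else acc) acc xs = rev (filter h xs) @ acc"
    for acc xs and h :: "'b \<Rightarrow> bool"
    by (induction xs arbitrary: acc) auto
  ultimately show ?thesis by simp
qed

lemma ptime_concat [ptime_intros]: "ptime l \<Longrightarrow> ptime (\<lambda>x. concat (l x))"
proof -
  assume l: "ptime l"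
  have "ptime (\<lambda>x. foldl (\<lambda>acc e. acc @ e) [] (l x))"
  proof (rule ptime_foldl[of _ _ _ "[:0, 1:]"])
    show "sz (a @ e) \<le> sz a + poly [:0, 1:] (sz x + sz e)" for x :: 'a and a e :: "'b list"
      using sz_append[of a e] by simp
  qed (intro ptime_intros l)+
  moreover have "foldl (\<lambda>acc e. acc @ e) acc xs = acc @ concat xs" for acc :: "'b list" and xs
    by (induction xs arbitrary: acc) auto
  ultimately show ?thesis by simp
qed

lemma ptime_ball [ptime_intros]:
  assumes "ptime (\<lambda>z. g (fst z) (snd z))" "ptime l"
  shows "ptime (\<lambda>x. \<forall>y\<in>set (l x). g x y)"
proof -
  have "ptime (\<lambda>x. foldl (\<lambda>acc e. acc \<and> g x e) True (l x))"
  proof (rule ptime_foldl[of _ _ _ "[:3:]"])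
    show "ptime (\<lambda>z. fst (snd z) \<and> g (fst z) (snd (snd z)))"
      by (rule ptime_conj) ((rule ptime_intros)+, rule ptime_comp2[OF assms(1)], (rule ptime_intros)+)
    show "sz (a \<and> g x e) \<le> sz a + poly [:3:] (sz x + sz e)" for x a e
      using sz_bool[of "a \<and> g x e"] by simp
  qed (intro ptime_intros assms)+
  moreover have "foldl (\<lambda>acc e. acc \<and> h e) acc xs \<longleftrightarrow> acc \<and> (\<forall>y\<in>set xs. h y)" for acc xs and h :: "'b \<Rightarrow> bool"
    by (induction xs arbitrary: acc) auto
  ultimately show ?thesis by simp
qed

lemma ptime_bex [ptime_intros]:
  assumes "ptime (\<lambda>z. g (fst z) (snd z))" "ptime l"
  shows "ptime (\<lambda>x. \<exists>y\<in>set (l x). g x y)"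
proof -
  have "ptime (\<lambda>x. \<not> (\<forall>y\<in>set (l x). \<not> g x y))"
    by (intro ptime_not ptime_ball assms)
  then show ?thesis by simp
qed

lemma ptime_length [ptime_intros]: "ptime l \<Longrightarrow> ptime (\<lambda>x. length (l x))"
proof -
  assume l: "ptime l"
  have "ptime (\<lambda>x. foldl (\<lambda>acc e. Suc acc) 0 (l x))"
    by (rule ptime_foldl[of _ _ _ "[:2:]"]) ((intro ptime_intros l)+, simp)
  moreover have "foldl (\<lambda>acc e. Suc acc) acc xs = acc + length xs" for acc and xs :: "'b list"
    by (induction xs arbitrary: acc) auto
  ultimately show ?thesis by simp
qed

text \<open>A unary number and a list of units have the same code, so the identity program converts
  one into the other. This reduces arithmetic to list operations and lets a number serve as a loop
  counter.\<close>

lemma ptime_replicate_unit [ptime_intros]: "ptime f \<Longrightarrow> ptime (\<lambda>x. replicate (f x) ())"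
proof (rule ptime_comp[of "\<lambda>k. replicate k ()"], rule ptime_expr[of "Var 0" _ "\<lambda>x. x"])
  have *: "encode (replicate k ()) = encode k" for k by (induction k) auto
  then show "value_of (Var 0) s = encode (replicate k ())" if "s 0 = encode k" for k s
    using that by simp
  show "sz (replicate k ()) \<le> sz k" for k by (simp only: sz_def * order_refl)
qed (rule pbounded_id)

lemma ptime_add [ptime_intros]:
  assumes "ptime f" "ptime g" shows "ptime (\<lambda>x. f x + g x :: nat)"
proof -
  have "ptime (\<lambda>x. length (replicate (f x) () @ replicate (g x) ()))"
    by (intro ptime_intros assms)
  then show ?thesis by simp
qed

lemma ptime_diff [ptime_intros]:
  assumes "ptime f" "ptime g" shows "ptime (\<lambda>x. f x - g x :: nat)"
proof -
  have "ptime (\<lambda>x. foldl (\<lambda>acc e. acc - Suc 0) (f x) (replicate (g x) ()))"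
    by (rule ptime_foldl[of _ _ _ 0]) ((intro ptime_intros assms)+, simp)
  moreover have "foldl (\<lambda>acc e. acc - Suc 0) acc (replicate k ()) = acc - k" for acc k
    by (induction k arbitrary: acc) auto
  ultimately show ?thesis by simp
qed

lemma ptime_eq_0: "ptime f \<Longrightarrow> ptime (\<lambda>x. f x = (0::nat))"
proof -
  assume f: "ptime f"
  have "ptime (\<lambda>x. \<not> (\<exists>y\<in>set (replicate (f x) ()). True))"
    by (intro ptime_intros f)
  moreover have "\<not> (\<exists>y\<in>set (replicate (f x) ()). True) \<longleftrightarrow> f x = 0" for x by auto
  ultimately show ?thesis by (simp only:)
qed

lemma ptime_le [ptime_intros]:
  assumes "ptime f" "ptime g" shows "ptime (\<lambda>x. f x \<le> (g x :: nat))"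
  using ptime_eq_0[OF ptime_diff[OF assms]] by simp

lemma ptime_less [ptime_intros]:
  assumes "ptime f" "ptime g" shows "ptime (\<lambda>x. f x < (g x :: nat))"
  using ptime_not[OF ptime_le[OF assms(2,1)]] by (simp add: not_le)

lemma ptime_eq_nat [ptime_intros]:
  assumes "ptime f" "ptime g" shows "ptime (\<lambda>x. f x = (g x :: nat))"
  using ptime_conj[OF ptime_le[OF assms] ptime_le[OF assms(2,1)]] by (simp add: eq_iff)

lemma ptime_eq_prod [ptime_intros]:
  assumes "ptime (\<lambda>x. fst (f x) = fst (g x))" "ptime (\<lambda>x. snd (f x) = snd (g x))"
  shows "ptime (\<lambda>x. f x = g x)"
  using ptime_conj[OF assms] by (simp add: prod_eq_iff)

lemma ptime_mem [ptime_intros]: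
  assumes "ptime (\<lambda>z. f (fst z) = snd z)" "ptime l"
  shows "ptime (\<lambda>x. f x \<in> set (l x))"
  using ptime_bex[of "\<lambda>x y. f x = y", OF assms] by simp

lemma ptime_upt [ptime_intros]: "ptime f \<Longrightarrow> ptime (\<lambda>x. [0..<f x])"
proof -
  assume f: "ptime f"
  \<comment> \<open>The list is built from its end; the length of the accumulator tells how many
    elements are already there.\<close>
  have "ptime (\<lambda>k. foldl (\<lambda>acc e. (k - Suc (length acc)) # acc) [] (replicate k ()))"
    by (rule ptime_foldl[of _ _ _ "[:1, 1:]"]) ((intro ptime_intros)+, simp)
  moreover have "j \<le> k \<Longrightarrow> foldl (\<lambda>acc e. (k - Suc (length acc)) # acc) [] (replicate j ()) = [k - j..<k]" for j k
  proof (induction j)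
    case (Suc j)
    have "foldl (\<lambda>acc e. (k - Suc (length acc)) # acc) [] (replicate (Suc j) ()) =
      foldl (\<lambda>acc e. (k - Suc (length acc)) # acc) [] (replicate j () @ [()])"
      by (simp add: replicate_append_same)
    also have "\<dots> = (k - Suc j) # [k - j..<k]" using Suc by simp
    also have "\<dots> = [k - Suc j..<k]" using Suc.prems by (simp add: upt_conv_Cons Suc_diff_Suc)
    finally show ?case .
  qed simp
  ultimately have "ptime (\<lambda>k. [0..<k])" by simp
  then show ?thesis using f by (rule ptime_comp)
qed

lemma ptime_product [ptime_intros]:
  assumes "ptime f" "ptime g" shows "ptime (\<lambda>x. List.product (f x) (g x))"
proof -
  have "ptime (\<lambda>x. concat (map (\<lambda>y. map (\<lambda>z. (y, z)) (g x)) (f x)))"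
    by (intro ptime_intros assms ptime_comp[OF assms(2)])
  then show ?thesis by (simp add: product_concat_map)
qed

definition nth_or :: "'a \<Rightarrow> 'a list \<Rightarrow> nat \<Rightarrow> 'a" where
  "nth_or d xs k = hd_or d (drop k xs)"

lemma nth_or_nth: "nth_or d xs k = (if k < length xs then xs ! k else d)"
  by (auto simp: nth_or_def hd_or_def Cons_nth_drop_Suc[symmetric])

lemma ptime_nth_or [ptime_intros]:
  fixes f :: "'a::encodable \<Rightarrow> 'b::encodable list"
  assumes "encode d = Leaf" "ptime f" "ptime g" shows "ptime (\<lambda>x. nth_or d (f x) (g x))"
proof -
  have sz_tl: "sz (tl xs) \<le> sz xs" for xs :: "'b list" by (cases xs) auto
  have "ptime (\<lambda>x. foldl (\<lambda>acc e. tl acc) (f x) (replicate (g x) ()))"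
    by (rule ptime_foldl[of _ _ _ 0]) ((intro ptime_intros assms)+, simp add: sz_tl)
  moreover have "foldl (\<lambda>acc e. tl acc) xs (replicate k ()) = drop k xs" for xs :: "'b list" and k
    by (induction k arbitrary: xs) (auto simp: drop_Suc)
  ultimately show ?thesis unfolding nth_or_def using assms(1) by (intro ptime_intros) auto
qed

text \<open>The growth per step is compared with the size of a polynomial-time value
  \<open>b x e\<close>, which is easier to exhibit than a polynomial: for a filtered list it can be
  the unfiltered one.\<close>

lemma ptime_foldl_bounded:
  fixes g :: "'x::encodable \<Rightarrow> 'a::encodable \<Rightarrow> 'e::encodable \<Rightarrow> 'a"
  assumes "ptime f" "ptime l"
    and "ptime (\<lambda>z. g (fst z) (fst (snd z)) (snd (snd z)))"
    and "ptime (\<lambda>z. b (fst z) (snd z))"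
    and "\<And>x a e. sz (g x a e) \<le> sz a + sz (b x e)"
  shows "ptime (\<lambda>x. foldl (g x) (f x) (l x))"
proof -
  obtain p where p: "\<And>x e. sz (b x e) \<le> poly p (sz x + sz e)"
    using ptime_sz_pair[OF assms(4)] by blast
  show ?thesis
    by (rule ptime_foldl[OF assms(1-3), of p]) (use assms(5) p add_left_mono order_trans in blast)
qed

lemma sz_filter_le: "sz (filter P xs) \<le> sz xs"
  by (induction xs) auto

section \<open>The algorithm\<close>

definition cadj :: "bool list list \<Rightarrow> nat \<Rightarrow> nat \<Rightarrow> bool" where
  "cadj A u v \<longleftrightarrow> u = v \<or> nth_or False (nth_or [] A u) v"

text \<open>A maximal clique of an interval graph is the common closed neighborhood of two of its
  vertices, so pairs of vertices represent the maximal cliques (with repetitions).\<close>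

definition mem :: "bool list list \<Rightarrow> nat \<times> nat \<Rightarrow> nat \<Rightarrow> bool" where
  "mem A c w \<longleftrightarrow> cadj A (fst c) w \<and> cadj A (snd c) w"

text \<open>Cliques of this form are maximal: a vertex adjacent to all members is adjacent to the
  two generating vertices, which are members themselves, and so it already belongs.\<close>

definition cliques :: "bool list list \<Rightarrow> (nat \<times> nat) list" where
  "cliques A = filter (\<lambda>c. cadj A (fst c) (snd c) \<and>
     (\<forall>w\<in>set [0..<length A]. \<forall>x\<in>set [0..<length A]. mem A c w \<longrightarrow> mem A c x \<longrightarrow> cadj A w x))
     (List.product [0..<length A] [0..<length A])"

definition sep :: "bool list list \<Rightarrow> nat \<times> nat \<Rightarrow> nat \<times> nat \<Rightarrow> nat \<times> nat \<Rightarrow> bool" where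
  "sep A e c d \<longleftrightarrow> (\<exists>v\<in>set [0..<length A]. mem A c v \<and> mem A d v \<and> \<not> mem A e v)"

type_synonym clique_rel = "((nat \<times> nat) \<times> nat \<times> nat) list"

definition close_step :: "bool list list \<Rightarrow> clique_rel \<Rightarrow> clique_rel" where
  "close_step A R = filter (\<lambda>q. q \<in> set R \<or> (\<exists>c\<in>set (cliques A).
       (fst q, c) \<in> set R \<and> sep A (fst q) c (snd q) \<or> (c, snd q) \<in> set R \<and> sep A (snd q) c (fst q)))
     (List.product (cliques A) (cliques A))"

text \<open>The folded list only counts: its length is the number of pairs of cliques, hence an
  upper bound for the number of steps that can add a pair.\<close>

definition close :: "bool list list \<Rightarrow> clique_rel \<Rightarrow> clique_rel" where
  "close A R = foldl (\<lambda>R _. close_step A R) R (List.product (cliques A) (cliques A))"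

definition individualize :: "bool list list \<Rightarrow> clique_rel \<Rightarrow> nat \<times> nat \<Rightarrow> clique_rel" where
  "individualize A R d = filter (\<lambda>q. q \<in> set R \<or> fst q = d \<and> snd q \<noteq> d \<and> (snd q, d) \<notin> set R)
     (List.product (cliques A) (cliques A))"

definition unsettled :: "bool list list \<Rightarrow> clique_rel \<Rightarrow> nat \<times> nat \<Rightarrow> bool" where
  "unsettled A R d \<longleftrightarrow> (\<exists>x\<in>set (cliques A). x \<noteq> d \<and> (d, x) \<notin> set R \<and> (x, d) \<notin> set R)"

definition asymmetric :: "clique_rel \<Rightarrow> bool" where
  "asymmetric R \<longleftrightarrow> (\<forall>q\<in>set R. (snd q, fst q) \<notin> set R)"

text \<open>A clique put first may contradict every valid order, in which case some pair becomes
  comparable both ways; hence all candidates are tested. The appended \<open>R\<close> is the result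
  when there is no candidate or none passes.\<close>

definition refine :: "bool list list \<Rightarrow> clique_rel \<Rightarrow> clique_rel" where
  "refine A R = hd_or [] (filter asymmetric
     (map (\<lambda>d. close A (individualize A R d)) (filter (unsettled A R) (cliques A))) @ [R])"

definition clique_order :: "bool list list \<Rightarrow> clique_rel" where
  "clique_order A = foldl (\<lambda>R _. refine A R) [] (List.product (cliques A) (cliques A))"

text \<open>The positions (from 1) of the last and the first clique that contains \<open>v\<close>.\<close>

definition hi :: "bool list list \<Rightarrow> clique_rel \<Rightarrow> nat \<Rightarrow> nat" where
  "hi A R v = length (filter (\<lambda>c. \<exists>d\<in>set (cliques A). mem A d v \<and> (c = d \<or> (c, d) \<in> set R)) (cliques A))"

definition lo :: "bool list list \<Rightarrow> clique_rel \<Rightarrow> nat \<Rightarrow> nat" where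
  "lo A R v = Suc (length (filter (\<lambda>c. \<forall>d\<in>set (cliques A). mem A d v \<longrightarrow> (c, d) \<in> set R) (cliques A)))"

definition vertex_order :: "bool list list \<Rightarrow> clique_rel \<Rightarrow> nat list" where
  "vertex_order A R = concat (map (\<lambda>p. filter (\<lambda>v. hi A R v = p) [0..<length A])
     [0..<Suc (length (cliques A))])"

text \<open>\<open>es\<close> holds the last right end point on each track, such that for every \<open>k\<close> the first \<open>k\<close>
  tracks are those of the best-fit assignment to \<open>k\<close> tracks, up to order. The new end point \<open>h\<close>
  replaces the first \<open>e < l\<close>. With more tracks available, best fit would have used a larger such \<open>e\<close>,
  so the evicted end point takes the place of the next larger \<open>e < l\<close>, and so on.\<close>

primrec bub :: "nat \<Rightarrow> nat \<Rightarrow> nat list \<Rightarrow> nat list" where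
  "bub l h [] = []"
| "bub l h (e # es) = (if e < l \<and> (l \<le> h \<or> h < e) then h # bub l e es else e # bub l h es)"

text \<open>The number of busy tracks before the first free one. So the vertex is accepted on
  \<open>k\<close> tracks exactly if its level is below \<open>k\<close>, see
  \<open>level_less_iff\<close>.\<close>

definition level :: "nat \<Rightarrow> nat \<Rightarrow> nat list \<Rightarrow> nat" where
  "level n l es = length (filter (\<lambda>k. \<forall>j\<in>set [0..<Suc k]. l \<le> nth_or 0 es j) [0..<n])"

definition level_step ::
    "bool list list \<times> clique_rel \<Rightarrow> nat list \<times> (nat \<times> nat) list \<Rightarrow> nat \<Rightarrow> nat list \<times> (nat \<times> nat) list" where
  "level_step G s v = (bub (lo (fst G) (snd G) v) (hi (fst G) (snd G) v) (fst s),
     (v, level (length (fst G)) (lo (fst G) (snd G) v) (fst s)) # snd s)"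

text \<open>There are as many tracks as vertices, and the initial end point 0 lies below every
  \<open>lo\<close>, so each track starts free.\<close>

definition levels :: "bool list list \<times> clique_rel \<Rightarrow> (nat \<times> nat) list" where
  "levels G = snd (foldl (level_step G) (map (\<lambda>_. 0) (fst G), []) (vertex_order (fst G) (snd G)))"

text \<open>\<open>levels\<close> lists the vertices in reverse order of processing, so those
  colored earlier end no earlier than the current one. Its neighbors among them all contain its
  right end point, and at most one of them shares its level.\<close>

definition color_step :: "bool list list \<Rightarrow> (nat \<times> nat) list \<Rightarrow> nat \<times> nat \<Rightarrow> (nat \<times> nat) list" where
  "color_step A cs w = (fst w,
     if \<exists>z\<in>set cs. snd z = Suc (snd w + snd w) \<and> cadj A (fst z) (fst w)
     then Suc (Suc (snd w + snd w)) else Suc (snd w + snd w)) # cs"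

definition colors :: "bool list list \<Rightarrow> (nat \<times> nat) list" where
  "colors A = foldl (color_step A) [] (levels (A, clique_order A))"

definition output_color :: "(nat \<times> nat) list \<Rightarrow> nat \<Rightarrow> nat" where
  "output_color cs v = hd_or 0 (map snd (filter (\<lambda>z. fst z = v) cs))"

definition coloring_alg :: "bool list list \<Rightarrow> nat list" where
  "coloring_alg A = map (output_color (colors A)) [0..<length A]"

section \<open>Running time of the algorithm\<close>

lemma ptime_cadj [ptime_intros]: "ptime f \<Longrightarrow> ptime g \<Longrightarrow> ptime h \<Longrightarrow> ptime (\<lambda>x. cadj (f x) (g x) (h x))"
  unfolding cadj_def by (intro ptime_intros) simp_all

lemma ptime_in_clique [ptime_intros]: "ptime f \<Longrightarrow> ptime g \<Longrightarrow> ptime h \<Longrightarrow> ptime (\<lambda>x. mem (f x) (g x) (h x))"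
  unfolding mem_def by (intro ptime_intros)

lemma ptime_cliques [ptime_intros]: "ptime f \<Longrightarrow> ptime (\<lambda>x. cliques (f x))"
  by (rule ptime_comp[of cliques], unfold cliques_def) (intro ptime_intros)+

lemma ptime_sep [ptime_intros]:
  assumes "ptime f" "ptime g" "ptime h" "ptime k"
  shows "ptime (\<lambda>x. sep (f x) (g x) (h x) (k x))"
proof -
  have "ptime (\<lambda>z. sep (fst z) (fst (snd z)) (fst (snd (snd z))) (snd (snd (snd z))))"
    unfolding sep_def by (intro ptime_intros)
  from ptime_comp[OF this ptime_pair[OF assms(1) ptime_pair[OF assms(2) ptime_pair[OF assms(3,4)]]]]
  show ?thesis by simp
qed

lemma ptime_close_step [ptime_intros]: "ptime f \<Longrightarrow> ptime g \<Longrightarrow> ptime (\<lambda>x. close_step (f x) (g x))"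
  by (rule ptime_comp2, unfold close_step_def) (intro ptime_intros)+

lemma ptime_close [ptime_intros]:
  assumes "ptime f" "ptime g" shows "ptime (\<lambda>x. close (f x) (g x))"
proof (rule ptime_comp2[of close, OF _ assms])
  show "ptime (\<lambda>z. close (fst z) (snd z))"
    unfolding close_def
  proof (rule ptime_foldl_bounded[where b = "\<lambda>x e. List.product (cliques (fst x)) (cliques (fst x))"])
    show "sz (close_step (fst x) a) \<le> sz a + sz (List.product (cliques (fst x)) (cliques (fst x)))"
      for x :: "bool list list \<times> clique_rel" and a
      unfolding close_step_def using sz_filter_le trans_le_add2 by blast
  qed (intro ptime_intros)+
qed

lemma ptime_individualize [ptime_intros]:
  assumes "ptime f" "ptime g" "ptime h" shows "ptime (\<lambda>x. individualize (f x) (g x) (h x))"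
  by (rule ptime_comp3[of individualize, OF _ assms], unfold individualize_def) (intro ptime_intros)+

lemma ptime_unsettled [ptime_intros]:
  assumes "ptime f" "ptime g" "ptime h" shows "ptime (\<lambda>x. unsettled (f x) (g x) (h x))"
  by (rule ptime_comp3[of unsettled, OF _ assms], unfold unsettled_def) (intro ptime_intros)+

lemma ptime_asymmetric [ptime_intros]: "ptime f \<Longrightarrow> ptime (\<lambda>x. asymmetric (f x))"
  by (rule ptime_comp[of asymmetric], unfold asymmetric_def) (intro ptime_intros)+

lemma ptime_refine [ptime_intros]: "ptime f \<Longrightarrow> ptime g \<Longrightarrow> ptime (\<lambda>x. refine (f x) (g x))"
  by (rule ptime_comp2[of refine], unfold refine_def) ((intro ptime_intros)+, simp)

text \<open>Serves the running time: whatever is derived, the relation remains a sublist of the list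
  of all pairs, which caps its size.\<close>

lemma close_subset_product:
  "\<exists>P. close A (individualize A R d) = filter P (List.product (cliques A) (cliques A))"
proof -
  have "(\<exists>P. foldl (\<lambda>R _. close_step A R) R l = filter P (List.product (cliques A) (cliques A)))"
    if "\<exists>P. R = filter P (List.product (cliques A) (cliques A))" for R and l :: "clique_rel"
    using that by (induction l arbitrary: R) (auto simp: close_step_def)
  then show ?thesis unfolding close_def individualize_def by blast
qed

lemma refine_cases:
  obtains "refine A R = R" | d where "d \<in> set (cliques A)" "unsettled A R d"
    "asymmetric (close A (individualize A R d))" "refine A R = close A (individualize A R d)"
  | "refine A R = []"
proof -
  define S where "S = filter asymmetric
     (map (\<lambda>d. close A (individualize A R d)) (filter (unsettled A R) (cliques A))) @ [R]"
  have "refine A R = [] \<or> refine A R \<in> set S"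
    unfolding refine_def S_def[symmetric] by (cases S) auto
  then show ?thesis using that unfolding S_def by auto
qed

lemma ptime_clique_order [ptime_intros]: "ptime f \<Longrightarrow> ptime (\<lambda>x. clique_order (f x))"
proof (rule ptime_comp[of clique_order])
  show "ptime clique_order"
    unfolding clique_order_def
  proof (rule ptime_foldl_bounded[where b = "\<lambda>A e. List.product (cliques A) (cliques A)"])
    show "sz (refine A R) \<le> sz R + sz (List.product (cliques A) (cliques A))" for A R
    proof (rule refine_cases[of A R])
      fix d assume "refine A R = close A (individualize A R d)"
      then show ?thesis using close_subset_product sz_filter_le trans_le_add2 by metis
    qed (auto simp: sz_pos Suc_leI trans_le_add1)
  qed (intro ptime_intros)+
qed

lemma ptime_hi [ptime_intros]:
  assumes "ptime f" "ptime g" "ptime h" shows "ptime (\<lambda>x. hi (f x) (g x) (h x))"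
  by (rule ptime_comp3[of hi, OF _ assms], unfold hi_def) (intro ptime_intros)+

lemma ptime_lo [ptime_intros]:
  assumes "ptime f" "ptime g" "ptime h" shows "ptime (\<lambda>x. lo (f x) (g x) (h x))"
  by (rule ptime_comp3[of lo, OF _ assms], unfold lo_def) (intro ptime_intros)+

lemma ptime_vertex_order [ptime_intros]:
  assumes "ptime f" "ptime g" shows "ptime (\<lambda>x. vertex_order (f x) (g x))"
  by (rule ptime_comp2[of vertex_order, OF _ assms], unfold vertex_order_def) (intro ptime_intros)+

text \<open>The recursion changes its argument \<open>h\<close>. Carrying \<open>h\<close> along
  with the finished prefix turns \<open>bub\<close> into a fold, for which a running time rule is
  available.\<close>

lemma bub_foldl:
  "bub l h es = snd (foldl (\<lambda>s e. if e < l \<and> (l \<le> fst s \<or> fst s < e) then (e, snd s @ [fst s])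
     else (fst s, snd s @ [e])) (h, []) es)"
proof -
  have "snd (foldl (\<lambda>s e. if e < l \<and> (l \<le> fst s \<or> fst s < e) then (e, snd s @ [fst s])
     else (fst s, snd s @ [e])) (h, ys) es) = ys @ bub l h es" for ys
    by (induction es arbitrary: h ys) auto
  from this[of "[]"] show ?thesis by simp
qed

lemma sz_bub: "sz (bub l h es) \<le> sz es + sz h"
  by (induction es arbitrary: h) (auto simp del: sz_nat simp: add.commute)

lemma ptime_bub [ptime_intros]:
  assumes "ptime f" "ptime g" "ptime h" shows "ptime (\<lambda>x. bub (f x) (g x) (h x))"
proof (rule ptime_comp3[of bub, OF _ assms])
  show "ptime (\<lambda>z. bub (fst z) (fst (snd z)) (snd (snd z)))"
    unfolding bub_foldl
  proof (rule ptime_snd, rule ptime_foldl_bounded[where b = "\<lambda>x e. (e, e)"])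
    show "sz (if e < fst x \<and> (fst x \<le> fst s \<or> fst s < e) then (e, snd s @ [fst s]) else (fst s, snd s @ [e]))
        \<le> sz s + sz (e, e)" for x :: "nat \<times> nat \<times> nat list" and s e
      using sz_append[of "snd s" "[e]"] sz_append[of "snd s" "[fst s]"] by (cases s) auto
  qed (intro ptime_intros)+
qed

lemma ptime_level [ptime_intros]:
  assumes "ptime f" "ptime g" "ptime h" shows "ptime (\<lambda>x. level (f x) (g x) (h x))"
  by (rule ptime_comp3[of level, OF _ assms], unfold level_def) ((intro ptime_intros)+, simp)

lemma level_le: "level n l es \<le> n"
  unfolding level_def using length_filter_le[of _ "[0..<n]"] by simp

lemma ptime_level_step [ptime_intros]:
  assumes "ptime f" "ptime g" "ptime h" shows "ptime (\<lambda>x. level_step (f x) (g x) (h x))"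
  by (rule ptime_comp3[of level_step, OF _ assms], unfold level_step_def) (intro ptime_intros)+

lemma ptime_levels [ptime_intros]: "ptime f \<Longrightarrow> ptime (\<lambda>x. levels (f x))"
proof (rule ptime_comp[of levels])
  show "ptime levels"
    unfolding levels_def
  proof (rule ptime_snd, rule ptime_foldl_bounded[where b = "\<lambda>G v. (hi (fst G) (snd G) v, v, length (fst G))"])
    show "sz (level_step G s v) \<le> sz s + sz (hi (fst G) (snd G) v, v, length (fst G))" for G s v
      unfolding level_step_def
      using sz_bub[of "lo (fst G) (snd G) v" "hi (fst G) (snd G) v" "fst s"]
        level_le[of "length (fst G)" "lo (fst G) (snd G) v" "fst s"] by (cases s) auto
  qed (intro ptime_intros)+
qed

lemma ptime_color_step [ptime_intros]:
  assumes "ptime f" "ptime g" "ptime h" shows "ptime (\<lambda>x. color_step (f x) (g x) (h x))"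
  by (rule ptime_comp3[of color_step, OF _ assms], unfold color_step_def) (intro ptime_intros)+

lemma ptime_colors [ptime_intros]: "ptime f \<Longrightarrow> ptime (\<lambda>x. colors (f x))"
proof (rule ptime_comp[of colors])
  show "ptime colors"
    unfolding colors_def
  proof (rule ptime_foldl_bounded[where b = "\<lambda>A w. (w, Suc (Suc (snd w + snd w)))"])
    show "sz (color_step A cs w) \<le> sz cs + sz (w, Suc (Suc (snd w + snd w)))" for A cs w
      unfolding color_step_def by (cases w) auto
  qed (intro ptime_intros)+
qed

lemma ptime_output_color [ptime_intros]:
  assumes "ptime f" "ptime g" shows "ptime (\<lambda>x. output_color (f x) (g x))"
  by (rule ptime_comp2[of output_color, OF _ assms], unfold output_color_def) ((intro ptime_intros)+, simp)

lemma ptime_coloring_alg: "ptime coloring_alg"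
  unfolding coloring_alg_def by (intro ptime_intros)

section \<open>Ordering the cliques\<close>

text \<open>Each step that changes the set adds an element of \<open>U\<close>, so after
  \<open>card U\<close> steps the set is fixed or all of \<open>U\<close>.\<close>

lemma funpow_reaches_fixpoint:
  assumes "finite U" "card U \<le> k" "X \<subseteq> U"
    and f: "\<And>Y. Y \<subseteq> U \<Longrightarrow> Y \<subseteq> f Y \<and> f Y \<subseteq> U"
  shows "f ((f ^^ k) X) = (f ^^ k) X"
proof -
  have U: "(f ^^ i) X \<subseteq> U" for i
    by (induction i) (use assms f in auto)
  have "f ((f ^^ i) X) = (f ^^ i) X \<or> i \<le> card ((f ^^ i) X)" for i
  proof (induction i)
    case (Suc i)
    show ?case
    proof (cases "f ((f ^^ i) X) = (f ^^ i) X")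
      case False
      then have "(f ^^ i) X \<subset> (f ^^ Suc i) X" using f[OF U[of i]] by auto
      then have "card ((f ^^ i) X) < card ((f ^^ Suc i) X)"
        using U assms(1) by (meson finite_subset psubset_card_mono)
      with Suc False show ?thesis by simp
    qed simp
  qed simp
  moreover have "f ((f ^^ k) X) = (f ^^ k) X" if "k \<le> card ((f ^^ k) X)"
  proof -
    have "(f ^^ k) X = U"
      using that U[of k] assms(1,2) by (simp add: card_seteq)
    then show ?thesis using f[of U] by auto
  qed
  ultimately show ?thesis by blast
qed

text \<open>\<open>M c v\<close> says that \<open>v\<close> belongs to \<open>c\<close>. If \<open>c\<close> and \<open>d\<close> share an element that \<open>e\<close> lacks, then \<open>e\<close>
  cannot lie between \<open>c\<close> and \<open>d\<close> in an order in which every element occupies consecutive sets.\<close>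

definition separates :: "('c \<Rightarrow> 'v \<Rightarrow> bool) \<Rightarrow> 'v set \<Rightarrow> 'c \<Rightarrow> 'c \<Rightarrow> 'c \<Rightarrow> bool" where
  "separates M V e c d \<longleftrightarrow> (\<exists>v\<in>V. M c v \<and> M d v \<and> \<not> M e v)"

definition consecutive :: "('c \<Rightarrow> 'c \<Rightarrow> 'c \<Rightarrow> bool) \<Rightarrow> 'c set \<Rightarrow> 'c rel \<Rightarrow> bool" where
  "consecutive S I R \<longleftrightarrow> (\<forall>e\<in>I. \<forall>c\<in>I. \<forall>d\<in>I. S e c d \<longrightarrow>
     ((e, c) \<in> R \<longrightarrow> (e, d) \<in> R) \<and> ((c, e) \<in> R \<longrightarrow> (d, e) \<in> R))"

definition negtrans :: "'c set \<Rightarrow> 'c rel \<Rightarrow> bool" where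
  "negtrans I R \<longleftrightarrow> (\<forall>a b. (a, b) \<in> R \<longrightarrow> (\<forall>g\<in>I. (a, g) \<in> R \<or> (g, b) \<in> R))"

definition asymm :: "'c rel \<Rightarrow> bool" where
  "asymm R \<longleftrightarrow> (\<forall>a b. (a, b) \<in> R \<longrightarrow> (b, a) \<notin> R)"

definition weak :: "'c set \<Rightarrow> 'c rel \<Rightarrow> bool" where
  "weak I R \<longleftrightarrow> R \<subseteq> I \<times> I \<and> asymm R \<and> negtrans I R"

lemma weak_trans: "weak I R \<Longrightarrow> (a, b) \<in> R \<Longrightarrow> (b, c) \<in> R \<Longrightarrow> (a, c) \<in> R"
  unfolding weak_def asymm_def negtrans_def by blast

text \<open>Ties of a weak order are broken by a given valid order.\<close>

lemma extend_to_total: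
  assumes R: "weak I R" "consecutive (separates M V) I R"
    and L: "weak I L" "total_on I L" "consecutive (separates M V) I L"
  shows "\<exists>L'. R \<subseteq> L' \<and> weak I L' \<and> total_on I L' \<and> consecutive (separates M V) I L'"
proof -
  define L' where "L' = R \<union> {(a, b) \<in> L. (a, b) \<notin> R \<and> (b, a) \<notin> R}"
  have sub: "L' \<subseteq> I \<times> I" using R(1) L(1) by (auto simp: L'_def weak_def)
  have as: "asymm L'" using R(1) L(1) by (auto simp: L'_def weak_def asymm_def)
  have tot: "total_on I L'" using L(2) by (auto simp: L'_def total_on_def)
  have tr: "(a, c) \<in> L'" if ab: "(a, b) \<in> L'" and bc: "(b, c) \<in> L'" for a b c
  proof -
    have abc: "a \<in> I" "b \<in> I" "c \<in> I" using ab bc sub by auto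
    have nt: "(x, z) \<in> R \<or> (z, y) \<in> R" if "(x, y) \<in> R" "z \<in> I" for x y z
      using R(1) that by (auto simp: weak_def negtrans_def)
    have aR: "(y, x) \<notin> R" if "(x, y) \<in> R" for x y
      using R(1) that by (auto simp: weak_def asymm_def)
    have "(a, c) \<in> L'" if "(a, b) \<in> R" using that nt[OF that, of c] abc bc aR by (auto simp: L'_def)
    moreover have "(a, c) \<in> L'" if "(b, c) \<in> R" using that nt[OF that, of a] abc ab aR by (auto simp: L'_def)
    \<comment> \<open>Being tied is transitive by negative transitivity, so here \<open>a\<close>
      and \<open>c\<close> are tied as well and \<open>L\<close> decides.\<close>
    moreover have "(a, c) \<in> L'" if "(a, b) \<notin> R" "(b, c) \<notin> R"
    proof -
      have "(a, b) \<in> L" "(b, c) \<in> L" "(b, a) \<notin> R" "(c, b) \<notin> R" using that ab bc by (auto simp: L'_def)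
      then show ?thesis using weak_trans[OF L(1)] nt[of c a b] nt[of a c b] that abc
        by (auto simp: L'_def)
    qed
    ultimately show ?thesis by blast
  qed
  have "negtrans I L'"
    unfolding negtrans_def
  proof (intro allI impI ballI)
    fix a b g assume ab: "(a, b) \<in> L'" and g: "g \<in> I"
    then have "a \<in> I" "b \<in> I" using sub by auto
    with tot g have "a = g \<or> (a, g) \<in> L' \<or> (g, a) \<in> L'" by (auto simp: total_on_def)
    then show "(a, g) \<in> L' \<or> (g, b) \<in> L'" using ab tr by blast
  qed
  moreover have "consecutive (separates M V) I L'"
  proof -
    \<comment> \<open>\<open>separates\<close> is symmetric in its last two arguments, so
      consecutiveness yields equivalences. Hence \<open>e\<close> is tied with \<open>c\<close>
      exactly if it is tied with \<open>d\<close>, and \<open>L\<close> then breaks both ties in the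
      same direction.\<close>
    have RR: "(e, c) \<in> R \<longleftrightarrow> (e, d) \<in> R" "(c, e) \<in> R \<longleftrightarrow> (d, e) \<in> R"
      if "e \<in> I" "c \<in> I" "d \<in> I" "separates M V e c d" for e c d
      using R(2) that unfolding consecutive_def by (auto simp: separates_def)
    show ?thesis unfolding consecutive_def
    proof (intro ballI impI)
      fix e c d assume *: "e \<in> I" "c \<in> I" "d \<in> I" "separates M V e c d"
      show "((e, c) \<in> L' \<longrightarrow> (e, d) \<in> L') \<and> ((c, e) \<in> L' \<longrightarrow> (d, e) \<in> L')"
        using RR[OF *] L(3) * unfolding L'_def consecutive_def by blast
    qed
  qed
  ultimately show ?thesis using sub as tot by (intro exI[of _ L']) (auto simp: weak_def L'_def)
qed

section \<open>Closing a relation under forced comparisons\<close>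

definition closure_step :: "('c \<Rightarrow> 'c \<Rightarrow> 'c \<Rightarrow> bool) \<Rightarrow> 'c set \<Rightarrow> 'c rel \<Rightarrow> 'c rel" where
  "closure_step S I R = {(a, b) \<in> I \<times> I. (a, b) \<in> R \<or>
     (\<exists>c\<in>I. (a, c) \<in> R \<and> S a c b \<or> (c, b) \<in> R \<and> S b c a)}"

lemma closure_step_fixpoint: "closure_step S I R = R \<Longrightarrow> consecutive S I R"
  unfolding closure_step_def consecutive_def by blast

lemma closure_step_subset_order:
  assumes "R \<subseteq> L" "consecutive S I L"
  shows "closure_step S I R \<subseteq> L"
  using assms unfolding closure_step_def consecutive_def by blast

text \<open>Let \<open>(a, b)\<close> be forced by \<open>(a, c)\<close> in \<open>R\<close> and an
  element \<open>v\<close> of \<open>c\<close> and \<open>b\<close> that is not in \<open>a\<close>.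
  If \<open>v\<close> lies in \<open>g\<close>, it forces \<open>(a, g)\<close> in the same way.
  Otherwise \<open>R\<close> has \<open>(a, g)\<close> or \<open>(g, c)\<close>, and in the latter
  case \<open>v\<close> forces \<open>(g, b)\<close>. The other rule is symmetric.\<close>

lemma negtrans_closure_step:
  assumes sub: "R \<subseteq> I \<times> I" and R: "negtrans I R"
  shows "negtrans I (closure_step (separates M V) I R)"
proof -
  let ?F = "closure_step (separates M V) I R"
  have inc: "R \<subseteq> ?F" using sub unfolding closure_step_def by auto
  have right: "(a, g) \<in> ?F \<or> (g, b) \<in> ?F"
    if asm: "(a, c) \<in> R" "separates M V a c b" "a \<in> I" "b \<in> I" "c \<in> I" "g \<in> I" for a b c g
  proof -
    obtain v where v: "v \<in> V" "M c v" "M b v" "\<not> M a v" using asm(2) by (auto simp: separates_def)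
    have "(a, g) \<in> R \<or> (g, c) \<in> R" using R asm by (auto simp: negtrans_def)
    moreover have "separates M V a c g" if "M g v" using v that by (auto simp: separates_def)
    moreover have "separates M V g c b" if "\<not> M g v" using v that by (auto simp: separates_def)
    ultimately show ?thesis using asm inc unfolding closure_step_def by blast
  qed
  have left: "(a, g) \<in> ?F \<or> (g, b) \<in> ?F"
    if asm: "(c, b) \<in> R" "separates M V b c a" "a \<in> I" "b \<in> I" "c \<in> I" "g \<in> I" for a b c g
  proof -
    obtain v where v: "v \<in> V" "M c v" "M a v" "\<not> M b v" using asm(2) by (auto simp: separates_def)
    have "(c, g) \<in> R \<or> (g, b) \<in> R" using R asm by (auto simp: negtrans_def)
    moreover have "separates M V b c g" if "M g v" using v that by (auto simp: separates_def)
    moreover have "separates M V g c a" if "\<not> M g v" using v that by (auto simp: separates_def)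
    ultimately show ?thesis using asm inc unfolding closure_step_def by blast
  qed
  show ?thesis
    unfolding negtrans_def
  proof (intro allI impI ballI)
    fix a b g assume "(a, b) \<in> ?F" "g \<in> I"
    then consider "(a, b) \<in> R"
      | c where "(a, c) \<in> R" "separates M V a c b" "a \<in> I" "b \<in> I" "c \<in> I"
      | c where "(c, b) \<in> R" "separates M V b c a" "a \<in> I" "b \<in> I" "c \<in> I"
      unfolding closure_step_def by blast
    then show "(a, g) \<in> ?F \<or> (g, b) \<in> ?F"
    proof cases
      case 1
      then show ?thesis using R \<open>g \<in> I\<close> inc unfolding negtrans_def by blast
    qed (use right left \<open>g \<in> I\<close> in blast)+
  qed
qed

text \<open>The last conclusion makes guessing sound: what is derived from a base inside a
  consecutive relation \<open>L\<close> stays inside \<open>L\<close>, so a right guess never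
  produces a contradiction.\<close>

lemma closure_properties:
  fixes M :: "'c \<Rightarrow> 'v \<Rightarrow> bool" and V :: "'v set"
  assumes "finite I" "card I * card I \<le> k" "B \<subseteq> I \<times> I" "negtrans I B"
  defines "C \<equiv> (closure_step (separates M V) I ^^ k) B"
  shows "B \<subseteq> C" "C \<subseteq> I \<times> I" "negtrans I C" "consecutive (separates M V) I C"
    and "B \<subseteq> L \<Longrightarrow> consecutive (separates M V) I L \<Longrightarrow> C \<subseteq> L"
proof -
  let ?F = "closure_step (separates M V) I"
  have "(?F ^^ i) B \<subseteq> I \<times> I \<and> B \<subseteq> (?F ^^ i) B \<and> negtrans I ((?F ^^ i) B)" for i
  proof (induction i)
    case (Suc i)
    moreover have "(?F ^^ i) B \<subseteq> ?F ((?F ^^ i) B)" "?F ((?F ^^ i) B) \<subseteq> I \<times> I"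
      using Suc unfolding closure_step_def by auto
    ultimately show ?case using negtrans_closure_step[of "(?F ^^ i) B" I M V] by auto
  qed (use assms in auto)
  then show "B \<subseteq> C" "C \<subseteq> I \<times> I" "negtrans I C" by (auto simp: C_def)
  have "?F C = C" unfolding C_def
    by (rule funpow_reaches_fixpoint[where U = "I \<times> I"])
      (use assms in \<open>auto simp: closure_step_def card_cartesian_product\<close>)
  then show "consecutive (separates M V) I C" by (rule closure_step_fixpoint)
  show "C \<subseteq> L" if "B \<subseteq> L" "consecutive (separates M V) I L"
  proof -
    have "(?F ^^ i) B \<subseteq> L" for i
    proof (induction i)
      case (Suc i)
      show ?case using closure_step_subset_order[OF Suc that(2)] by simp
    qed (use that in simp)
    then show ?thesis by (simp add: C_def)
  qed
qed

definition place_first :: "'c set \<Rightarrow> 'c rel \<Rightarrow> 'c \<Rightarrow> 'c rel" where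
  "place_first I R d = {(a, b) \<in> I \<times> I. (a, b) \<in> R \<or> a = d \<and> b \<noteq> d \<and> (b, d) \<notin> R}"

lemma negtrans_place_first: "weak I R \<Longrightarrow> d \<in> I \<Longrightarrow> negtrans I (place_first I R d)"
  unfolding weak_def negtrans_def place_first_def by blast

definition tied :: "'c set \<Rightarrow> 'c rel \<Rightarrow> 'c \<Rightarrow> bool" where
  "tied I R d \<longleftrightarrow> (\<exists>x\<in>I. x \<noteq> d \<and> (d, x) \<notin> R \<and> (x, d) \<notin> R)"

text \<open>In a valid order that extends \<open>R\<close>, take the first clique \<open>d\<close>
  that is tied with another one. Cliques tied with \<open>d\<close> are themselves tied, so they
  come later, and the order contains \<open>place_first I R d\<close>.\<close>

lemma exists_consistent_first:
  assumes "finite I" "weak I R" "consecutive (separates M V) I R" "\<not> total_on I R"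
    and L: "weak I L" "total_on I L" "consecutive (separates M V) I L"
  obtains d L' where "d \<in> I" "tied I R d" "place_first I R d \<subseteq> L'" "asymm L'"
    "consecutive (separates M V) I L'"
proof -
  obtain L' where L': "R \<subseteq> L'" "weak I L'" "total_on I L'" "consecutive (separates M V) I L'"
    using extend_to_total[OF assms(2,3) L] by blast
  let ?T = "{d \<in> I. tied I R d}"
  let ?f = "\<lambda>d. card {c. (c, d) \<in> L'}"
  have "?T \<noteq> {}" using assms(4) by (auto simp: total_on_def tied_def)
  then obtain d where d: "d \<in> ?T" "\<And>x. x \<in> ?T \<Longrightarrow> ?f d \<le> ?f x"
    using ex_has_least_nat[of "\<lambda>d. d \<in> ?T" _ ?f] by blast
  have min: "(x, d) \<notin> L'" if "x \<in> ?T" for x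
  proof
    assume xd: "(x, d) \<in> L'"
    have "{c. (c, d) \<in> L'} \<subseteq> I" using L'(2) by (auto simp: weak_def)
    then have "finite {c. (c, d) \<in> L'}" using assms(1) by (rule finite_subset)
    moreover have "{c. (c, x) \<in> L'} \<subset> {c. (c, d) \<in> L'}"
    proof
      show "{c. (c, x) \<in> L'} \<subseteq> {c. (c, d) \<in> L'}" using weak_trans[OF L'(2) _ xd] by blast
      have "(x, x) \<notin> L'" using L'(2) by (auto simp: weak_def asymm_def)
      then show "{c. (c, x) \<in> L'} \<noteq> {c. (c, d) \<in> L'}" using xd by blast
    qed
    ultimately have "?f x < ?f d" by (rule psubset_card_mono)
    then show False using d(2)[OF that] by simp
  qed
  have "place_first I R d \<subseteq> L'"
  proof
    fix q assume "q \<in> place_first I R d"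
    then consider "q \<in> R" | b where "q = (d, b)" "b \<in> I" "b \<noteq> d" "(b, d) \<notin> R" "(d, b) \<notin> R"
      unfolding place_first_def by blast
    then show "q \<in> L'"
    proof cases
      case 2
      then have "b \<in> ?T" using d(1) by (auto simp: tied_def)
      then show ?thesis using min[of b] 2 L'(3) d(1) by (auto simp: total_on_def)
    qed (use L' in blast)
  qed
  then show ?thesis using that[of d L'] d L' by (auto simp: weak_def)
qed

section \<open>Transfer to the lists of the algorithm\<close>

lemma foldl_const: "foldl (\<lambda>R _. f R) R l = (f ^^ length l) R"
  by (induction l arbitrary: R) (auto simp: funpow_swap1)

lemma sep_eq_separates: "sep A = separates (mem A) {..<length A}"
  by (auto simp: fun_eq_iff sep_def separates_def)

lemma set_close_step: "set (close_step A R) = closure_step (sep A) (set (cliques A)) (set R)"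
  by (auto simp: close_step_def closure_step_def)

lemma set_close:
  "set (close A R) = (closure_step (sep A) (set (cliques A)) ^^ (length (cliques A) * length (cliques A))) (set R)"
proof -
  have "set ((close_step A ^^ k) R) = (closure_step (sep A) (set (cliques A)) ^^ k) (set R)" for k
    by (induction k) (auto simp: set_close_step)
  then show ?thesis by (simp add: close_def foldl_const)
qed

lemma set_individualize: "set (individualize A R d) = place_first (set (cliques A)) (set R) d"
  by (auto simp: individualize_def place_first_def)

lemma unsettled_iff_tied: "unsettled A R d \<longleftrightarrow> tied (set (cliques A)) (set R) d"
  by (auto simp: unsettled_def tied_def)

lemma asymmetric_iff_asymm: "asymmetric R \<longleftrightarrow> asymm (set R)"
  by (auto simp: asymmetric_def asymm_def)

text \<open>The candidate from \<open>exists_consistent_first\<close> only shows that the test is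
  passed by someone; \<open>refine\<close> may pick another. That one is as good, because its
  closure is also asymmetric, negatively transitive and consecutive. Being tied with some clique, it
  adds a pair.\<close>

lemma refine_progress:
  fixes A R
  defines "I \<equiv> set (cliques A)"
  assumes R: "weak I (set R)" "consecutive (sep A) I (set R)"
    and L: "weak I L" "total_on I L" "consecutive (sep A) I L"
  shows "total_on I (set R) \<and> refine A R = R \<or>
    weak I (set (refine A R)) \<and> consecutive (sep A) I (set (refine A R)) \<and> set R \<subset> set (refine A R)"
proof -
  define f where "f = (\<lambda>d. close A (individualize A R d))"
  have ind: "set (individualize A R d) \<subseteq> I \<times> I" "set R \<subseteq> set (individualize A R d)"
    "d \<in> I \<Longrightarrow> negtrans I (set (individualize A R d))" for d
    using R(1) negtrans_place_first[of I "set R" d]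
    by (auto simp: set_individualize I_def[symmetric] place_first_def weak_def)
  have card: "card I * card I \<le> length (cliques A) * length (cliques A)"
    unfolding I_def by (intro mult_mono card_length) auto
  have fin: "finite I" by (simp add: I_def)
  note cp = closure_properties[OF fin card ind(1) ind(3), where M = "mem A" and V = "{..<length A}",
      folded sep_eq_separates, unfolded I_def, folded set_close, folded I_def f_def]
  show ?thesis
  proof (cases "total_on I (set R)")
    case True
    then have "filter (unsettled A R) (cliques A) = []"
      by (auto simp: unsettled_iff_tied tied_def total_on_def filter_empty_conv I_def)
    moreover have "asymmetric R" using R(1) by (auto simp: asymmetric_iff_asymm weak_def)
    ultimately show ?thesis using True by (simp add: refine_def)
  next
    case False
    obtain d L' where d: "d \<in> I" "tied I (set R) d" "place_first I (set R) d \<subseteq> L'" "asymm L'"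
      "consecutive (sep A) I L'"
      using exists_consistent_first[OF fin R(1) R(2)[unfolded sep_eq_separates] False L(1,2)
          L(3)[unfolded sep_eq_separates]] unfolding sep_eq_separates by blast
    have "set (f d) \<subseteq> L'"
      using cp(5)[of d L'] d by (simp add: set_individualize I_def f_def)
    then have "asymmetric (f d)" using d(4) unfolding asymmetric_iff_asymm asymm_def by blast
    define S where "S = filter asymmetric (map f (filter (unsettled A R) (cliques A)) @ [R])"
    have "f d \<in> set (filter asymmetric (map f (filter (unsettled A R) (cliques A))))"
      using d \<open>asymmetric (f d)\<close> by (auto simp: unsettled_iff_tied I_def)
    then obtain r rs where r: "filter asymmetric (map f (filter (unsettled A R) (cliques A))) = r # rs"
      by (cases "filter asymmetric (map f (filter (unsettled A R) (cliques A)))") auto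
    then have ref: "refine A R = r" by (simp add: refine_def f_def)
    have "r \<in> set (filter asymmetric (map f (filter (unsettled A R) (cliques A))))"
      unfolding r by simp
    then obtain e where e: "e \<in> I" "tied I (set R) e" "r = f e" "asymm (set r)"
      by (auto simp: unsettled_iff_tied asymmetric_iff_asymm I_def)
    have "weak I (set r)" "consecutive (sep A) I (set r)"
      using cp(2-4)[of e] e by (simp_all add: weak_def f_def)
    moreover have "set R \<subset> set r"
    proof -
      obtain x where x: "x \<in> I" "x \<noteq> e" "(e, x) \<notin> set R" "(x, e) \<notin> set R"
        using e(2) by (auto simp: tied_def)
      then have "(e, x) \<in> set (individualize A R e)"
        using e(1) by (auto simp: set_individualize I_def place_first_def)
      then show ?thesis using cp(1)[of e] e(1,3) ind(2)[of e] x(3) unfolding f_def by blast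
    qed
    ultimately show ?thesis by (simp add: ref)
  qed
qed

lemma distinct_cliques: "distinct (cliques A)"
  unfolding cliques_def by (intro distinct_filter distinct_product) auto

lemma clique_order_valid:
  fixes A
  defines "I \<equiv> set (cliques A)"
  assumes L: "weak I L" "total_on I L" "consecutive (sep A) I L"
  shows "weak I (set (clique_order A)) \<and> total_on I (set (clique_order A)) \<and>
    consecutive (sep A) I (set (clique_order A))"
proof -
  have *: "weak I (set ((refine A ^^ k) [])) \<and> consecutive (sep A) I (set ((refine A ^^ k) [])) \<and>
    (total_on I (set ((refine A ^^ k) [])) \<or> k \<le> card (set ((refine A ^^ k) [])))" for k
  proof (induction k)
    case 0
    show ?case by (auto simp: weak_def asymm_def negtrans_def consecutive_def)
  next
    case (Suc k)
    let ?R = "(refine A ^^ k) []"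
    show ?case
    proof (cases "total_on I (set ?R) \<and> refine A ?R = ?R")
      case True
      then show ?thesis using Suc by simp
    next
      case False
      then have step: "weak I (set (refine A ?R))" "consecutive (sep A) I (set (refine A ?R))"
        "set ?R \<subset> set (refine A ?R)"
        using refine_progress[of A ?R L] Suc L unfolding I_def by blast+
      then have "card (set ?R) < card (set (refine A ?R))" by (intro psubset_card_mono) auto
      moreover have "total_on I (set ?R) \<Longrightarrow> total_on I (set (refine A ?R))"
        using step(3) unfolding total_on_def by blast
      ultimately show ?thesis using Suc step by auto
    qed
  qed
  let ?R = "(refine A ^^ (length (cliques A) * length (cliques A))) []"
  \<comment> \<open>A relation that grew in every round has at least as many pairs as
    \<open>I \<times> I\<close>, so it is all of it and trivially total.\<close>
  have "total_on I (set ?R)" if "length (cliques A) * length (cliques A) \<le> card (set ?R)"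
  proof -
    have "card (I \<times> I) \<le> card (set ?R)"
      using that distinct_card[OF distinct_cliques, of A] by (simp add: I_def card_cartesian_product)
    then have "set ?R = I \<times> I"
      using *[of "length (cliques A) * length (cliques A)"]
      by (intro card_seteq) (auto simp: weak_def I_def)
    then show ?thesis by (auto simp: total_on_def)
  qed
  with * have "total_on I (set ?R)" by blast
  with * show ?thesis by (simp add: clique_order_def foldl_const)
qed

section \<open>Intervals with integer end points\<close>

definition Hi :: "('c \<Rightarrow> 'v \<Rightarrow> bool) \<Rightarrow> 'c set \<Rightarrow> 'c rel \<Rightarrow> 'v \<Rightarrow> 'c set" where
  "Hi M I R v = {c \<in> I. \<exists>d\<in>I. M d v \<and> (c = d \<or> (c, d) \<in> R)}"

definition Lo :: "('c \<Rightarrow> 'v \<Rightarrow> bool) \<Rightarrow> 'c set \<Rightarrow> 'c rel \<Rightarrow> 'v \<Rightarrow> 'c set" where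
  "Lo M I R v = {c \<in> I. \<forall>d\<in>I. M d v \<longrightarrow> (c, d) \<in> R}"

text \<open>Consecutiveness of \<open>u\<close> extends the comparison \<open>(c, e)\<close> from
  \<open>c\<close> to every clique of \<open>u\<close>; consecutiveness of \<open>v\<close> then
  extends it from \<open>e\<close> to every clique of \<open>v\<close>. Both moves need that no
  clique contains both vertices.\<close>

lemma Hi_subset_Lo:
  assumes R: "weak I R" "consecutive (separates M V) I R"
    and uv: "u \<in> V" "v \<in> V" "c \<in> I" "e \<in> I" "M c u" "M e v" "(c, e) \<in> R"
    and dis: "\<And>d. d \<in> I \<Longrightarrow> M d u \<Longrightarrow> \<not> M d v"
  shows "Hi M I R u \<subseteq> Lo M I R v"
proof -
  have all: "(d, f) \<in> R" if "d \<in> I" "f \<in> I" "M d u" "M f v" for d f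
  proof -
    have "separates M V e c d" "separates M V d e f"
      using uv that dis by (auto simp: separates_def)
    then show ?thesis using R(2) uv that unfolding consecutive_def by blast
  qed
  show ?thesis
    unfolding Hi_def Lo_def using all weak_trans[OF R(1)] by blast
qed

text \<open>A shared clique lies in both \<open>Hi\<close> sets and, by irreflexivity, in neither
  \<open>Lo\<close> set, which makes both inequalities strict. Without one, all cliques of one
  vertex precede those of the other, and an inequality fails.\<close>

lemma share_iff_overlap:
  assumes "finite I" and R: "weak I R" "total_on I R" "consecutive (separates M V) I R"
    and uv: "u \<in> V" "v \<in> V" "\<exists>c\<in>I. M c u" "\<exists>c\<in>I. M c v"
  shows "(\<exists>c\<in>I. M c u \<and> M c v) \<longleftrightarrow>
    Suc (card (Lo M I R u)) \<le> card (Hi M I R v) \<and> Suc (card (Lo M I R v)) \<le> card (Hi M I R u)"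
proof -
  have fin: "finite (Hi M I R w)" "finite (Lo M I R w)" for w
    using assms(1) by (auto simp: Hi_def Lo_def)
  show ?thesis
  proof
    assume "\<exists>c\<in>I. M c u \<and> M c v"
    then obtain c where c: "c \<in> I" "M c u" "M c v" by blast
    have "insert c (Lo M I R u) \<subseteq> Hi M I R v" "insert c (Lo M I R v) \<subseteq> Hi M I R u"
      using c by (auto simp: Hi_def Lo_def)
    moreover have "c \<notin> Lo M I R u" "c \<notin> Lo M I R v"
      using c R(1) by (auto simp: Lo_def weak_def asymm_def)
    ultimately show "Suc (card (Lo M I R u)) \<le> card (Hi M I R v) \<and> Suc (card (Lo M I R v)) \<le> card (Hi M I R u)"
      using fin card_mono by (metis card_insert_disjoint)
  next
    assume *: "Suc (card (Lo M I R u)) \<le> card (Hi M I R v) \<and> Suc (card (Lo M I R v)) \<le> card (Hi M I R u)"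
    show "\<exists>c\<in>I. M c u \<and> M c v"
    proof (rule ccontr)
      assume no: "\<not> (\<exists>c\<in>I. M c u \<and> M c v)"
      obtain c e where ce: "c \<in> I" "e \<in> I" "M c u" "M e v" using uv by blast
      moreover have "c \<noteq> e" using no ce by blast
      ultimately have "(c, e) \<in> R \<or> (e, c) \<in> R" using R(2) unfolding total_on_def by blast
      then have "Hi M I R u \<subseteq> Lo M I R v \<or> Hi M I R v \<subseteq> Lo M I R u"
        using Hi_subset_Lo[OF R(1,3) uv(1,2) ce] Hi_subset_Lo[OF R(1,3) uv(2,1) ce(2,1,4,3)] no by blast
      then have "card (Hi M I R u) \<le> card (Lo M I R v) \<or> card (Hi M I R v) \<le> card (Lo M I R u)"
        using fin card_mono by blast
      with * show False by linarith
    qed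
  qed
qed

lemma hi_eq_card: "hi A R v = card (Hi (mem A) (set (cliques A)) (set R) v)"
  unfolding hi_def Hi_def using distinct_length_filter[OF distinct_cliques]
  by (simp add: Collect_conj_eq Int_commute)

lemma lo_eq_card: "lo A R v = Suc (card (Lo (mem A) (set (cliques A)) (set R) v))"
  unfolding lo_def Lo_def using distinct_length_filter[OF distinct_cliques]
  by (simp add: Collect_conj_eq Int_commute)

section \<open>Cliques of an interval graph\<close>

text \<open>Helly's theorem on the line. It is applied to the set of intervals, which must have at
  least two elements; since vertices may share an interval, a single interval is a separate
  case.\<close>

lemma intervals_common_point:
  fixes J :: "'a \<Rightarrow> real set"
  assumes "finite K" "K \<noteq> {}" "\<And>v. v \<in> K \<Longrightarrow> is_interval (J v)"
    and meet: "\<And>u v. u \<in> K \<Longrightarrow> v \<in> K \<Longrightarrow> J u \<inter> J v \<noteq> {}"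
  shows "\<exists>p. \<forall>v\<in>K. p \<in> J v"
proof (cases "card (J ` K) \<ge> 2")
  case True
  have "\<Inter>(J ` K) \<noteq> {}"
  proof (rule Helly)
    show "DIM(real) + 1 \<le> card (J ` K)" using True by simp
    show "\<forall>s\<in>J ` K. convex s" using assms(3) by (auto simp: is_interval_convex)
    fix t assume t: "t \<subseteq> J ` K" "card t = DIM(real) + 1"
    then obtain a b where "t = {a, b}" using card_2_iff[of t] by auto
    with t(1) show "\<Inter>t \<noteq> {}" using meet by auto
  qed
  then show ?thesis by blast
next
  case False
  obtain v where v: "v \<in> K" using assms(2) by blast
  have "card (J ` K) \<le> 1" using False by simp
  then have "J u = J v" if "u \<in> K" for u
    using that v assms(1) by (metis One_nat_def card_le_Suc0_iff_eq finite_imageI image_eqI)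
  moreover have "J v \<noteq> {}" using meet[OF v v] by simp
  ultimately show ?thesis by blast
qed

lemma finite_chain_has_least:
  assumes "finite C" "C \<noteq> {}" "\<And>a b. a \<in> C \<Longrightarrow> b \<in> C \<Longrightarrow> U a \<subseteq> U b \<or> U b \<subseteq> U a"
  shows "\<exists>a\<in>C. \<forall>c\<in>C. U a \<subseteq> U c"
  using assms
proof (induction C rule: finite_ne_induct)
  case (insert x F)
  then obtain a where a: "a \<in> F" "\<forall>c\<in>F. U a \<subseteq> U c" by blast
  with insert.prems[of a x] show ?case by (cases "U a \<subseteq> U x") auto
qed auto

lemma intervals_chain:
  fixes S T :: "real set"
  assumes "is_interval S" "is_interval T" "p \<in> S" "p \<in> T"
  shows "S \<inter> {p..} \<subseteq> T \<inter> {p..} \<or> T \<inter> {p..} \<subseteq> S \<inter> {p..}"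
    and "S \<inter> {..p} \<subseteq> T \<inter> {..p} \<or> T \<inter> {..p} \<subseteq> S \<inter> {..p}"
proof -
  have between: "z \<in> X" if "is_interval X" "x \<in> X" "y \<in> X" "x \<le> z" "z \<le> y" for X :: "real set" and x y z
    using that unfolding is_interval_1 by blast
  show "S \<inter> {p..} \<subseteq> T \<inter> {p..} \<or> T \<inter> {p..} \<subseteq> S \<inter> {p..}"
  proof (rule ccontr)
    assume "\<not> ?thesis"
    then obtain x y where "x \<in> S" "x \<ge> p" "x \<notin> T" "y \<in> T" "y \<ge> p" "y \<notin> S" by auto
    then show False using between[of S p x y] between[of T p y x] assms by (cases "x \<le> y") auto
  qed
  show "S \<inter> {..p} \<subseteq> T \<inter> {..p} \<or> T \<inter> {..p} \<subseteq> S \<inter> {..p}"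
  proof (rule ccontr)
    assume "\<not> ?thesis"
    then obtain x y where "x \<in> S" "x \<le> p" "x \<notin> T" "y \<in> T" "y \<le> p" "y \<notin> S" by auto
    then show False using between[of S x p y] between[of T y p x] assms by (cases "x \<le> y") auto
  qed
qed

text \<open>Take a point \<open>p\<close> of \<open>u\<close> and \<open>v\<close> that lies in as
  many intervals as possible. Among the intervals through \<open>p\<close>, let \<open>a\<close>
  reach least far to the right and \<open>b\<close> least far to the left. Every interval that meets
  both contains \<open>p\<close>, so \<open>a\<close> and \<open>b\<close> generate the clique of
  \<open>p\<close>. With \<open>u = v\<close>, each vertex is in some clique.\<close>

lemma edge_in_clique:
  fixes J :: "nat \<Rightarrow> real set"
  assumes adj: "\<And>u v. u < length A \<Longrightarrow> v < length A \<Longrightarrow> cadj A u v \<longleftrightarrow> J u \<inter> J v \<noteq> {}"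
    and int: "\<And>v. v < length A \<Longrightarrow> is_interval (J v)"
    and uv: "u < length A" "v < length A" "cadj A u v"
  shows "\<exists>c\<in>set (cliques A). mem A c u \<and> mem A c v"
proof -
  let ?n = "length A"
  define C where "C = (\<lambda>p. {w. w < ?n \<and> p \<in> J w})"
  have finC: "finite (C p)" for p by (simp add: C_def)
  obtain p0 where "p0 \<in> J u" "p0 \<in> J v" using adj uv by blast
  then have "{u, v} \<subseteq> C p0" using uv by (auto simp: C_def)
  moreover have "card (C q) \<le> ?n" for q
    using card_mono[of "{..<?n}" "C q"] by (auto simp: C_def)
  ultimately obtain p where p: "{u, v} \<subseteq> C p" "\<And>q. {u, v} \<subseteq> C q \<Longrightarrow> card (C q) \<le> card (C p)"
    using ex_has_greatest_nat[of "\<lambda>q. {u, v} \<subseteq> C q" p0 "\<lambda>q. card (C q)" "Suc ?n"] less_Suc_eq_le by blast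
  have ne: "C p \<noteq> {}" using p(1) by auto
  have inC: "is_interval (J a)" "p \<in> J a" "a < ?n" if "a \<in> C p" for a
    using that int by (auto simp: C_def)
  obtain a where a: "a \<in> C p" "\<And>c. c \<in> C p \<Longrightarrow> J a \<inter> {p..} \<subseteq> J c \<inter> {p..}"
    using finite_chain_has_least[OF finC ne, of "\<lambda>a. J a \<inter> {p..}"] intervals_chain(1) inC by metis
  obtain b where b: "b \<in> C p" "\<And>c. c \<in> C p \<Longrightarrow> J b \<inter> {..p} \<subseteq> J c \<inter> {..p}"
    using finite_chain_has_least[OF finC ne, of "\<lambda>a. J a \<inter> {..p}"] intervals_chain(2) inC by metis
  have maximal: "w \<in> C p" if "w < ?n" "x \<in> J w" "\<And>c. c \<in> C p \<Longrightarrow> x \<in> J c" for w x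
  proof (rule ccontr)
    assume "w \<notin> C p"
    moreover have "insert w (C p) \<subseteq> C x" using that by (auto simp: C_def)
    ultimately have "card (C p) < card (C x)"
      using card_mono[OF finC[of x], of "insert w (C p)"] finC[of p] by simp
    moreover have "{u, v} \<subseteq> C x" using \<open>insert w (C p) \<subseteq> C x\<close> p(1) by blast
    ultimately show False using p(2)[of x] by simp
  qed
  have memC: "mem A (a, b) w \<longleftrightarrow> w \<in> C p" if w: "w < ?n" for w
  proof
    assume "w \<in> C p"
    then show "mem A (a, b) w" using adj[of a w] adj[of b w] inC[OF a(1)] inC[OF b(1)] w
      by (auto simp: mem_def C_def)
  next
    assume "mem A (a, b) w"
    then obtain x y where xy: "x \<in> J a" "x \<in> J w" "y \<in> J b" "y \<in> J w"
      using adj[of a w] adj[of b w] inC[OF a(1)] inC[OF b(1)] w by (auto simp: mem_def)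
    \<comment> \<open>If \<open>x\<close> is to the right of \<open>p\<close>, it lies in all
      intervals through \<open>p\<close>, as \<open>a\<close> reaches least far; so the maximal
      choice of \<open>p\<close> applies. Likewise for \<open>y\<close> on the left. Otherwise
      \<open>w\<close> has points on both sides of \<open>p\<close>.\<close>
    consider "x \<ge> p" | "y \<le> p" | "x \<le> p" "p \<le> y" by linarith
    then show "w \<in> C p"
    proof cases
      case 1
      then show ?thesis using maximal[OF w xy(2)] a(2) xy(1) by auto
    next
      case 2
      then show ?thesis using maximal[OF w xy(4)] b(2) xy(3) by auto
    next
      case 3
      then show ?thesis using int[OF w] xy w unfolding is_interval_1 C_def by blast
    qed
  qed
  have "(a, b) \<in> set (cliques A)"
    using memC adj inC[OF a(1)] inC[OF b(1)] by (auto simp: cliques_def C_def)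
  then show ?thesis using memC p(1) uv by auto
qed

text \<open>The members meet pairwise and so have a common point. Any interval through that point
  meets both generating vertices and hence belongs to a member.\<close>

lemma cliques_points:
  fixes J :: "nat \<Rightarrow> real set"
  assumes adj: "\<And>u v. u < length A \<Longrightarrow> v < length A \<Longrightarrow> cadj A u v \<longleftrightarrow> J u \<inter> J v \<noteq> {}"
    and int: "\<And>v. v < length A \<Longrightarrow> is_interval (J v)"
    and c: "c \<in> set (cliques A)"
  shows "\<exists>p. \<forall>v<length A. mem A c v \<longleftrightarrow> p \<in> J v"
proof -
  let ?K = "{v. v < length A \<and> mem A c v}"
  have c': "fst c < length A" "snd c < length A" "cadj A (fst c) (snd c)"
    using c by (auto simp: cliques_def)
  have K: "fst c \<in> ?K" "snd c \<in> ?K"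
    using c' adj by (auto simp: mem_def cadj_def Int_commute)
  have "\<exists>p. \<forall>v\<in>?K. p \<in> J v"
  proof (rule intervals_common_point)
    show "J u \<inter> J v \<noteq> {}" if "u \<in> ?K" "v \<in> ?K" for u v
      using c that adj[of u v] by (auto simp: cliques_def)
  qed (use K int in auto)
  then obtain p where p: "\<And>v. v \<in> ?K \<Longrightarrow> p \<in> J v" by blast
  have "mem A c v" if "v < length A" "p \<in> J v" for v
    using that p[OF K(1)] p[OF K(2)] adj[of "fst c" v] adj[of "snd c" v] c' by (auto simp: mem_def)
  with p show ?thesis by blast
qed

lemma valid_order_exists:
  fixes J :: "nat \<Rightarrow> real set"
  assumes adj: "\<And>u v. u < length A \<Longrightarrow> v < length A \<Longrightarrow> cadj A u v \<longleftrightarrow> J u \<inter> J v \<noteq> {}"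
    and int: "\<And>v. v < length A \<Longrightarrow> is_interval (J v)"
  shows "\<exists>L. weak (set (cliques A)) L \<and> total_on (set (cliques A)) L \<and> consecutive (sep A) (set (cliques A)) L"
proof -
  let ?I = "set (cliques A)"
  have "\<forall>c\<in>?I. \<exists>p. \<forall>v<length A. mem A c v \<longleftrightarrow> p \<in> J v"
    using cliques_points[OF adj int] by blast
  then obtain pt where pt: "\<And>c v. c \<in> ?I \<Longrightarrow> v < length A \<Longrightarrow> mem A c v \<longleftrightarrow> pt c \<in> J v"
    by metis
  \<comment> \<open>Different pairs can generate the same clique, so points may coincide; the
    injective \<open>prod_encode\<close> breaks such ties.\<close>
  define L where "L = {(c, d) \<in> ?I \<times> ?I. pt c < pt d \<or> pt c = pt d \<and> prod_encode c < prod_encode d}"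
  have "weak ?I L"
    by (auto simp: weak_def asymm_def negtrans_def L_def)
  moreover have "total_on ?I L"
    unfolding total_on_def
  proof (intro ballI impI)
    fix c d assume cd: "c \<in> ?I" "d \<in> ?I" "c \<noteq> d"
    then have "prod_encode c \<noteq> prod_encode d" by (simp only: prod_encode_eq not_False_eq_True)
    then show "(c, d) \<in> L \<or> (d, c) \<in> L"
      using cd(1,2) unfolding L_def mem_Collect_eq case_prod_conv mem_Sigma_iff by linarith
  qed
  moreover have "consecutive (sep A) ?I L"
    unfolding consecutive_def
  proof (intro ballI impI)
    fix e c d assume I: "e \<in> ?I" "c \<in> ?I" "d \<in> ?I" and "sep A e c d"
    then obtain v where v: "v < length A" "mem A c v" "mem A d v" "\<not> mem A e v" by (auto simp: sep_def)
    then have "pt c \<in> J v" "pt d \<in> J v" "pt e \<notin> J v" using pt I by auto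
    \<comment> \<open>The interval of \<open>v\<close> contains \<open>pt c\<close> and
      \<open>pt d\<close> but not \<open>pt e\<close>, so \<open>pt e\<close> is strictly on one
      side of both.\<close>
    then have "pt e < pt c \<longleftrightarrow> pt e < pt d" "pt c < pt e \<longleftrightarrow> pt d < pt e" "pt e \<noteq> pt c" "pt e \<noteq> pt d"
      using int[OF v(1)] unfolding is_interval_1 by (metis less_imp_le linorder_cases)+
    then show "((e, c) \<in> L \<longrightarrow> (e, d) \<in> L) \<and> ((c, e) \<in> L \<longrightarrow> (d, e) \<in> L)"
      using I by (auto simp: L_def)
  qed
  ultimately show ?thesis by blast
qed

text \<open>The integer intervals from \<open>lo\<close> to \<open>hi\<close> represent the graph,
  so computed intervals can take the place of the unknown real ones.\<close>

lemma overlap_iff_adjacent: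
  fixes J :: "nat \<Rightarrow> real set"
  assumes adj: "\<And>u v. u < length A \<Longrightarrow> v < length A \<Longrightarrow> cadj A u v \<longleftrightarrow> J u \<inter> J v \<noteq> {}"
    and int: "\<And>v. v < length A \<Longrightarrow> is_interval (J v)"
    and uv: "u < length A" "v < length A"
  defines "R \<equiv> clique_order A"
  shows "cadj A u v \<longleftrightarrow> lo A R u \<le> hi A R v \<and> lo A R v \<le> hi A R u"
proof -
  let ?I = "set (cliques A)"
  have R: "weak ?I (set R)" "total_on ?I (set R)" "consecutive (separates (mem A) {..<length A}) ?I (set R)"
    using clique_order_valid valid_order_exists[OF adj int] by (auto simp: R_def sep_eq_separates)
  have in_some: "\<exists>c\<in>?I. mem A c w" if "w < length A" for w
    using edge_in_clique[OF adj int that that] by (auto simp: cadj_def)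
  have "cadj A u v \<longleftrightarrow> (\<exists>c\<in>?I. mem A c u \<and> mem A c v)"
    using edge_in_clique[OF adj int uv] uv by (auto simp: cliques_def)
  then show ?thesis
    using share_iff_overlap[OF _ R, of u v] in_some uv by (simp add: hi_eq_card lo_eq_card)
qed

section \<open>Maximum $k$-colorable subgraphs\<close>

definition cnt :: "nat list \<Rightarrow> nat \<Rightarrow> nat" where
  "cnt es p = length (filter (\<lambda>e. p \<le> e) es)"

text \<open>The scan never looks ahead, so it commutes with truncation. This is what lets one list
  simulate every number of tracks.\<close>

lemma take_bub: "take k (bub l h es) = bub l h (take k es)"
  by (induction es arbitrary: h k) (auto simp: take_Cons split: nat.split)

lemma length_bub [simp]: "length (bub l h es) = length es"
  by (induction es arbitrary: h) auto

text \<open>The carried end point is exchanged for each larger free one in turn, so what finally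
  drops out is the largest of all below \<open>l\<close>. As a multiset, the list thus changes as
  under best fit.\<close>

lemma bub_mset_small:
  "h < l \<Longrightarrow> \<exists>t. (t = h \<or> t \<in> set es) \<and> t < l \<and> h \<le> t \<and> (\<forall>e\<in>set es. e < l \<longrightarrow> e \<le> t) \<and>
    add_mset t (mset (bub l h es)) = add_mset h (mset es)"
proof (induction es arbitrary: h)
  case (Cons e es)
  show ?case
  proof (cases "e < l \<and> h < e")
    case True
    then obtain t where t: "t = e \<or> t \<in> set es" "t < l" "e \<le> t" "\<forall>e\<in>set es. e < l \<longrightarrow> e \<le> t"
      "add_mset t (mset (bub l e es)) = add_mset e (mset es)"
      using Cons.IH[of e] by blast
    have "add_mset t (mset (bub l h (e # es))) = add_mset h (add_mset t (mset (bub l e es)))"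
      using True by (simp add: add_mset_commute)
    also have "\<dots> = add_mset h (mset (e # es))" by (simp add: t(5))
    finally show ?thesis using t True by (intro exI[of _ t]) auto
  next
    case False
    obtain t where t: "t = h \<or> t \<in> set es" "t < l" "h \<le> t" "\<forall>e\<in>set es. e < l \<longrightarrow> e \<le> t"
      "add_mset t (mset (bub l h es)) = add_mset h (mset es)"
      using Cons.IH[of h] Cons.prems by blast
    have "add_mset t (mset (bub l h (e # es))) = add_mset e (add_mset t (mset (bub l h es)))"
      using False Cons.prems by (auto simp: add_mset_commute)
    also have "\<dots> = add_mset h (mset (e # es))" by (simp add: t(5) add_mset_commute)
    finally show ?thesis using t False by (intro exI[of _ t]) auto
  qed
qed simp

lemma bub_mset:
  assumes "l \<le> h"
  shows "(\<forall>e\<in>set es. l \<le> e) \<and> bub l h es = es \<or>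
    (\<exists>t\<in>set es. t < l \<and> (\<forall>e\<in>set es. e < l \<longrightarrow> e \<le> t) \<and>
      add_mset t (mset (bub l h es)) = add_mset h (mset es))"
proof (induction es)
  case (Cons e es)
  show ?case
  proof (cases "e < l")
    case True
    obtain t where t: "t = e \<or> t \<in> set es" "t < l" "e \<le> t" "\<forall>e\<in>set es. e < l \<longrightarrow> e \<le> t"
      "add_mset t (mset (bub l e es)) = add_mset e (mset es)"
      using bub_mset_small[OF True, of es] by blast
    have "add_mset t (mset (bub l h (e # es))) = add_mset h (add_mset t (mset (bub l e es)))"
      using True assms by (simp add: add_mset_commute)
    also have "\<dots> = add_mset h (mset (e # es))" by (simp add: t(5))
    finally show ?thesis using t by (intro disjI2 bexI[of _ t]) auto
  next
    case False
    from Cons show ?thesis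
    proof
      assume "\<exists>t\<in>set es. t < l \<and> (\<forall>e\<in>set es. e < l \<longrightarrow> e \<le> t) \<and>
        add_mset t (mset (bub l h es)) = add_mset h (mset es)"
      then obtain t where t: "t \<in> set es" "t < l" "\<forall>e\<in>set es. e < l \<longrightarrow> e \<le> t"
        "add_mset t (mset (bub l h es)) = add_mset h (mset es)" by blast
      have "add_mset t (mset (bub l h (e # es))) = add_mset e (add_mset t (mset (bub l h es)))"
        using False by (simp add: add_mset_commute)
      also have "\<dots> = add_mset h (mset (e # es))" by (simp add: t(4) add_mset_commute)
      finally show ?thesis using t False by (intro disjI2 bexI[of _ t]) auto
    qed (use False in auto)
  qed
qed simp

lemma cnt_le_length: "cnt es p \<le> length es"
  by (simp add: cnt_def)

lemma cnt_mset: "cnt es p = size (filter_mset (\<lambda>e. p \<le> e) (mset es))"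
  unfolding cnt_def by (metis mset_filter size_mset)

lemma cnt_exchange:
  assumes "add_mset t (mset es') = add_mset h (mset es)"
  shows "cnt es' p + (if p \<le> t then 1 else 0) = cnt es p + (if p \<le> h then 1 else 0)"
proof -
  have "size (filter_mset (\<lambda>e. p \<le> e) (add_mset t (mset es'))) =
    size (filter_mset (\<lambda>e. p \<le> e) (add_mset h (mset es)))" by (simp only: assms)
  then show ?thesis by (auto simp: cnt_mset split: if_splits)
qed

text \<open>As \<open>t\<close> is the best fit, no end point lies strictly between \<open>t\<close>
  and \<open>l\<close>. Both acceptance proofs below rest on this.\<close>

lemma cnt_gap:
  assumes "\<forall>e\<in>set es. e < l \<longrightarrow> e \<le> t" "t < p" "p \<le> l"
  shows "cnt es p = cnt es l"
  unfolding cnt_def using assms by (intro arg_cong[where f = length] filter_cong) (auto intro: leI)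

section \<open>Invariants of the greedy process\<close>

definition depth :: "('v \<Rightarrow> nat) \<Rightarrow> ('v \<Rightarrow> nat) \<Rightarrow> 'v set \<Rightarrow> nat \<Rightarrow> nat" where
  "depth l h S p = card {v \<in> S. l v \<le> p \<and> p \<le> h v}"

lemma depth_insert:
  assumes "finite S" "x \<notin> S"
  shows "depth l h (insert x S) p = depth l h S p + (if l x \<le> p \<and> p \<le> h x then 1 else 0)"
proof -
  have "{v \<in> insert x S. l v \<le> p \<and> p \<le> h v} =
    (if l x \<le> p \<and> p \<le> h x then insert x {v \<in> S. l v \<le> p \<and> p \<le> h v} else {v \<in> S. l v \<le> p \<and> p \<le> h v})"
    by auto
  then show ?thesis using assms by (auto simp: depth_def)
qed

lemma depth_mono: "finite T \<Longrightarrow> S \<subseteq> T \<Longrightarrow> depth l h S p \<le> depth l h T p"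
  unfolding depth_def by (intro card_mono) auto

lemma depth_pos: "0 < depth l h S p \<Longrightarrow> \<exists>v\<in>S. l v \<le> p \<and> p \<le> h v"
  unfolding depth_def by (metis (mono_tags, lifting) card_gt_0_iff ex_in_conv mem_Collect_eq)

text \<open>Invariant of the best-fit assignment of intervals to tracks: \<open>P\<close> is the set of intervals seen,
  \<open>S\<close> the set of those accepted, and \<open>es\<close> holds the last right end point on each track.\<close>

definition tracks_inv :: "('v \<Rightarrow> nat) \<Rightarrow> ('v \<Rightarrow> nat) \<Rightarrow> 'v set \<Rightarrow> 'v set \<Rightarrow> nat list \<Rightarrow> bool" where
  "tracks_inv l h P S es \<longleftrightarrow> finite P \<and> S \<subseteq> P \<and>
     (\<forall>p. depth l h S p \<le> cnt es p) \<and>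
     (\<forall>q\<ge>1. \<exists>p\<ge>q. cnt es q \<le> depth l h S p) \<and>
     (\<forall>v\<in>P - S. \<exists>p. l v \<le> p \<and> p \<le> h v \<and> length es \<le> depth l h S p)"

text \<open>The counterpart of \<open>cnt\<close> for a competing coloring: each color of
  \<open>C\<close> is a track, counted if one of its intervals ends at \<open>q\<close> or
  later.\<close>

definition color_ends :: "('v \<Rightarrow> nat) \<Rightarrow> ('v \<Rightarrow> 'c) \<Rightarrow> 'c set \<Rightarrow> 'v set \<Rightarrow> nat \<Rightarrow> 'c set" where
  "color_ends h \<phi> C P q = {c \<in> C. \<exists>v\<in>P. \<phi> v = c \<and> q \<le> h v}"

text \<open>The greedy algorithm stays ahead of every other choice of \<open>length es\<close> independent sets: what
  the other choice gains in the free tracks it has already lost in the number of intervals.\<close>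

definition ahead :: "('v \<Rightarrow> nat) \<Rightarrow> ('v \<Rightarrow> 'c) \<Rightarrow> 'c set \<Rightarrow> 'v set \<Rightarrow> 'v set \<Rightarrow> nat list \<Rightarrow> bool" where
  "ahead h \<phi> C P S es \<longleftrightarrow> (\<forall>q\<ge>1. cnt es q + card {v \<in> P. \<phi> v \<in> C} \<le> card S + card (color_ends h \<phi> C P q))"

lemma tracks_inv_cnt_0:
  assumes "tracks_inv l h P S es" "\<And>v. v \<in> P \<Longrightarrow> h v < q" "1 \<le> q"
  shows "cnt es q = 0"
proof (rule ccontr)
  assume "cnt es q \<noteq> 0"
  moreover obtain p where "p \<ge> q" "cnt es q \<le> depth l h S p"
    using assms unfolding tracks_inv_def by blast
  ultimately obtain v where "v \<in> S" "p \<le> h v" using depth_pos[of l h S p] by auto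
  then show False using assms(1) assms(2)[of v] \<open>p \<ge> q\<close> by (auto simp: tracks_inv_def)
qed

context
  fixes l h :: "'v \<Rightarrow> nat" and P S :: "'v set" and es :: "nat list" and x :: 'v
  assumes inv: "tracks_inv l h P S es"
    and x: "x \<notin> P" "1 \<le> l x" "l x \<le> h x" "\<And>v. v \<in> P \<Longrightarrow> h v \<le> h x"
begin

lemma finite_tracks: "finite P" "finite S" "x \<notin> S"
  using inv x(1) finite_subset by (auto simp: tracks_inv_def)

text \<open>All tracks are busy at \<open>l x\<close>, so the invariant yields a point of full depth
  at or after \<open>l x\<close>. It does not lie beyond \<open>h x\<close>, because an accepted
  interval reaches it and \<open>x\<close> ends last.\<close>

lemma tracks_inv_reject:
  assumes full: "\<forall>e\<in>set es. l x \<le> e"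
  shows "tracks_inv l h (insert x P) S es"
proof -
  have cnt: "cnt es (l x) = length es" using full by (simp add: cnt_def)
  obtain p where p: "p \<ge> l x" "length es \<le> depth l h S p"
    using inv x(2) unfolding tracks_inv_def cnt[symmetric] by blast
  have "\<exists>p. l x \<le> p \<and> p \<le> h x \<and> length es \<le> depth l h S p"
  proof (cases "length es = 0")
    case True
    then show ?thesis using x(3) by (intro exI[of _ "l x"]) simp
  next
    case False
    then have "0 < depth l h S p" using p(2) by linarith
    then obtain v where "v \<in> S" "p \<le> h v" using depth_pos by blast
    then show ?thesis using p x(4)[of v] inv by (intro exI[of _ p]) (auto simp: tracks_inv_def)
  qed
  then show ?thesis using inv unfolding tracks_inv_def by auto
qed

text \<open>The new interval raises \<open>cnt\<close> after \<open>t\<close> up to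
  \<open>h x\<close>, but the depth only from \<open>l x\<close> on. Between \<open>t\<close> and
  \<open>l x\<close> there is no other end point, so there the witness for \<open>l x\<close> serves
  again.\<close>

lemma tracks_inv_accept:
  assumes t: "t < l x" "\<forall>e\<in>set es. e < l x \<longrightarrow> e \<le> t"
    and es': "add_mset t (mset es') = add_mset (h x) (mset es)"
  shows "tracks_inv l h (insert x P) (insert x S) es'"
proof -
  note dep = depth_insert[OF finite_tracks(2,3), of l h]
  have len: "length es' = length es"
    using arg_cong[OF es', of size] by simp
  have upper: "depth l h (insert x S) p \<le> cnt es' p" for p
    using cnt_exchange[OF es', of p] inv t(1) x(3) unfolding dep tracks_inv_def
    by (cases "l x \<le> p \<and> p \<le> h x"; cases "p \<le> t"; auto split: if_splits intro: le_SucI)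
  have above: "\<exists>p\<ge>q. cnt es' q \<le> depth l h (insert x S) p" if q: "l x \<le> q" for q
  proof (cases "q \<le> h x")
    case False
    obtain p where p: "p \<ge> q" "cnt es q \<le> depth l h S p"
      using inv x(2) q unfolding tracks_inv_def by (meson le_trans)
    then show ?thesis using cnt_exchange[OF es', of q] False q t(1)
      by (intro exI[of _ p]) (auto simp: dep split: if_splits)
  next
    case True
    have c: "cnt es' q = cnt es q + 1" using cnt_exchange[OF es', of q] True q t(1) by auto
    show ?thesis
    proof (cases "cnt es q = 0")
      case True
      then show ?thesis using c q \<open>q \<le> h x\<close> by (intro exI[of _ q]) (auto simp: dep)
    next
      case False
      obtain p where p: "p \<ge> q" "cnt es q \<le> depth l h S p"
        using inv x(2) q unfolding tracks_inv_def by (meson le_trans)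
      then obtain v where "v \<in> S" "p \<le> h v" using depth_pos[of l h S p] False by auto
      then have "p \<le> h x" using x(4)[of v] inv by (auto simp: tracks_inv_def)
      then show ?thesis using p c q by (intro exI[of _ p]) (auto simp: dep)
    qed
  qed
  have lower: "\<exists>p\<ge>q. cnt es' q \<le> depth l h (insert x S) p" if q: "1 \<le> q" for q
  proof -
    consider "l x \<le> q" | "q < l x" "q \<le> t" | "q < l x" "t < q" by linarith
    then show ?thesis
    proof cases
      case 1
      then show ?thesis by (rule above)
    next
      case 2
      obtain p where p: "p \<ge> q" "cnt es q \<le> depth l h S p"
        using inv q unfolding tracks_inv_def by blast
      then show ?thesis using cnt_exchange[OF es', of q] 2 x(3)
        by (intro exI[of _ p]) (auto simp: dep)
    next
      case 3
      have "cnt es' q = cnt es' (l x)"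
        using cnt_gap[OF t(2) 3(2)] cnt_exchange[OF es', of q] cnt_exchange[OF es', of "l x"] 3 t(1) x(3)
        by auto
      then show ?thesis using above[of "l x"] 3(1) by (metis order_refl less_imp_le le_trans)
    qed
  qed
  have "\<exists>p. l v \<le> p \<and> p \<le> h v \<and> length es' \<le> depth l h (insert x S) p" if v: "v \<in> insert x P - insert x S" for v
  proof -
    have "v \<in> P - S" using v by auto
    then obtain p where "l v \<le> p" "p \<le> h v" "length es \<le> depth l h S p"
      using inv unfolding tracks_inv_def by blast
    then show ?thesis using len by (intro exI[of _ p]) (auto simp: dep)
  qed
  then show ?thesis using upper lower inv unfolding tracks_inv_def by auto
qed

context
  fixes \<phi> :: "'v \<Rightarrow> 'c" and C :: "'c set"
  assumes C: "finite C" "card C \<le> length es" and ah: "ahead h \<phi> C P S es"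
    and proper: "\<And>v. v \<in> P \<Longrightarrow> l x \<le> h v \<Longrightarrow> \<phi> v \<noteq> \<phi> x"
begin

lemma color_ends_insert: "color_ends h \<phi> C (insert x P) q =
  color_ends h \<phi> C P q \<union> (if q \<le> h x \<and> \<phi> x \<in> C then {\<phi> x} else {})"
  by (auto simp: color_ends_def)

lemma finite_color_ends: "finite (color_ends h \<phi> C P q)"
  using C by (simp add: color_ends_def)

lemma new_color_free: "l x \<le> q \<Longrightarrow> \<phi> x \<notin> color_ends h \<phi> C P q"
  using proper by (force simp: color_ends_def)

text \<open>Some interval with the color of \<open>x\<close> ends at \<open>q\<close> or later, but
  by properness none ends at \<open>l x\<close> or later. So this color accounts for the
  difference.\<close>

lemma card_color_ends_less:
  assumes "q \<le> l x" "\<phi> x \<in> color_ends h \<phi> C P q"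
  shows "card (color_ends h \<phi> C P (l x)) + 1 \<le> card (color_ends h \<phi> C P q)"
proof -
  have "insert (\<phi> x) (color_ends h \<phi> C P (l x)) \<subseteq> color_ends h \<phi> C P q"
    using assms by (auto simp: color_ends_def)
  then have "card (insert (\<phi> x) (color_ends h \<phi> C P (l x))) \<le> card (color_ends h \<phi> C P q)"
    using finite_color_ends by (intro card_mono)
  then show ?thesis using new_color_free[of "l x"] finite_color_ends by simp
qed

lemma card_color_ends_insert:
  "card (color_ends h \<phi> C (insert x P) q) = card (color_ends h \<phi> C P q) +
    (if q \<le> h x \<and> \<phi> x \<in> C \<and> \<phi> x \<notin> color_ends h \<phi> C P q then 1 else 0)"
  using finite_color_ends by (auto simp: color_ends_insert insert_absorb)

lemma card_colored_insert:
  "card {v \<in> insert x P. \<phi> v \<in> C} = card {v \<in> P. \<phi> v \<in> C} + (if \<phi> x \<in> C then 1 else 0)"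
proof -
  have "{v \<in> insert x P. \<phi> v \<in> C} = (if \<phi> x \<in> C then insert x {v \<in> P. \<phi> v \<in> C} else {v \<in> P. \<phi> v \<in> C})"
    by auto
  then show ?thesis using x(1) finite_tracks by auto
qed

text \<open>If the competitor takes \<open>x\<close>, its color is free at \<open>l x\<close> while
  all \<open>length es\<close> tracks are busy there. As \<open>card C\<close> is at most
  \<open>length es\<close>, the greedy choice is ahead by one interval, which pays for
  \<open>x\<close>.\<close>

lemma ahead_reject:
  assumes full: "\<forall>e\<in>set es. l x \<le> e"
  shows "ahead h \<phi> C (insert x P) S es"
  unfolding ahead_def
proof (intro allI impI)
  fix q :: nat assume q: "1 \<le> q"
  let ?O = "card {v \<in> P. \<phi> v \<in> C}"
  have IH: "cnt es r + ?O \<le> card S + card (color_ends h \<phi> C P r)" if "1 \<le> r" for r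
    using ah that by (simp add: ahead_def)
  show "cnt es q + card {v \<in> insert x P. \<phi> v \<in> C} \<le> card S + card (color_ends h \<phi> C (insert x P) q)"
  proof (cases "\<phi> x \<in> C")
    case False
    then show ?thesis using IH[OF q]
          unfolding card_colored_insert card_color_ends_insert by simp
  next
    case True
    have cnt: "cnt es (l x) = length es" using full by (simp add: cnt_def)
    have "insert (\<phi> x) (color_ends h \<phi> C P (l x)) \<subseteq> C" using True by (auto simp: color_ends_def)
    then have "card (insert (\<phi> x) (color_ends h \<phi> C P (l x))) \<le> length es"
      using C card_mono order_trans by blast
    then have D: "card (color_ends h \<phi> C P (l x)) + 1 \<le> length es"
      using new_color_free[of "l x"] finite_color_ends by simp
    have base: "length es + ?O \<le> card S + card (color_ends h \<phi> C P (l x))"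
      using IH[OF x(2)] cnt by simp
    \<comment> \<open>Beyond \<open>h x\<close> no track is busy. Up to \<open>h x\<close>, either
      the color becomes occupied and raises the right side, or it was occupied already; then
      \<open>q\<close> is at most \<open>l x\<close>, and passing from \<open>l x\<close> to
      \<open>q\<close> gains one color.\<close>
    consider "h x < q" | "q \<le> h x" "\<phi> x \<notin> color_ends h \<phi> C P q" | "\<phi> x \<in> color_ends h \<phi> C P q"
      by linarith
    then show ?thesis
    proof cases
      case 1
      have "cnt es q = 0"
        using tracks_inv_cnt_0[OF inv _ q] x(4) 1 by (meson le_less_trans)
      then show ?thesis using base D True
          unfolding card_colored_insert card_color_ends_insert by simp
    next
      case 2
      then show ?thesis using IH[OF q] True
          unfolding card_colored_insert card_color_ends_insert by simp
    next
      case 3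
      then have "q \<le> l x" using new_color_free[of q] by linarith
      then show ?thesis using card_color_ends_less[OF _ 3] base cnt_le_length[of es q] True 3
          unfolding card_colored_insert card_color_ends_insert by simp
    qed
  qed
qed

text \<open>The new interval counts on both sides. The only danger is a \<open>q\<close> where
  \<open>cnt\<close> grows although the competitor's color was occupied already. Then
  \<open>q\<close> lies after \<open>t\<close> and up to \<open>l x\<close>; best fit gives
  \<open>cnt\<close> the same value at \<open>l x\<close>, where the competitor has at least one
  occupied color less.\<close>

lemma ahead_accept:
  assumes t: "t < l x" "\<forall>e\<in>set es. e < l x \<longrightarrow> e \<le> t"
    and es': "add_mset t (mset es') = add_mset (h x) (mset es)"
  shows "ahead h \<phi> C (insert x P) (insert x S) es'"
  unfolding ahead_def
proof (intro allI impI)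
  fix q :: nat assume q: "1 \<le> q"
  let ?O = "card {v \<in> P. \<phi> v \<in> C}"
  have IH: "cnt es r + ?O \<le> card S + card (color_ends h \<phi> C P r)" if "1 \<le> r" for r
    using ah that by (simp add: ahead_def)
  have S: "card (insert x S) = card S + 1" using finite_tracks by simp
  have c: "cnt es' q \<le> cnt es q + 1" "\<not> (t < q \<and> q \<le> h x) \<Longrightarrow> cnt es' q \<le> cnt es q"
    using cnt_exchange[OF es', of q] t(1) x(3) by (auto split: if_splits)
  show "cnt es' q + card {v \<in> insert x P. \<phi> v \<in> C} \<le>
    card (insert x S) + card (color_ends h \<phi> C (insert x P) q)"
  proof (cases "\<phi> x \<in> C \<and> t < q \<and> q \<le> h x \<and> \<phi> x \<in> color_ends h \<phi> C P q")
    case False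
    then show ?thesis using IH[OF q] c S
      unfolding card_colored_insert card_color_ends_insert by (auto split: if_splits)
  next
    case True
    then have "q \<le> l x" using new_color_free[of q] by linarith
    then have "cnt es q = cnt es (l x)" using cnt_gap[OF t(2)] True by blast
    then show ?thesis using IH[OF x(2)] card_color_ends_less[OF \<open>q \<le> l x\<close>] True c(1) S
          unfolding card_colored_insert card_color_ends_insert by simp
  qed
qed

end

end

section \<open>All numbers of tracks at once\<close>

lemma level_less_iff:
  assumes "length es = n" "k \<le> n"
  shows "level n l es < k \<longleftrightarrow> (\<exists>e\<in>set (take k es). e < l)"
proof -
  have lev: "level n l es = card {i. i < n \<and> (\<forall>j\<le>i. l \<le> es ! j)}"
  proof -
    have *: "(\<forall>j\<in>set [0..<Suc i]. l \<le> nth_or 0 es j) \<longleftrightarrow> (\<forall>j\<le>i. l \<le> es ! j)" if "i < n" for i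
      using that assms by (auto simp: nth_or_nth less_Suc_eq_le)
    have "{i. i < n \<and> (\<forall>j\<le>i. l \<le> es ! j)} =
      {i. \<forall>j\<in>set [0..<Suc i]. l \<le> nth_or 0 es j} \<inter> set [0..<n]"
    proof (rule set_eqI)
      show "i \<in> {i. i < n \<and> (\<forall>j\<le>i. l \<le> es ! j)} \<longleftrightarrow>
        i \<in> {i. \<forall>j\<in>set [0..<Suc i]. l \<le> nth_or 0 es j} \<inter> set [0..<n]" for i
        using *[of i] by (simp only: mem_Collect_eq Int_iff set_upt atLeastLessThan_iff le0) blast
    qed
    then show ?thesis unfolding level_def using distinct_length_filter[of "[0..<n]"] by auto
  qed
  show ?thesis
  proof
    assume "level n l es < k"
    show "\<exists>e\<in>set (take k es). e < l"
    proof (rule ccontr)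
      assume "\<not> ?thesis"
      then have "l \<le> es ! j" if "j < k" for j
        using that assms nth_mem[of j "take k es"] by (auto simp: not_less)
      then have "{..<k} \<subseteq> {i. i < n \<and> (\<forall>j\<le>i. l \<le> es ! j)}"
        using assms(2) by auto
      then have "card {..<k} \<le> level n l es" unfolding lev by (intro card_mono) auto
      then show False using \<open>level n l es < k\<close> by simp
    qed
  next
    assume "\<exists>e\<in>set (take k es). e < l"
    then obtain j where j: "j < k" "es ! j < l" by (auto simp: set_conv_nth)
    then have "{i. i < n \<and> (\<forall>j\<le>i. l \<le> es ! j)} \<subseteq> {..<j}" by (auto simp: not_le[symmetric])
    then have "level n l es \<le> card {..<j}" unfolding lev by (intro card_mono) auto
    then show "level n l es < k" using j by simp
  qed
qed

definition assign_level ::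
    "('v \<Rightarrow> nat) \<Rightarrow> ('v \<Rightarrow> nat) \<Rightarrow> nat \<Rightarrow> nat list \<times> ('v \<times> nat) list \<Rightarrow> 'v \<Rightarrow> nat list \<times> ('v \<times> nat) list" where
  "assign_level l h n s v = (bub (l v) (h v) (fst s), (v, level n (l v) (fst s)) # snd s)"

lemma assign_level_sel:
  "fst (assign_level l h n s v) = bub (l v) (h v) (fst s)"
  "snd (assign_level l h n s v) = (v, level n (l v) (fst s)) # snd s"
  by (simp_all add: assign_level_def)

definition below :: "('v \<times> nat) list \<Rightarrow> nat \<Rightarrow> 'v set" where
  "below out k = {v. \<exists>j<k. (v, j) \<in> set out}"

text \<open>The fold mentions neither \<open>k\<close> nor the coloring \<open>\<phi>\<close> with
  its colors \<open>C\<close>. Hence a single run satisfies the invariants for every number of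
  tracks and against every competitor.\<close>

lemma foldl_assign_level:
  fixes l h :: "'v \<Rightarrow> nat" and \<phi> :: "'v \<Rightarrow> 'c"
  assumes "distinct vs" "sorted (map h vs)" "\<And>v. v \<in> set vs \<Longrightarrow> 1 \<le> l v \<and> l v \<le> h v"
    and proper: "\<And>u v. u \<in> set vs \<Longrightarrow> v \<in> set vs \<Longrightarrow> u \<noteq> v \<Longrightarrow> l u \<le> h v \<Longrightarrow> l v \<le> h u \<Longrightarrow> \<phi> u \<noteq> \<phi> v"
    and k: "k \<le> n" and C: "finite C" "card C \<le> k"
  shows "length (fst (foldl (assign_level l h n) (replicate n 0, []) vs)) = n \<and>
    map fst (snd (foldl (assign_level l h n) (replicate n 0, []) vs)) = rev vs \<and>
    tracks_inv l h (set vs) (below (snd (foldl (assign_level l h n) (replicate n 0, []) vs)) k)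
      (take k (fst (foldl (assign_level l h n) (replicate n 0, []) vs))) \<and>
    ahead h \<phi> C (set vs) (below (snd (foldl (assign_level l h n) (replicate n 0, []) vs)) k)
      (take k (fst (foldl (assign_level l h n) (replicate n 0, []) vs)))"
  using assms(1-4)
proof (induction vs rule: rev_induct)
  case Nil
  \<comment> \<open>The initial end points are 0, which is why both invariants restrict
    \<open>q\<close> to positive values.\<close>
  have "cnt (replicate k 0) q = 0" if "1 \<le> q" for q
    using that by (auto simp: cnt_def)
  then show ?case using k
    by (auto simp: tracks_inv_def ahead_def below_def depth_def min_absorb2)
next
  case (snoc x vs)
  let ?s = "foldl (assign_level l h n) (replicate n 0, []) vs"
  let ?es = "take k (fst ?s)" and ?S = "below (snd ?s) k"
  have IH: "length (fst ?s) = n" "map fst (snd ?s) = rev vs" "tracks_inv l h (set vs) ?S ?es"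
    "ahead h \<phi> C (set vs) ?S ?es"
    using snoc by (auto simp: sorted_append)
  have x: "x \<notin> set vs" "1 \<le> l x" "l x \<le> h x" "\<And>v. v \<in> set vs \<Longrightarrow> h v \<le> h x"
    using snoc.prems by (auto simp: sorted_append)
  have len: "length ?es = k" using IH(1) k by simp
  have C': "card C \<le> length ?es" using C len by simp
  have pr: "\<phi> v \<noteq> \<phi> x" if "v \<in> set vs" "l x \<le> h v" for v
    using snoc.prems(3)[of v] snoc.prems(4)[of v x] x that by (auto intro: order_trans)
  have S': "below (snd (assign_level l h n ?s x)) k =
      (if \<exists>e\<in>set ?es. e < l x then insert x ?S else ?S)"
    using level_less_iff[OF IH(1) k, of "l x"] by (auto simp: below_def assign_level_sel)
  have es': "take k (fst (assign_level l h n ?s x)) = bub (l x) (h x) ?es"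
    by (simp add: take_bub assign_level_sel)
  from bub_mset[OF x(3), of ?es]
  have "tracks_inv l h (insert x (set vs)) (below (snd (assign_level l h n ?s x)) k)
      (take k (fst (assign_level l h n ?s x))) \<and>
    ahead h \<phi> C (insert x (set vs)) (below (snd (assign_level l h n ?s x)) k)
      (take k (fst (assign_level l h n ?s x)))"
  proof
    assume a: "(\<forall>e\<in>set ?es. l x \<le> e) \<and> bub (l x) (h x) ?es = ?es"
    then have "below (snd (assign_level l h n ?s x)) k = ?S" by (auto simp: S')
    then show ?thesis
      using tracks_inv_reject[OF IH(3) x] ahead_reject[OF IH(3) x C(1) C' IH(4) pr] a by (simp add: es')
  next
    assume "\<exists>t\<in>set ?es. t < l x \<and> (\<forall>e\<in>set ?es. e < l x \<longrightarrow> e \<le> t) \<and>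
      add_mset t (mset (bub (l x) (h x) ?es)) = add_mset (h x) (mset ?es)"
    then obtain t where t: "t \<in> set ?es" "t < l x" "\<forall>e\<in>set ?es. e < l x \<longrightarrow> e \<le> t"
      "add_mset t (mset (bub (l x) (h x) ?es)) = add_mset (h x) (mset ?es)" by blast
    then have "below (snd (assign_level l h n ?s x)) k = insert x ?S" by (auto simp: S')
    then show ?thesis
      using tracks_inv_accept[OF IH(3) x t(2-4)] ahead_accept[OF IH(3) x C(1) C' IH(4) pr t(2-4)]
      by (simp add: es')
  qed
  then show ?case using IH(1,2) by (simp add: assign_level_sel)
qed


text \<open>An interval of level \<open>k\<close> contains a point where \<open>below out k\<close> has depth \<open>k\<close>, and there no other
  interval of level \<open>k\<close> fits. But of three intervals with a common point, one is covered by the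
  other two.\<close>

lemma level_no_triple:
  fixes l h :: "'v \<Rightarrow> nat"
  assumes k: "tracks_inv l h P (below out k) es" "length es = k"
    and Suc_k: "tracks_inv l h P (below out (Suc k)) es'" "length es' = Suc k"
    and dist: "distinct (map fst out)"
    and xyz: "(x, k) \<in> set out" "(y, k) \<in> set out" "(z, k) \<in> set out" "x \<noteq> y" "x \<noteq> z" "y \<noteq> z"
    and p: "\<And>v. v \<in> {x, y, z} \<Longrightarrow> l v \<le> p \<and> p \<le> h v"
  shows False
proof -
  have notin: "v \<notin> below out k" if "(v, k) \<in> set out" for v
    using that dist by (force simp: below_def distinct_map inj_on_def)
  have inP: "v \<in> below out (Suc k) \<and> v \<in> P" if "(v, k) \<in> set out" for v
    using that Suc_k(1) by (auto simp: below_def tracks_inv_def)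
  have fin: "finite (below out (Suc k))" "finite (below out k)"
    using Suc_k(1) k(1) finite_subset unfolding tracks_inv_def by blast+
  have sub: "below out k \<subseteq> below out (Suc k)" unfolding below_def using less_SucI by blast
  have own_point: "\<exists>q. l v \<le> q \<and> q \<le> h v \<and> (\<forall>w. (w, k) \<in> set out \<longrightarrow> w \<noteq> v \<longrightarrow> \<not> (l w \<le> q \<and> q \<le> h w))"
    if v: "(v, k) \<in> set out" for v
  proof -
    obtain q where q: "l v \<le> q" "q \<le> h v" "k \<le> depth l h (below out k) q"
      using k inP[OF v] notin[OF v] unfolding tracks_inv_def by blast
    have "\<not> (l w \<le> q \<and> q \<le> h w)" if w: "(w, k) \<in> set out" "w \<noteq> v" for w
    proof
      assume "l w \<le> q \<and> q \<le> h w"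
      then have "depth l h (insert w (insert v (below out k))) q = depth l h (below out k) q + 2"
        using depth_insert[of "below out k" v l h q] depth_insert[of "insert v (below out k)" w l h q]
          fin notin[OF v] notin[OF w(1)] w(2) q by simp
      moreover have "depth l h (insert w (insert v (below out k))) q \<le> depth l h (below out (Suc k)) q"
        using fin sub inP[OF v] inP[OF w(1)] by (intro depth_mono) auto
      moreover have "depth l h (below out (Suc k)) q \<le> Suc k"
        using Suc_k cnt_le_length[of es' q] unfolding tracks_inv_def by (metis le_trans)
      ultimately show False using q(3) by simp
    qed
    then show ?thesis using q by blast
  qed
  obtain qx where qx: "l x \<le> qx" "qx \<le> h x" "\<not> (l y \<le> qx \<and> qx \<le> h y)" "\<not> (l z \<le> qx \<and> qx \<le> h z)"
    using own_point[OF xyz(1)] xyz by metis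
  obtain qy where qy: "l y \<le> qy" "qy \<le> h y" "\<not> (l x \<le> qy \<and> qy \<le> h x)" "\<not> (l z \<le> qy \<and> qy \<le> h z)"
    using own_point[OF xyz(2)] xyz by metis
  obtain qz where qz: "l z \<le> qz" "qz \<le> h z" "\<not> (l x \<le> qz \<and> qz \<le> h x)" "\<not> (l y \<le> qz \<and> qz \<le> h y)"
    using own_point[OF xyz(3)] xyz by metis
  have "l x \<le> p" "p \<le> h x" "l y \<le> p" "p \<le> h y" "l z \<le> p" "p \<le> h z" using p by auto
  with qx qy qz show False by linarith
qed

text \<open>Beyond all right end points no color is occupied, so only the numbers of intervals
  remain to be compared.\<close>

lemma aheadD:
  assumes "ahead h \<phi> C P S es" "\<And>v. v \<in> P \<Longrightarrow> h v < q"
  shows "card {v \<in> P. \<phi> v \<in> C} \<le> card S"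
proof -
  have "color_ends h \<phi> C P (Suc q) = {}" using assms(2) by (force simp: color_ends_def)
  moreover have "cnt es (Suc q) + card {v \<in> P. \<phi> v \<in> C} \<le> card S + card (color_ends h \<phi> C P (Suc q))"
    using assms(1) by (simp add: ahead_def)
  ultimately show ?thesis by simp
qed

section \<open>Splitting a level into two colors\<close>

text \<open>A conflict on the second color of a level needs an earlier neighbor of that color
  besides the one that blocked the first color. A color determines its level, so these are two
  earlier neighbors on one level.\<close>

lemma foldl_color_step:
  assumes "distinct (map fst out)"
    and no_triple: "\<And>pre x j post y z. out = pre @ (x, j) # post \<Longrightarrow> (y, j) \<in> set pre \<Longrightarrow> (z, j) \<in> set pre \<Longrightarrow>
      y \<noteq> z \<Longrightarrow> cadj A y x \<Longrightarrow> cadj A z x \<Longrightarrow> False"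
    and sym: "\<And>u v. u \<in> fst ` set out \<Longrightarrow> v \<in> fst ` set out \<Longrightarrow> cadj A u v \<Longrightarrow> cadj A v u"
  shows "map fst (foldl (color_step A) [] out) = rev (map fst out) \<and>
    (\<forall>(v, c)\<in>set (foldl (color_step A) [] out). \<exists>j. (v, j) \<in> set out \<and> (c = Suc (j + j) \<or> c = Suc (Suc (j + j)))) \<and>
    (\<forall>(u, c)\<in>set (foldl (color_step A) [] out). \<forall>(v, d)\<in>set (foldl (color_step A) [] out).
      u \<noteq> v \<longrightarrow> cadj A u v \<longrightarrow> c \<noteq> d)"
  using assms
proof (induction out rule: rev_induct)
  case (snoc w out)
  obtain x j where w: "w = (x, j)" by (cases w)
  define cs where "cs = foldl (color_step A) [] out"
  define b where "b = (\<exists>z\<in>set cs. snd z = Suc (j + j) \<and> cadj A (fst z) x)"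
  define e where "e = (if b then Suc (Suc (j + j)) else Suc (j + j))"
  have IH: "map fst cs = rev (map fst out)"
    "\<And>v c. (v, c) \<in> set cs \<Longrightarrow> \<exists>j. (v, j) \<in> set out \<and> (c = Suc (j + j) \<or> c = Suc (Suc (j + j)))"
    "\<And>u c v d. (u, c) \<in> set cs \<Longrightarrow> (v, d) \<in> set cs \<Longrightarrow> u \<noteq> v \<Longrightarrow> cadj A u v \<Longrightarrow> c \<noteq> d"
  proof -
    have "distinct (map fst out)" using snoc.prems(1) by simp
    moreover have False if "out = pre @ (x, j) # post" "(y, j) \<in> set pre" "(z, j) \<in> set pre"
      "y \<noteq> z" "cadj A y x" "cadj A z x" for pre x j post y z
      by (rule snoc.prems(2)[of pre x j "post @ [w]" y z]) (use that in auto)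
    moreover have "cadj A v u" if "u \<in> fst ` set out" "v \<in> fst ` set out" "cadj A u v" for u v
      using snoc.prems(3) that by auto
    ultimately show "map fst cs = rev (map fst out)"
    "\<And>v c. (v, c) \<in> set cs \<Longrightarrow> \<exists>j. (v, j) \<in> set out \<and> (c = Suc (j + j) \<or> c = Suc (Suc (j + j)))"
    "\<And>u c v d. (u, c) \<in> set cs \<Longrightarrow> (v, d) \<in> set cs \<Longrightarrow> u \<noteq> v \<Longrightarrow> cadj A u v \<Longrightarrow> c \<noteq> d"
      using snoc.IH unfolding cs_def by blast+
  qed
  have fold: "foldl (color_step A) [] (out @ [w]) = (x, e) # cs"
    by (simp add: color_step_def w cs_def b_def e_def)
  have new: "e \<noteq> d" if v: "(v, d) \<in> set cs" and vx: "cadj A v x" for v d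
  proof
    assume "e = d"
    obtain i where i: "(v, i) \<in> set out" "d = Suc (i + i) \<or> d = Suc (Suc (i + i))"
      using IH(2)[OF v] by blast
    show False
    proof (cases b)
      case False
      then have "d = Suc (j + j)" using \<open>e = d\<close> by (simp add: e_def)
      then show False using False v vx by (force simp: b_def)
    next
      case True
      then have d: "d = Suc (Suc (j + j))" using \<open>e = d\<close> by (simp add: e_def)
      then have "i = j" using i(2) by presburger
      from True obtain z where z: "(z, Suc (j + j)) \<in> set cs" "cadj A z x"
        unfolding b_def by (metis prod.collapse)
      obtain i' where i': "(z, i') \<in> set out" "Suc (j + j) = Suc (i' + i') \<or> Suc (j + j) = Suc (Suc (i' + i'))"
        using IH(2)[OF z(1)] by blast
      then have "i' = j" by presburger
      have "distinct (map fst cs)" using snoc.prems(1) by (simp add: IH(1))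
      then have "z \<noteq> v" using eq_key_imp_eq_value[of cs v "Suc (j + j)" d] z(1) v d by auto
      then show False using snoc.prems(2)[of out x j "[]" z v] i(1) i'(1) \<open>i = j\<close> \<open>i' = j\<close> z(2) vx w by auto
    qed
  qed
  have new': "d \<noteq> e" if v: "(v, d) \<in> set cs" and xv: "cadj A x v" for v d
  proof -
    have "v \<in> fst ` set out" using IH(2)[OF v] by force
    then have "cadj A v x" using snoc.prems(3)[of x v] xv by (auto simp: w)
    then show ?thesis using new[OF v] by blast
  qed
  show ?case
    unfolding fold
  proof (intro conjI)
    show "map fst ((x, e) # cs) = rev (map fst (out @ [w]))" by (simp add: IH(1) w)
    show "\<forall>(v, c)\<in>set ((x, e) # cs). \<exists>j. (v, j) \<in> set (out @ [w]) \<and> (c = Suc (j + j) \<or> c = Suc (Suc (j + j)))"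
      using IH(2) by (fastforce simp: w e_def)
    show "\<forall>(u, c)\<in>set ((x, e) # cs). \<forall>(v, d)\<in>set ((x, e) # cs). u \<noteq> v \<longrightarrow> cadj A u v \<longrightarrow> c \<noteq> d"
    proof -
      have "c \<noteq> d" if "(u, c) \<in> set ((x, e) # cs)" "(v, d) \<in> set ((x, e) # cs)" "u \<noteq> v" "cadj A u v" for u c v d
        using that IH(3)[of u c v d] new[of u c] new'[of v d] by auto
      then show ?thesis by blast
    qed
  qed
qed simp

lemma output_color_in:
  assumes "v \<in> fst ` set cs"
  shows "(v, output_color cs v) \<in> set cs"
proof -
  have "filter (\<lambda>z. fst z = v) cs \<noteq> []" using assms by (auto simp: filter_empty_conv)
  then obtain z zs where z: "filter (\<lambda>z. fst z = v) cs = z # zs" by (cases "filter (\<lambda>z. fst z = v) cs") auto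
  then have "z \<in> set (filter (\<lambda>z. fst z = v) cs)" by simp
  then have "fst z = v" "z \<in> set cs" by auto
  moreover have "output_color cs v = snd z" by (simp add: output_color_def z)
  ultimately show ?thesis by (metis prod.collapse)
qed

lemma bucket_sort:
  fixes f :: "nat \<Rightarrow> nat" and n :: nat
  defines "b \<equiv> \<lambda>m. concat (map (\<lambda>p. filter (\<lambda>v. f v = p) [0..<n]) [0..<m])"
  shows "set (b m) = {v. v < n \<and> f v < m} \<and> distinct (b m) \<and> sorted (map f (b m))"
proof (induction m)
  case (Suc m)
  have "b (Suc m) = b m @ filter (\<lambda>v. f v = m) [0..<n]" by (simp add: b_def)
  moreover have "map f (filter (\<lambda>v. f v = m) xs) = replicate (length (filter (\<lambda>v. f v = m) xs)) m" for xs
    by (induction xs) auto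
  ultimately show ?case using Suc by (auto simp: sorted_append)
qed (simp add: b_def)

section \<open>Entropy\<close>

text \<open>Summation by parts: nonnegative partial sums are multiplied by the decrements of
  \<open>g\<close>, and the boundary term vanishes because the total is 0.\<close>

lemma sum_decreasing_nonneg:
  fixes d g :: "nat \<Rightarrow> real"
  assumes "\<And>k. k \<le> K \<Longrightarrow> 0 \<le> (\<Sum>i<k. d i)" "(\<Sum>i<K. d i) = 0"
    and "\<And>i. Suc i < K \<Longrightarrow> g (Suc i) \<le> g i"
  shows "0 \<le> (\<Sum>i<K. d i * g i)"
proof (cases K)
  case (Suc K')
  have "(\<Sum>i<Suc m. d i) * g m \<le> (\<Sum>i<Suc m. d i * g i)" if "m < K" for m
    using that
  proof (induction m)
    case (Suc m)
    have "(\<Sum>i<Suc m. d i) * g (Suc m) \<le> (\<Sum>i<Suc m. d i) * g m"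
      using Suc.prems assms(1)[of "Suc m"] assms(3)[of m] by (intro mult_left_mono) auto
    also have "\<dots> \<le> (\<Sum>i<Suc m. d i * g i)" using Suc by simp
    finally show ?case by (simp add: algebra_simps)
  qed simp
  from this[of K'] show ?thesis using assms(2) Suc by simp
qed simp

lemma sum_pairs: "(\<Sum>c<2 * K. a (c div 2) / 2) = (\<Sum>i<K. a i)" for a :: "nat \<Rightarrow> real"
  by (induction K) auto

text \<open>Gibbs' inequality, with the optimal class sizes, each split into two halves, as weights.\<close>

lemma entropy_split_levels:
  fixes \<phi> \<psi> lev :: "'v \<Rightarrow> nat"
  assumes V: "finite V" "V \<noteq> {}"
    and \<phi>: "\<And>v. v \<in> V \<Longrightarrow> \<phi> v = Suc (lev v + lev v) \<or> \<phi> v = Suc (Suc (lev v + lev v))"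
    and max: "\<And>C. card C \<le> card V \<Longrightarrow> finite C \<Longrightarrow> card {v \<in> V. \<psi> v \<in> C} \<le> card {v \<in> V. lev v < card C}"
  shows "color_entropy V \<phi> \<le> color_entropy V \<psi> + 1"
proof -
  define n where "n = card V"
  define size where "size = (\<lambda>c. card {v \<in> V. \<psi> v = c})"
  \<comment> \<open>\<open>sort_key\<close> sorts upwards; the key \<open>n - size c\<close> puts
    the largest classes first.\<close>
  define cs where "cs = sort_key (\<lambda>c. n - size c) (sorted_list_of_set (\<psi> ` V))"
  define K where "K = length cs"
  define a where "a = (\<lambda>i. real (size (cs ! i)))"
  define w where "w = (\<lambda>i. real (card {v \<in> V. lev v = i}))"
  define g where "g = (\<lambda>i. log 2 (a i / n))"
  have n: "0 < n" using V by (simp add: n_def card_gt_0_iff)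
  have cs: "set cs = \<psi> ` V" "distinct cs" "sorted (map (\<lambda>c. n - size c) cs)"
    using V by (auto simp: cs_def)
  have size_le: "size c \<le> n" for c unfolding size_def n_def using V by (intro card_mono) auto
  have size_pos: "0 < size c" if "c \<in> \<psi> ` V" for c
    unfolding size_def using that V by (auto simp: card_gt_0_iff)
  have a_pos: "0 < a i" if "i < K" for i
    using size_pos[of "cs ! i"] that cs(1) nth_mem[of i cs] by (auto simp: a_def K_def)
  have a_dec: "a (Suc i) \<le> a i" if "Suc i < K" for i
  proof -
    have "n - size (cs ! i) \<le> n - size (cs ! Suc i)"
      using sorted_nth_mono[OF cs(3), of i "Suc i"] that by (simp add: K_def)
    then show ?thesis using size_le[of "cs ! i"] size_le[of "cs ! Suc i"] by (simp add: a_def)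
  qed
  have K_le: "K \<le> n"
    using distinct_card[OF cs(2)] card_image_le[OF V(1), of \<psi>] by (simp add: K_def n_def cs(1))
  have classes: "card {v \<in> V. \<psi> v \<in> set (take k cs)} = (\<Sum>i<k. size (cs ! i))" if "k \<le> K" for k
  proof -
    have "set (take k cs) = (!) cs ` {..<k}"
      using nth_image[of k cs] that by (simp add: K_def atLeast0LessThan)
    then have "{v \<in> V. \<psi> v \<in> set (take k cs)} = (\<Union>i<k. {v \<in> V. \<psi> v = cs ! i})"
      by auto
    also have "card \<dots> = (\<Sum>i<k. card {v \<in> V. \<psi> v = cs ! i})"
      using V cs(2) that by (subst card_UN_disjoint) (auto simp: nth_eq_iff_index_eq K_def)
    finally show ?thesis by (simp add: size_def)
  qed
  have levels: "real (card {v \<in> V. lev v < k}) = (\<Sum>i<k. w i)" for k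
  proof -
    have "{v \<in> V. lev v < k} = (\<Union>i<k. {v \<in> V. lev v = i})" by auto
    also have "card \<dots> = (\<Sum>i<k. card {v \<in> V. lev v = i})"
      using V by (subst card_UN_disjoint) auto
    finally show ?thesis by (simp add: w_def)
  qed
  have prefix: "(\<Sum>i<k. a i) \<le> (\<Sum>i<k. w i)" if "k \<le> K" for k
  proof -
    have "card (set (take k cs)) = k" using that cs(2) by (simp add: distinct_card K_def)
    then have "card {v \<in> V. \<psi> v \<in> set (take k cs)} \<le> card {v \<in> V. lev v < k}"
      using max[of "set (take k cs)"] that K_le by (simp add: n_def)
    then have "real (\<Sum>i<k. size (cs ! i)) \<le> real (card {v \<in> V. lev v < k})"
      using classes[OF that] by (simp only: of_nat_le_iff)
    then show ?thesis by (simp add: levels a_def)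
  qed
  have "{v \<in> V. \<psi> v \<in> set (take K cs)} = V" by (auto simp: K_def cs(1))
  then have "n = (\<Sum>i<K. size (cs ! i))" using classes[of K] by (simp add: n_def)
  then have sum_a: "(\<Sum>i<K. a i) = n" by (simp add: a_def)
  \<comment> \<open>\<open>\<psi>\<close> covers \<open>V\<close> with \<open>K\<close> colors, so
    by the comparison of prefixes the first \<open>K\<close> levels hold all vertices too.\<close>
  have all: "{v \<in> V. lev v < K} = V"
  proof (rule card_seteq)
    have "real n \<le> real (card {v \<in> V. lev v < K})" using prefix[of K] sum_a levels[of K] by simp
    then show "card V \<le> card {v \<in> V. lev v < K}" by (simp add: n_def)
  qed (use V in auto)
  then have lev_less: "lev v < K" if "v \<in> V" for v using that by blast
  have sum_w: "(\<Sum>i<K. w i) = n" using levels[of K] by (simp only: all n_def)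
  have g_dec: "g (Suc i) \<le> g i" if "Suc i < K" for i
    using a_dec[OF that] a_pos[OF that] n unfolding g_def by (intro log_mono) (auto simp: divide_right_mono)
  have "0 \<le> (\<Sum>i<K. (w i - a i) * g i)"
    using prefix sum_a sum_w g_dec by (intro sum_decreasing_nonneg) (auto simp: sum_subtractf)
  then have abel: "(\<Sum>i<K. a i * g i) \<le> (\<Sum>i<K. w i * g i)"
    by (simp add: left_diff_distrib sum_subtractf)
  have wg: "(\<Sum>v\<in>V. g (lev v)) = (\<Sum>i<K. w i * g i)"
  proof -
    have "(\<Sum>v\<in>V. g (lev v)) = (\<Sum>i<K. \<Sum>v | v \<in> V \<and> lev v = i. g (lev v))"
      using lev_less V by (intro sum.group[symmetric]) auto
    also have "\<dots> = (\<Sum>i<K. w i * g i)" by (intro sum.cong) (auto simp: w_def)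
    finally show ?thesis .
  qed
  have ag: "(\<Sum>i<K. a i * g i) = - (n * color_entropy V \<psi>)"
  proof -
    have "(\<Sum>i<K. a i * g i) = (\<Sum>c\<in>\<psi> ` V. real (size c) * log 2 (real (size c) / n))"
      unfolding a_def g_def
      by (rule sum.reindex_bij_betw[of "\<lambda>i. cs ! i" "{..<K}" "\<psi> ` V" "\<lambda>c. real (size c) * log 2 (real (size c) / n)"])
        (use bij_betw_nth[OF cs(2)] cs(1) K_def in auto)
    also have "\<dots> = - (n * color_entropy V \<psi>)"
      using n by (simp add: color_entropy_def color_freq_def size_def n_def sum_distrib_left)
    finally show ?thesis .
  qed
  define c where "c = (\<lambda>v. real (card {u \<in> V. \<phi> u = \<phi> v}))"
  have c_pos: "0 < c v" if "v \<in> V" for v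
    using that V by (auto simp: c_def card_gt_0_iff)
  have lev_eq: "lev v = (\<phi> v - 1) div 2" if "v \<in> V" for v
    using \<phi>[OF that] by (elim disjE) simp_all
  \<comment> \<open>Within a class of \<open>\<phi>\<close> the summands agree and
    \<open>c v\<close> cancels its size, leaving half the size of the class of \<open>\<psi>\<close>
    with the index of the level. Each index occurs for at most two classes of
    \<open>\<phi>\<close>.\<close>
  have weights: "(\<Sum>v\<in>V. a (lev v) / (2 * c v)) \<le> n"
  proof -
    have "(\<Sum>v\<in>V. a (lev v) / (2 * c v)) = (\<Sum>i\<in>\<phi> ` V. \<Sum>v\<in>{v \<in> V. \<phi> v = i}. a (lev v) / (2 * c v))"
      by (rule sum.image_gen[OF V(1)])
    also have "\<dots> = (\<Sum>i\<in>\<phi> ` V. a ((i - 1) div 2) / 2)"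
    proof (rule sum.cong[OF refl])
      fix i assume i: "i \<in> \<phi> ` V"
      have "(\<Sum>v\<in>{v \<in> V. \<phi> v = i}. a (lev v) / (2 * c v)) =
        (\<Sum>v\<in>{v \<in> V. \<phi> v = i}. a ((i - 1) div 2) / (2 * real (card {u \<in> V. \<phi> u = i})))"
        by (rule sum.cong) (auto simp: lev_eq c_def)
      also have "\<dots> = a ((i - 1) div 2) / 2"
      proof -
        have "card {u \<in> V. \<phi> u = i} \<noteq> 0" using i V by (auto simp: card_eq_0_iff)
        then show ?thesis by simp
      qed
      finally show "(\<Sum>v\<in>{v \<in> V. \<phi> v = i}. a (lev v) / (2 * c v)) = a ((i - 1) div 2) / 2" .
    qed
    also have "\<dots> = (\<Sum>i\<in>(\<lambda>i. i - 1) ` \<phi> ` V. a (i div 2) / 2)"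
    proof -
      have inj: "inj_on (\<lambda>i. i - 1) (\<phi> ` V)"
      proof (rule inj_onI)
        fix i j assume "i \<in> \<phi> ` V" "j \<in> \<phi> ` V" "i - 1 = j - 1"
        moreover have "0 < k" if "k \<in> \<phi> ` V" for k using that \<phi> by force
        ultimately show "i = j" by (metis Suc_pred' One_nat_def)
      qed
      show ?thesis by (simp only: sum.reindex[OF inj] o_def)
    qed
    also have "\<dots> \<le> (\<Sum>i<2 * K. a (i div 2) / 2)"
    proof (rule sum_mono2)
      show "(\<lambda>i. i - 1) ` \<phi> ` V \<subseteq> {..<2 * K}"
      proof clarify
        fix v assume "v \<in> V"
        then show "\<phi> v - 1 < 2 * K" using \<phi>[of v] lev_less[of v] by linarith
      qed
    qed (auto simp: a_def)
    finally show ?thesis using sum_a by (simp add: sum_pairs)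
  qed
  have "(\<Sum>v\<in>V. ln (a (lev v) / (2 * c v))) \<le> (\<Sum>v\<in>V. a (lev v) / (2 * c v) - 1)"
    using c_pos a_pos lev_less by (intro sum_mono ln_le_minus_one) simp
  also have "\<dots> \<le> 0" using weights by (simp add: sum_subtractf n_def)
  finally have gibbs: "(\<Sum>v\<in>V. log 2 (a (lev v) / (2 * c v))) \<le> 0"
    by (simp add: log_def sum_divide_distrib[symmetric] divide_nonpos_pos)
  \<comment> \<open>The halved weights appear here as the term \<open>- 1\<close>, the one bit of
    the theorem.\<close>
  have "log 2 (a (lev v) / (2 * c v)) = g (lev v) - 1 - log 2 (c v / n)" if "v \<in> V" for v
    using c_pos[OF that] a_pos[OF lev_less[OF that]] n by (simp add: g_def log_divide log_mult)
  then have "(\<Sum>v\<in>V. g (lev v) - 1 - log 2 (c v / n)) \<le> 0" using gibbs by simp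
  then have "(\<Sum>v\<in>V. g (lev v)) - n \<le> (\<Sum>v\<in>V. log 2 (c v / n))"
    by (simp add: sum_subtractf n_def)
  moreover have "(\<Sum>v\<in>V. log 2 (c v / n)) = - (n * color_entropy V \<phi>)"
    unfolding color_entropy_partition[OF V(1)] c_def using n
    by (simp add: sum_divide_distrib[symmetric] n_def)
  ultimately have "n * color_entropy V \<phi> \<le> n * (color_entropy V \<psi> + 1)"
    using wg ag abel by (simp add: distrib_left)
  then show ?thesis using n by simp
qed

section \<open>Correctness of the algorithm\<close>

context
  fixes A :: "bool list list" and J :: "nat \<Rightarrow> real set"
    and n :: nat and l h :: "nat \<Rightarrow> nat" and vs :: "nat list" and out :: "(nat \<times> nat) list"
  defines "n \<equiv> length A"
    and "l \<equiv> lo A (clique_order A)" and "h \<equiv> hi A (clique_order A)"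
    and "vs \<equiv> vertex_order A (clique_order A)" and "out \<equiv> levels (A, clique_order A)"
  assumes adj: "\<And>u v. u < n \<Longrightarrow> v < n \<Longrightarrow> cadj A u v \<longleftrightarrow> J u \<inter> J v \<noteq> {}"
    and int: "\<And>v. v < n \<Longrightarrow> is_interval (J v)"
begin

lemma overlap: "u < n \<Longrightarrow> v < n \<Longrightarrow> cadj A u v \<longleftrightarrow> l u \<le> h v \<and> l v \<le> h u"
  using overlap_iff_adjacent[of A J u v] adj int unfolding n_def l_def h_def by blast

lemma lo_hi: "v < n \<Longrightarrow> 1 \<le> l v \<and> l v \<le> h v"
  using overlap[of v v] by (simp add: cadj_def lo_def l_def)

lemma hi_less: "h v < Suc (length (cliques A))"
  unfolding h_def hi_def by (simp add: less_Suc_eq_le)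

lemma vertex_order_props: "set vs = {..<n}" "distinct vs" "sorted (map h vs)"
  using bucket_sort[of h n "Suc (length (cliques A))", unfolded h_def n_def,
      folded vertex_order_def, folded h_def n_def vs_def] hi_less
  by (simp_all add: lessThan_def)

lemma out_eq: "out = snd (foldl (assign_level l h n) (replicate n 0, []) vs)"
proof -
  have "level_step (A, clique_order A) = assign_level l h n"
    by (simp add: fun_eq_iff level_step_def assign_level_def l_def h_def n_def)
  then show ?thesis by (simp add: levels_def map_replicate_const out_def vs_def n_def)
qed

lemma greedy:
  assumes "k \<le> n" "finite C" "card C \<le> k"
    and "\<And>u v. u < n \<Longrightarrow> v < n \<Longrightarrow> u \<noteq> v \<Longrightarrow> cadj A u v \<Longrightarrow> \<psi> u \<noteq> \<psi> v"
  shows "map fst out = rev vs \<and>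
    (\<exists>es. length es = k \<and> tracks_inv l h {..<n} (below out k) es \<and> ahead h \<psi> C {..<n} (below out k) es)"
proof -
  let ?es = "fst (foldl (assign_level l h n) (replicate n 0, []) vs)"
  have "length ?es = n \<and> map fst out = rev vs \<and> tracks_inv l h (set vs) (below out k) (take k ?es) \<and>
    ahead h \<psi> C (set vs) (below out k) (take k ?es)"
    unfolding out_eq
  proof (rule foldl_assign_level[OF vertex_order_props(2,3) _ _ assms(1-3)])
    show "\<psi> u \<noteq> \<psi> v" if "u \<in> set vs" "v \<in> set vs" "u \<noteq> v" "l u \<le> h v" "l v \<le> h u" for u v
      using that assms(4) overlap by (simp add: vertex_order_props(1))
    show "1 \<le> l v \<and> l v \<le> h v" if "v \<in> set vs" for v
      using lo_hi that by (simp only: vertex_order_props(1) lessThan_iff)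
  qed
  then show ?thesis using assms(1) unfolding vertex_order_props(1)
    by (intro conjI exI[of _ "take k ?es"]) simp_all
qed

text \<open>Facts that involve no competitor come from the trivial one: \<open>id\<close> as the
  coloring and no colors.\<close>

lemma map_fst_out: "map fst out = rev vs"
  using greedy[of 0 "{}" id] by simp

lemma tracks_out: "k \<le> n \<Longrightarrow> \<exists>es. length es = k \<and> tracks_inv l h {..<n} (below out k) es"
  using greedy[of k "{}" id] by auto

lemma below_maximum:
  assumes "k \<le> n" "finite C" "card C \<le> k"
    and "\<And>u v. u < n \<Longrightarrow> v < n \<Longrightarrow> u \<noteq> v \<Longrightarrow> cadj A u v \<Longrightarrow> \<psi> u \<noteq> \<psi> v"
  shows "card {v \<in> {..<n}. \<psi> v \<in> C} \<le> card (below out k)"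
proof -
  obtain es where "ahead h \<psi> C {..<n} (below out k) es"
    using greedy[of k C \<psi>] assms by blast
  then show ?thesis using hi_less by (rule aheadD)
qed

lemma distinct_out: "distinct (map fst out)" and fst_out: "fst ` set out = {..<n}"
proof -
  show "distinct (map fst out)" using vertex_order_props(2) by (simp add: map_fst_out)
  have "set (map fst out) = {..<n}" unfolding map_fst_out by (simp add: vertex_order_props(1))
  then show "fst ` set out = {..<n}" by simp
qed

text \<open>Against the competitor \<open>id\<close>, which colors all vertices with
  \<open>n\<close> colors, the greedy choice on \<open>n\<close> tracks must accept every
  vertex.\<close>

lemma level_out_less: "(v, j) \<in> set out \<Longrightarrow> j < n"
proof -
  assume v: "(v, j) \<in> set out"
  have "below out n \<subseteq> {..<n}" using fst_out by (force simp: below_def)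
  moreover have "card {..<n} \<le> card (below out n)"
    using below_maximum[of n "{..<n}" id] by simp
  ultimately have "below out n = {..<n}" by (intro card_seteq) auto
  then have "v \<in> below out n" using v fst_out by force
  then obtain i where "i < n" "(v, i) \<in> set out" by (auto simp: below_def)
  then show "j < n" using eq_key_imp_eq_value[OF distinct_out v] by blast
qed

text \<open>In \<open>out\<close> the right end points never increase, so both neighbors contain the
  point \<open>h x\<close>, and three intervals of one level would share it.\<close>

lemma out_no_triple:
  assumes out: "out = pre @ (x, j) # post" and yz: "(y, j) \<in> set pre" "(z, j) \<in> set pre" "y \<noteq> z"
    and "cadj A y x" "cadj A z x"
  shows False
proof -
  have mem: "(x, j) \<in> set out" "(y, j) \<in> set out" "(z, j) \<in> set out" using out yz by auto
  have n: "x < n" "y < n" "z < n" using fst_out mem by force+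
  have "x \<notin> fst ` set pre" using distinct_out unfolding out by auto
  then have ne: "x \<noteq> y" "x \<noteq> z" using yz by force+
  have "sorted (rev (map h (map fst out)))"
    unfolding map_fst_out using vertex_order_props(3) by (simp add: rev_map)
  then have h: "h x \<le> h y" "h x \<le> h z"
    unfolding out using yz by (force simp: sorted_append)+
  have "j < n" using level_out_less mem(1) by blast
  obtain es es' where es: "length es = j" "tracks_inv l h {..<n} (below out j) es"
    "length es' = Suc j" "tracks_inv l h {..<n} (below out (Suc j)) es'"
    using tracks_out[of j] tracks_out[of "Suc j"] \<open>j < n\<close> by auto
  show False
  proof (rule level_no_triple[OF es(2,1,4,3) distinct_out mem ne yz(3), of "h x"])
    show "l v \<le> h x \<and> h x \<le> h v" if "v \<in> {x, y, z}" for v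
      using that lo_hi[OF n(1)] overlap[of y x] overlap[of z x] n h assms(5,6) by auto
  qed
qed

lemma cadj_sym: "u < n \<Longrightarrow> v < n \<Longrightarrow> cadj A u v \<Longrightarrow> cadj A v u"
  using adj by (simp add: Int_commute)

lemma colors_props:
  shows "map fst (colors A) = rev (map fst out)"
    and "(v, c) \<in> set (colors A) \<Longrightarrow> \<exists>j. (v, j) \<in> set out \<and> (c = Suc (j + j) \<or> c = Suc (Suc (j + j)))"
    and "(u, c) \<in> set (colors A) \<Longrightarrow> (v, d) \<in> set (colors A) \<Longrightarrow> u \<noteq> v \<Longrightarrow> cadj A u v \<Longrightarrow> c \<noteq> d"
proof -
  have "map fst (colors A) = rev (map fst out) \<and>
    (\<forall>(v, c)\<in>set (colors A). \<exists>j. (v, j) \<in> set out \<and> (c = Suc (j + j) \<or> c = Suc (Suc (j + j)))) \<and>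
    (\<forall>(u, c)\<in>set (colors A). \<forall>(v, d)\<in>set (colors A). u \<noteq> v \<longrightarrow> cadj A u v \<longrightarrow> c \<noteq> d)"
    unfolding colors_def out_def[symmetric]
  proof (rule foldl_color_step)
    show "distinct (map fst out)" by (rule distinct_out)
    show "cadj A v u" if "u \<in> fst ` set out" "v \<in> fst ` set out" "cadj A u v" for u v
      using that cadj_sym unfolding fst_out by simp
  qed (rule out_no_triple)
  then show "map fst (colors A) = rev (map fst out)"
    "(v, c) \<in> set (colors A) \<Longrightarrow> \<exists>j. (v, j) \<in> set out \<and> (c = Suc (j + j) \<or> c = Suc (Suc (j + j)))"
    "(u, c) \<in> set (colors A) \<Longrightarrow> (v, d) \<in> set (colors A) \<Longrightarrow> u \<noteq> v \<Longrightarrow> cadj A u v \<Longrightarrow> c \<noteq> d"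
    by blast+
qed

lemma output_color_mem: "v < n \<Longrightarrow> (v, output_color (colors A) v) \<in> set (colors A)"
proof (rule output_color_in)
  assume "v < n"
  moreover have "set (map fst (colors A)) = {..<n}" unfolding colors_props(1) using fst_out by simp
  ultimately show "v \<in> fst ` set (colors A)" by simp
qed

lemma output_color_proper:
  assumes "u < n" "v < n" "u \<noteq> v" "cadj A u v"
  shows "output_color (colors A) u \<noteq> output_color (colors A) v"
  by (rule colors_props(3)[OF output_color_mem[OF assms(1)] output_color_mem[OF assms(2)] assms(3,4)])

lemma output_color_pos:
  assumes "v < n" shows "0 < output_color (colors A) v"
  using colors_props(2)[OF output_color_mem[OF assms]] by auto

lemma output_color_entropy:
  assumes "0 < n" and proper: "\<And>u v. u < n \<Longrightarrow> v < n \<Longrightarrow> u \<noteq> v \<Longrightarrow> cadj A u v \<Longrightarrow> \<psi> u \<noteq> \<psi> v"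
  shows "color_entropy {..<n} (output_color (colors A)) \<le> color_entropy {..<n} \<psi> + 1"
proof -
  have "\<forall>v\<in>{..<n}. \<exists>j. (v, j) \<in> set out \<and>
      (output_color (colors A) v = Suc (j + j) \<or> output_color (colors A) v = Suc (Suc (j + j)))"
    using colors_props(2)[OF output_color_mem] by blast
  from bchoice[OF this] obtain lev where
    lev: "\<forall>v\<in>{..<n}. (v, lev v) \<in> set out \<and> (output_color (colors A) v = Suc (lev v + lev v) \<or>
      output_color (colors A) v = Suc (Suc (lev v + lev v)))" by blast
  have below: "below out k = {v \<in> {..<n}. lev v < k}" for k
  proof -
    have "v \<in> below out k \<longleftrightarrow> v < n \<and> lev v < k" for v
    proof
      assume "v \<in> below out k"
      then obtain j where j: "j < k" "(v, j) \<in> set out" by (auto simp: below_def)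
      then have "v \<in> fst ` set out" by force
      then have "v < n" by (simp add: fst_out)
      then show "v < n \<and> lev v < k"
        using lev eq_key_imp_eq_value[OF distinct_out j(2), of "lev v"] j(1) by auto
    qed (use lev in \<open>auto simp: below_def\<close>)
    then show ?thesis by auto
  qed
  show ?thesis
  proof (rule entropy_split_levels[where lev = lev])
    fix C :: "nat set" assume "card C \<le> card {..<n}" "finite C"
    then show "card {v \<in> {..<n}. \<psi> v \<in> C} \<le> card {v \<in> {..<n}. lev v < card C}"
      using below_maximum[of "card C" C \<psi>] proper unfolding below by simp
  qed (use assms(1) lev in auto)
qed

end

lemma encode_adjacency:
  fixes n :: nat and E :: "nat set set"
  shows "encode (map (\<lambda>i. map (\<lambda>j. {i, j} \<in> E) [0..<n]) [0..<n]) = enc_graph n E"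
  by (simp add: enc_graph_def o_def)

lemma encode_coloring:
  fixes n :: nat and \<phi> :: "nat \<Rightarrow> nat"
  shows "encode (map \<phi> [0..<n]) = enc_coloring n \<phi>"
  by (simp add: enc_coloring_def o_def)

theorem theorem9:
  shows "\<exists>(alg :: com) (p :: nat poly). \<forall>(n :: nat) (E :: nat set set).
    interval_graph {..<n} E \<longrightarrow>
      (\<exists>(\<phi> :: nat \<Rightarrow> nat) (t :: nat).
         computes_in_time alg (enc_graph n E) (enc_coloring n \<phi>) t \<and>
         t \<le> poly p (data_size (enc_graph n E)) \<and>
         proper_coloring {..<n} E \<phi> \<and>
         color_entropy {..<n} \<phi> \<le> min_entropy {..<n} E + 1)"
proof -
  obtain c N p where c: "implements c N (poly p) coloring_alg"
    using ptime_coloring_alg unfolding ptime_def by blast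
  show ?thesis
  proof (intro exI[of _ c] exI[of _ p] allI impI)
    fix n :: nat and E :: "nat set set" assume G: "interval_graph {..<n} E"
    define A where "A = map (\<lambda>i. map (\<lambda>j. {i, j} \<in> E) [0..<n]) [0..<n]"
    define \<phi> where "\<phi> = output_color (colors A)"
    have len: "length A = n" by (simp add: A_def)
    have simple: "simple_graph {..<n} E" using G by (simp add: interval_graph_def)
    obtain J :: "nat \<Rightarrow> real set" where J: "\<And>v. v < n \<Longrightarrow> is_interval (J v) \<and> J v \<noteq> {}"
      "\<And>u v. u < n \<Longrightarrow> v < n \<Longrightarrow> u \<noteq> v \<Longrightarrow> {u, v} \<in> E \<longleftrightarrow> J u \<inter> J v \<noteq> {}"
      using G unfolding interval_graph_def by (metis lessThan_iff)
    have cadj: "cadj A u v \<longleftrightarrow> u = v \<or> {u, v} \<in> E" if "u < n" "v < n" for u v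
      using that by (simp add: cadj_def nth_or_nth A_def)
    \<comment> \<open>For \<open>u = v\<close> this uses that the intervals are nonempty, as
      \<open>cadj\<close> is reflexive.\<close>
    have adj: "cadj A u v \<longleftrightarrow> J u \<inter> J v \<noteq> {}" if "u < length A" "v < length A" for u v
      using that cadj J[of u] J(2)[of u v] by (cases "u = v") (auto simp: len)
    have int: "is_interval (J v)" if "v < length A" for v using J that by (simp add: len)
    have loop_free: "u \<noteq> v" if "{u, v} \<in> E" for u v
    proof
      assume "u = v"
      then have "{u} \<in> E" using that by simp
      then obtain a b where "a \<noteq> b" "{u} = {a, b}" using simple unfolding simple_graph_def by blast
      then show False by (metis insertI1 insert_commute singletonD)
    qed
    let ?s = "(\<lambda>_. Leaf)(0 := encode A)"
    have "runs c ?s (poly p (sz A)) (?s(0 := encode (coloring_alg A)))"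
      by (rule implements_runs[OF c]) auto
    then obtain t where t: "t \<le> poly p (sz A)" "exec c ?s t (?s(0 := encode (coloring_alg A)))"
      unfolding runs_def by blast
    have enc: "encode A = enc_graph n E" unfolding A_def by (rule encode_adjacency)
    have out: "encode (coloring_alg A) = enc_coloring n \<phi>"
      unfolding coloring_alg_def len \<phi>_def by (rule encode_coloring)
    have "computes_in_time c (enc_graph n E) (enc_coloring n \<phi>) t"
      unfolding computes_in_time_def
    proof (intro exI conjI)
      show "exec c ((\<lambda>_. Leaf)(0 := enc_graph n E)) t (?s(0 := encode (coloring_alg A)))"
        using t(2) by (simp only: enc)
      show "(?s(0 := encode (coloring_alg A))) 0 = enc_coloring n \<phi>"
        by (simp only: fun_upd_same out)
    qed
    moreover have "t \<le> poly p (data_size (enc_graph n E))"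
      using t(1) by (simp only: sz_def enc)
    moreover have "proper_coloring {..<n} E \<phi>"
      unfolding proper_coloring_def \<phi>_def
      using output_color_proper[OF adj int] output_color_pos[OF adj int] loop_free cadj
      by (simp add: len)
    moreover have "color_entropy {..<n} \<phi> \<le> min_entropy {..<n} E + 1"
    proof -
      obtain \<psi> where \<psi>: "proper_coloring {..<n} E \<psi>" "color_entropy {..<n} \<psi> = min_entropy {..<n} E"
        using min_entropy_attained(1)[OF simple] by blast
      show ?thesis
      \<comment> \<open>The entropy argument divides by \<open>n\<close>; without vertices every
        entropy is an empty sum.\<close>
      proof (cases "n = 0")
        case True
        then show ?thesis using \<psi>(2) by (simp add: color_entropy_def)
      next
        case False
        then have "color_entropy {..<n} \<phi> \<le> color_entropy {..<n} \<psi> + 1"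
          using output_color_entropy[OF adj int, of \<psi>] \<psi>(1) cadj
          by (simp add: len \<phi>_def proper_coloring_def)
        then show ?thesis using \<psi>(2) by simp
      qed
    qed
    ultimately show "\<exists>\<phi> t. computes_in_time c (enc_graph n E) (enc_coloring n \<phi>) t \<and>
        t \<le> poly p (data_size (enc_graph n E)) \<and> proper_coloring {..<n} E \<phi> \<and>
        color_entropy {..<n} \<phi> \<le> min_entropy {..<n} E + 1" by blast
  qed
qed

end
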